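(* Each of the following Lie groups is rigid within every almost Polish class $\mathcal K$ containing it, where in all cases $\rho$ denotes the natural representation: - $\mathbb R^n\rtimes_\rho\operatorname{O}(n)$ for $n\ge 3$; - $\mathbb R^n\rtimes_\rho\operatorname{SO}(n)$ for $n\ge 4$; - $\mathbb C^n\rtimes_\rho\operatorname{SU}(n)$ for $n\ge 2$; - $\mathbb H^n\rtimes_\rho\operatorname{Sp}(n)$ for $n\ge 1$; - $\mathbb R^{2n}\rtimes_\rho\operatorname{Sp}_{2n}(\mathbb R)$ for $n\ge 1$; - $\mathbb R^n\rtimes_\rho\operatorname{SL}_n(\mathbb R)$ for $n\ge 2$; - $\mathbb R^n\rtimes_\rho\operatorname{GL}_n(\mathbb R)$ for $n\ge 2$.
   Context: All topological spaces and groups are Hausdorff. $\operatorname{Sp}(n)$ denotes the quaternion unitary group acting on $\mathbb H^n$ ($\mathbb H$ the real quaternions), and $\operatorname{Sp}_{2n}(\mathbb R)$ denotes the group leaving the standard symplectic form on $\mathbb R^{2n}$ invariant. For a Lie group $H$ and a continuous finite dimensional real representation $\rho:H\to\operatorname{GL}(V)$, the semidirect product $V\rtimes_\rho H$ is the manifold $V\times H$ with multiplication $(u,a)(v,b)=(u+\rho(a)v,ab)$; $\mathbb C^n$ and $\mathbb H^n$ are regarded as real vector spaces. Almost open: a subset of a space $X$ is meager if it is contained in a countable union of nowhere dense subsets of $X$. A subset $E\subseteq X$ is almost open if there is an open set $U\subseteq X$ such that $(E\setminus U)\cup(U\setminus E)$ is meager in $X$. $\mathcal K$-analytic: let $\mathcal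 K$ be a class of topological spaces closed under finite products and under passage to closed subspaces. For $X\in\mathcal K$, a subset $A\subseteq X$ is $\mathcal K$-analytic if $A=\psi(Z)$ for some $Z\in\mathcal K$ and some continuous map $\psi:Z\to X$. Almost Polish: such a class $\mathcal K$ is almost Polish if (i) every member of $\mathcal K$ is Lindelöf (every open covering has a countable subcovering), (ii) no nonempty member of $\mathcal K$ is meager in itself, (iii) for every $X\in\mathcal K$, every $\mathcal K$-analytic subset of $X$ is almost open in $X$. Rigid: let $\mathcal K$ be an almost Polish class and $G$ a topological group whose underlying space belongs to $\mathcal K$. $G$ is rigid within $\mathcal K$ if for every topological group $K$ belonging to $\mathcal K$ and every abstract (not necessarily continuous) surjective group homomorphism $\phi:K\to G$ whose kernel is a $\mathcal K$-analytic subset of $K$, the homomorphism $\phi$ is continuous and open. *)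

theory Defs
  imports "HOL-Analysis.Analysis" "HOL-Algebra.Coset"
begin

section \<open>Meager and almost open sets\<close>

definition nowhere_dense_in :: "'a topology \<Rightarrow> 'a set \<Rightarrow> bool" where
  "nowhere_dense_in X A \<longleftrightarrow> A \<subseteq> topspace X \<and> X interior_of (X closure_of A) = {}"

definition meager_in :: "'a topology \<Rightarrow> 'a set \<Rightarrow> bool" where
  "meager_in X A \<longleftrightarrow>
     (\<exists>\<N>. countable \<N> \<and> (\<forall>N\<in>\<N>. nowhere_dense_in X N) \<and> A \<subseteq> \<Union>\<N>)"

definition almost_open_in :: "'a topology \<Rightarrow> 'a set \<Rightarrow> bool" where
  "almost_open_in X E \<longleftrightarrow> E \<subseteq> topspace X \<and>
     (\<exists>U. openin X U \<and> meager_in X ((E - U) \<union> (U - E)))"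


section \<open>Almost Polish classes\<close>

text \<open>
  A class of spaces is encoded by a set \<open>\<K>\<close> of topologies on subsets of an arbitrary type
  \<open>'u\<close>, which plays the role of the universe; an arbitrary space (on any type) belongs to the
  class if it is homeomorphic to a member of \<open>\<K>\<close>.
\<close>

definition in_class :: "'u topology set \<Rightarrow> 'a topology \<Rightarrow> bool" where
  "in_class \<K> X \<longleftrightarrow> (\<exists>Y\<in>\<K>. X homeomorphic_space Y)"

definition class_analytic :: "'u topology set \<Rightarrow> 'a topology \<Rightarrow> 'a set \<Rightarrow> bool" where
  "class_analytic \<K> X A \<longleftrightarrow>
     (\<exists>Z\<in>\<K>. \<exists>\<psi>. continuous_map Z X \<psi> \<and> A = \<psi> ` topspace Z)"

definition almost_Polish :: "'u topology set \<Rightarrow> bool" where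
  "almost_Polish \<K> \<longleftrightarrow>
     (\<forall>X\<in>\<K>. Hausdorff_space X) \<and>
     (\<forall>X (I :: nat set). finite I \<and> (\<forall>i\<in>I. X i \<in> \<K>) \<longrightarrow> in_class \<K> (product_topology X I)) \<and>
     (\<forall>X\<in>\<K>. \<forall>C. closedin X C \<longrightarrow> in_class \<K> (subtopology X C)) \<and>
     (\<forall>X\<in>\<K>. Lindelof_space X) \<and>
     (\<forall>X\<in>\<K>. topspace X \<noteq> {} \<longrightarrow> \<not> meager_in X (topspace X)) \<and>
     (\<forall>X\<in>\<K>. \<forall>A. class_analytic \<K> X A \<longrightarrow> almost_open_in X A)"


section \<open>Topological groups and rigidity\<close>

definition topological_group :: "('a, 'b) monoid_scheme \<Rightarrow> 'a topology \<Rightarrow> bool" where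
  "topological_group G T \<longleftrightarrow>
     group G \<and> topspace T = carrier G \<and> Hausdorff_space T \<and>
     continuous_map (prod_topology T T) T (\<lambda>(x, y). x \<otimes>\<^bsub>G\<^esub> y) \<and>
     continuous_map T T (\<lambda>x. inv\<^bsub>G\<^esub> x)"

text \<open>
  Every topological group belonging to the class is isomorphic, as a topological group, to one
  whose elements have type \<open>'u\<close>, so it suffices to let \<open>L\<close> range over the latter.
\<close>

definition rigid_within ::
  "'u topology set \<Rightarrow> ('a, 'b) monoid_scheme \<Rightarrow> 'a topology \<Rightarrow> bool" where
  "rigid_within \<K> G T \<longleftrightarrow>
     topological_group G T \<and> in_class \<K> T \<and>
     (\<forall>(L :: 'u monoid) S \<phi>.
        topological_group L S \<and> in_class \<K> S \<and> \<phi> \<in> epi L G \<and>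
        class_analytic \<K> S (kernel L G \<phi>) \<longrightarrow>
        continuous_map S T \<phi> \<and> open_map S T \<phi>)"


section \<open>Semidirect products\<close>

definition semidirect ::
  "('h, 'm) monoid_scheme \<Rightarrow> ('h \<Rightarrow> 'v \<Rightarrow> 'v) \<Rightarrow> ('v::ab_group_add \<times> 'h) monoid" where
  "semidirect H \<rho> =
     \<lparr>carrier = UNIV \<times> carrier H,
      mult = (\<lambda>(u, a) (v, b). (u + \<rho> a v, a \<otimes>\<^bsub>H\<^esub> b)),
      one = (0, \<one>\<^bsub>H\<^esub>)\<rparr>"

definition matrix_group :: "('k::semiring_1^'n^'n) set \<Rightarrow> ('k^'n^'n) monoid" where
  "matrix_group M = \<lparr>carrier = M, mult = (**), one = mat 1\<rparr>"

definition affine_group :: "('k::ring_1^'n^'n) set \<Rightarrow> (('k^'n) \<times> ('k^'n^'n)) monoid" where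
  "affine_group M = semidirect (matrix_group M) (*v)"

definition affine_topology ::
  "('k::topological_space^'n^'n) set \<Rightarrow> (('k^'n) \<times> ('k^'n^'n)) topology" where
  "affine_topology M = prod_topology euclidean (top_of_set M)"


section \<open>Quaternions\<close>

codatatype quat = Quat (qRe: real) (qI: real) (qJ: real) (qK: real)

lemma quat_eq_iff: "x = y \<longleftrightarrow> qRe x = qRe y \<and> qI x = qI y \<and> qJ x = qJ y \<and> qK x = qK y"
  by (auto intro: quat.expand)

instantiation quat :: ring_1
begin

primcorec zero_quat where
  "qRe 0 = 0" | "qI 0 = 0" | "qJ 0 = 0" | "qK 0 = 0"

primcorec one_quat where
  "qRe 1 = 1" | "qI 1 = 0" | "qJ 1 = 0" | "qK 1 = 0"

primcorec plus_quat where
  "qRe (x + y) = qRe x + qRe y"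
| "qI (x + y) = qI x + qI y"
| "qJ (x + y) = qJ x + qJ y"
| "qK (x + y) = qK x + qK y"

primcorec uminus_quat where
  "qRe (- x) = - qRe x"
| "qI (- x) = - qI x"
| "qJ (- x) = - qJ x"
| "qK (- x) = - qK x"

primcorec minus_quat where
  "qRe (x - y) = qRe x - qRe y"
| "qI (x - y) = qI x - qI y"
| "qJ (x - y) = qJ x - qJ y"
| "qK (x - y) = qK x - qK y"

primcorec times_quat where
  "qRe (x * y) = qRe x * qRe y - qI x * qI y - qJ x * qJ y - qK x * qK y"
| "qI (x * y) = qRe x * qI y + qI x * qRe y + qJ x * qK y - qK x * qJ y"
| "qJ (x * y) = qRe x * qJ y - qI x * qK y + qJ x * qRe y + qK x * qI y"
| "qK (x * y) = qRe x * qK y + qI x * qJ y - qJ x * qI y + qK x * qRe y"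

instance
  by standard (simp_all add: quat_eq_iff algebra_simps)

end

instantiation quat :: real_algebra_1
begin

primcorec scaleR_quat where
  "qRe (r *\<^sub>R x) = r * qRe x"
| "qI (r *\<^sub>R x) = r * qI x"
| "qJ (r *\<^sub>R x) = r * qJ x"
| "qK (r *\<^sub>R x) = r * qK x"

instance
  by standard (simp_all add: quat_eq_iff algebra_simps)

end

instantiation quat :: real_normed_algebra_1
begin

definition norm_quat :: "quat \<Rightarrow> real" where
  "norm x = sqrt ((qRe x)\<^sup>2 + (qI x)\<^sup>2 + (qJ x)\<^sup>2 + (qK x)\<^sup>2)"

definition sgn_quat :: "quat \<Rightarrow> quat" where
  "sgn (x :: quat) = x /\<^sub>R norm x"

definition dist_quat :: "quat \<Rightarrow> quat \<Rightarrow> real" where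
  "dist (x :: quat) y = norm (x - y)"

definition uniformity_quat :: "(quat \<times> quat) filter" where
  "(uniformity :: (quat \<times> quat) filter) = (INF e\<in>{0 <..}. principal {(x :: quat, y). dist x y < e})"

definition open_quat :: "quat set \<Rightarrow> bool" where
  "open (U :: quat set) \<longleftrightarrow> (\<forall>x\<in>U. eventually (\<lambda>(x', y). x' = x \<longrightarrow> y \<in> U) uniformity)"

instance
proof
  fix r :: real and x y :: quat
  have tuple: "norm z = norm (qRe z, qI z, qJ z, qK z)" for z :: quat
    by (simp add: norm_quat_def norm_Pair add.assoc)
  show "(norm x = 0) = (x = 0)"
    by (simp add: tuple quat_eq_iff zero_prod_def)
  show "norm (x + y) \<le> norm x + norm y"
    using norm_triangle_ineq[of "(qRe x, qI x, qJ x, qK x)" "(qRe y, qI y, qJ y, qK y)"]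
    by (simp add: tuple)
  show "norm (r *\<^sub>R x) = \<bar>r\<bar> * norm x"
    using norm_scaleR[of r "(qRe x, qI x, qJ x, qK x)"]
    by (simp add: tuple)
  show "norm (x * y) \<le> norm x * norm y"
    by (simp add: norm_quat_def real_sqrt_mult [symmetric] power2_eq_square algebra_simps)
  show "norm (1 :: quat) = 1"
    by (simp add: norm_quat_def)
qed (rule sgn_quat_def dist_quat_def open_quat_def uniformity_quat_def)+

end

primcorec qcnj :: "quat \<Rightarrow> quat" where
  "qRe (qcnj x) = qRe x"
| "qI (qcnj x) = - qI x"
| "qJ (qcnj x) = - qJ x"
| "qK (qcnj x) = - qK x"


section \<open>The classical matrix groups\<close>

definition O_mats :: "(real^'n^'n) set" where
  "O_mats = {A. orthogonal_matrix A}"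

definition SO_mats :: "(real^'n^'n) set" where
  "SO_mats = {A. rotation_matrix A}"

definition cadjoint :: "complex^'n^'m \<Rightarrow> complex^'m^'n" where
  "cadjoint A = (\<chi> i j. cnj (A $ j $ i))"

definition SU_mats :: "(complex^'n^'n) set" where
  "SU_mats = {A. cadjoint A ** A = mat 1 \<and> A ** cadjoint A = mat 1 \<and> det A = 1}"

definition qadjoint :: "quat^'n^'m \<Rightarrow> quat^'m^'n" where
  "qadjoint A = (\<chi> i j. qcnj (A $ j $ i))"

text \<open>
  \<open>\<bbbH>\<^sup>n\<close> is a right \<open>\<bbbH>\<close>-module, on which matrices act \<open>\<bbbH>\<close>-linearly from the left.
\<close>

definition Sp_mats :: "(quat^'n^'n) set" where
  "Sp_mats = {A. qadjoint A ** A = mat 1 \<and> A ** qadjoint A = mat 1}"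

text \<open>The coordinates of \<open>\<real>\<^sup>2\<^sup>n\<close> are indexed by two disjoint copies of \<open>'n\<close>.\<close>

definition symplectic_form :: "real^('n::finite + 'n) \<Rightarrow> real^('n + 'n) \<Rightarrow> real" where
  "symplectic_form x y = (\<Sum>i\<in>UNIV. x $ Inl i * y $ Inr i - x $ Inr i * y $ Inl i)"

definition SpR_mats :: "(real^('n::finite + 'n)^('n + 'n)) set" where
  "SpR_mats = {A. \<forall>x y. symplectic_form (A *v x) (A *v y) = symplectic_form x y}"

definition SL_mats :: "(real^'n^'n) set" where
  "SL_mats = {A. det A = 1}"

definition GL_mats :: "(real^'n^'n) set" where
  "GL_mats = {A. invertible A}"

end

theory Submission
  imports Defs
begin

text \<open>
  Let \<open>\<phi>\<close> be a surjective homomorphism onto \<open>G\<close> with analytic kernel. A subset of \<open>G\<close> defined by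
  finitely many equations and existential quantifiers in the language of groups, with parameters from
  \<open>G\<close>, has an analytic, hence almost open, preimage. By the theorem of Pettis and the Lindelof property
  it follows that \<open>\<phi>\<close> is continuous as soon as every neighbourhood of \<open>1\<close> contains countably many such
  definable sets that together cover a smaller neighbourhood; openness then follows by applying the
  theorem of Pettis in \<open>G\<close>.

  For a group of affine maps with matrix part \<open>M\<close> there are two tasks. First, arbitrarily small
  neighbourhoods of \<open>0\<close> in the translation group have to be defined: for bounded \<open>M\<close> these are sums of
  orbits of short vectors, and for the other groups one uses that a half line is the set of squares in
  a torus, so that intervals are definable. The matrices that displace the basis vectors by small
  amounts are then also definable. Second, the stabilizer of the origin has to be a countable union of
  definable sets. It is the centralizer of a central matrix without eigenvalue \<open>1\<close> if there is one;
  for \<open>SL\<close> and for \<open>SO\<close> in odd dimensions it is generated by finitely many definable subsets that are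
  obtained from centralizers of suitable diagonal matrices.
\<close>

section \<open>Meager sets and analytic sets\<close>

text \<open>The axioms of the class give images, preimages, products and finite intersections of
  analytic sets, but neither complements nor countable unions. Every small set must therefore be
  described positively and existentially, and inequalities have to be expressed through orbits and
  squares. Countable families enter only through Baire category, where it suffices that one member
  of the family has a nonmeager preimage. This is why the stabilizer of the origin is needed only as
  a countable union, not as a single definable set. Conjugating the translation by \<open>v\<close>
  with \<open>(u, A)\<close> gives the translation by \<open>A *v v\<close>. This action sees
  \<open>A\<close> but not \<open>u\<close>, which is what separates the two tasks: closeness of
  \<open>A\<close> to the identity is read off from the action, whereas the condition
  \<open>u = 0\<close> has to be imposed by other means. A small translation is multiplied in
  afterwards.\<close>

lemma meager_in_subset: "meager_in X A \<Longrightarrow> B \<subseteq> A \<Longrightarrow> meager_in X B"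
  unfolding meager_in_def by (meson order_trans)

lemma meager_in_Union:
  assumes "countable \<A>" "\<And>A. A \<in> \<A> \<Longrightarrow> meager_in X A"
  shows "meager_in X (\<Union>\<A>)"
proof -
  have "\<forall>A\<in>\<A>. \<exists>\<N>. countable \<N> \<and> (\<forall>N\<in>\<N>. nowhere_dense_in X N) \<and> A \<subseteq> \<Union>\<N>"
    using assms(2) unfolding meager_in_def by (intro ballI)
  from bchoice[OF this] obtain \<N> where \<N>: "\<forall>A\<in>\<A>. countable (\<N> A) \<and> (\<forall>N\<in>\<N> A. nowhere_dense_in X N) \<and> A \<subseteq> \<Union>(\<N> A)"
    ..
  show ?thesis
    unfolding meager_in_def
  proof (intro exI conjI)
    show "countable (\<Union>(\<N> ` \<A>))"
      using \<N> assms(1) by simp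
    show "\<forall>N\<in>\<Union>(\<N> ` \<A>). nowhere_dense_in X N"
      using \<N> by simp
    show "\<Union>\<A> \<subseteq> \<Union>(\<Union>(\<N> ` \<A>))"
      using \<N> by fastforce
  qed
qed

lemma meager_in_Un: "meager_in X A \<Longrightarrow> meager_in X B \<Longrightarrow> meager_in X (A \<union> B)"
  using meager_in_Union[of "{A, B}" X] by auto

lemma meager_in_homeomorphic_image:
  assumes h: "homeomorphic_map X Y h" and A: "meager_in X A"
  shows "meager_in Y (h ` A)"
proof -
  obtain \<N> where \<N>: "countable \<N>" "\<And>N. N \<in> \<N> \<Longrightarrow> nowhere_dense_in X N" "A \<subseteq> \<Union>\<N>"
    using A unfolding meager_in_def by blast
  have "nowhere_dense_in Y (h ` N)" if "N \<in> \<N>" for N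
  proof -
    have N: "N \<subseteq> topspace X" "X interior_of (X closure_of N) = {}"
      using \<N>(2)[OF that] by (auto simp: nowhere_dense_in_def)
    have "Y interior_of (Y closure_of (h ` N)) = h ` (X interior_of (X closure_of N))"
      using N(1) h
      by (simp add: homeomorphic_map_closure_of homeomorphic_map_interior_of closure_of_subset_topspace)
    moreover have "h ` N \<subseteq> topspace Y"
      using h N(1) by (metis homeomorphic_imp_surjective_map image_mono)
    ultimately show ?thesis
      using N(2) by (simp add: nowhere_dense_in_def)
  qed
  then show ?thesis
    unfolding meager_in_def using \<N>(1,3) by (intro exI[of _ "(`) h ` \<N>"]) fastforce
qed

lemma almost_open_in_homeomorphic_image:
  assumes h: "homeomorphic_map X Y h" and A: "almost_open_in X A"
  shows "almost_open_in Y (h ` A)"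
proof -
  obtain U where U: "A \<subseteq> topspace X" "openin X U" "meager_in X ((A - U) \<union> (U - A))"
    using A unfolding almost_open_in_def by blast
  have inj: "inj_on h (topspace X)"
    using h by (simp add: homeomorphic_imp_injective_map)
  have US: "U \<subseteq> topspace X"
    by (simp add: U(2) openin_subset)
  have "h ` ((A - U) \<union> (U - A)) = (h ` A - h ` U) \<union> (h ` U - h ` A)"
    using inj_on_image_set_diff[OF inj] U(1) US by (simp add: image_Un Diff_subset_conv le_supI2)
  then have "meager_in Y ((h ` A - h ` U) \<union> (h ` U - h ` A))"
    using meager_in_homeomorphic_image[OF h U(3)] by simp
  moreover have "openin Y (h ` U)"
    using h U(2) US homeomorphic_map_openness_eq by blast
  moreover have "h ` A \<subseteq> topspace Y"
    using h U(1) by (metis homeomorphic_imp_surjective_map image_mono)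
  ultimately show ?thesis
    unfolding almost_open_in_def by blast
qed

lemma class_analytic_subset_topspace: "class_analytic \<K> X A \<Longrightarrow> A \<subseteq> topspace X"
  unfolding class_analytic_def by (auto simp: continuous_map_def)

lemma class_analytic_continuous_image:
  assumes "class_analytic \<K> X A" "continuous_map X Y f"
  shows "class_analytic \<K> Y (f ` A)"
proof -
  obtain Z \<psi> where "Z \<in> \<K>" "continuous_map Z X \<psi>" "A = \<psi> ` topspace Z"
    using assms(1) unfolding class_analytic_def by blast
  then show ?thesis
    unfolding class_analytic_def
    using continuous_map_compose[OF _ assms(2)] by (metis image_comp)
qed

lemma class_analytic_topspace:
  assumes "in_class \<K> X"
  shows "class_analytic \<K> X (topspace X)"
proof -
  obtain Y f g where Y: "Y \<in> \<K>" "homeomorphic_maps X Y f g"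
    using assms unfolding in_class_def homeomorphic_space_def by blast
  then have "homeomorphic_map Y X g"
    using homeomorphic_maps_map by blast
  then have "continuous_map Y X g" "topspace X = g ` topspace Y"
    by (simp_all add: homeomorphic_imp_continuous_map homeomorphic_imp_surjective_map)
  then show ?thesis
    unfolding class_analytic_def using Y(1) by blast
qed

section \<open>Closure properties of analytic sets, with the axioms transferred along
  homeomorphisms\<close>

context
  fixes \<K> :: "'u topology set"
  assumes K: "almost_Polish \<K>"
begin

lemma in_class_Lindelof_space:
  assumes "in_class \<K> X"
  shows "Lindelof_space X"
proof -
  obtain Z \<psi> where Z: "Z \<in> \<K>" "continuous_map Z X \<psi>" "topspace X = \<psi> ` topspace Z"
    using class_analytic_topspace[OF assms] unfolding class_analytic_def by blast
  moreover have "Lindelof_space Z"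
    using K Z(1) unfolding almost_Polish_def by blast
  ultimately show ?thesis
    using Lindelof_space_continuous_map_image by metis
qed

lemma in_class_not_meager:
  assumes "in_class \<K> X" "topspace X \<noteq> {}"
  shows "\<not> meager_in X (topspace X)"
proof
  assume m: "meager_in X (topspace X)"
  obtain Y h where Y: "Y \<in> \<K>" "homeomorphic_map X Y h"
    using assms(1) unfolding in_class_def homeomorphic_space by blast
  then have e: "h ` topspace X = topspace Y"
    by (simp add: homeomorphic_imp_surjective_map)
  have "meager_in Y (topspace Y)"
    using meager_in_homeomorphic_image[OF Y(2) m] e by simp
  moreover have "topspace Y \<noteq> {}"
    using e assms(2) by auto
  ultimately show False
    using K Y(1) unfolding almost_Polish_def by blast
qed

lemma class_analytic_almost_open:
  assumes "in_class \<K> X" "class_analytic \<K> X A"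
  shows "almost_open_in X A"
proof -
  obtain Y h g where Y: "Y \<in> \<K>" "homeomorphic_maps X Y h g"
    using assms(1) unfolding in_class_def homeomorphic_space_def by blast
  have "class_analytic \<K> Y (h ` A)"
    using Y(2) by (intro class_analytic_continuous_image[OF assms(2)]) (simp add: homeomorphic_maps_def)
  then have "almost_open_in Y (h ` A)"
    using K Y(1) unfolding almost_Polish_def by blast
  then have "almost_open_in X (g ` h ` A)"
    using Y(2) almost_open_in_homeomorphic_image homeomorphic_maps_map by blast
  moreover have "g ` h ` A = A"
    using Y(2) class_analytic_subset_topspace[OF assms(2)]
    by (force simp: homeomorphic_maps_def image_iff)
  ultimately show ?thesis
    by simp
qed

lemma class_analytic_closedin:
  assumes "in_class \<K> X" "closedin X C"
  shows "class_analytic \<K> X C"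
proof -
  obtain Y h g where Y: "Y \<in> \<K>" "homeomorphic_maps X Y h g"
    using assms(1) unfolding in_class_def homeomorphic_space_def by blast
  have "closedin Y (h ` C)"
    using Y(2) assms(2) homeomorphic_map_closedness_eq homeomorphic_maps_map by blast
  then have "in_class \<K> (subtopology Y (h ` C))"
    using K Y(1) unfolding almost_Polish_def by blast
  then have "class_analytic \<K> (subtopology Y (h ` C)) (topspace (subtopology Y (h ` C)))"
    by (rule class_analytic_topspace)
  moreover have gh: "g ` h ` C = C"
    using Y(2) closedin_subset[OF assms(2)]
    by (force simp: homeomorphic_maps_def image_iff)
  moreover have "topspace (subtopology Y (h ` C)) = h ` C"
    using \<open>closedin Y (h ` C)\<close> closedin_subset by fastforce
  moreover have "continuous_map (subtopology Y (h ` C)) X g"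
    using Y(2) by (simp add: homeomorphic_maps_def continuous_map_from_subtopology)
  ultimately show ?thesis
    using class_analytic_continuous_image by fastforce
qed

text \<open>Products, preimages and intersections of analytic sets all reduce to this. The fibre
  product is closed in the product because \<open>X\<close> is Hausdorff. It belongs to the class
  only up to homeomorphism, so it is parametrized by some \<open>Z\<close> in \<open>\<K>\<close>
  itself, of which only the joint image under \<open>p1\<close> and \<open>p2\<close> is
  recorded.\<close>

lemma class_fibre_product:
  assumes Z: "Z1 \<in> \<K>" "Z2 \<in> \<K>"
    and f: "continuous_map Z1 X f1" "continuous_map Z2 X f2" and X: "Hausdorff_space X"
  obtains Z p1 p2 where "Z \<in> \<K>" "continuous_map Z Z1 p1" "continuous_map Z Z2 p2"
    "(\<lambda>z. (p1 z, p2 z)) ` topspace Z = {(a, b). a \<in> topspace Z1 \<and> b \<in> topspace Z2 \<and> f1 a = f2 b}"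
proof -
  \<comment> \<open>The class is closed under products over finite sets of naturals, so a pair of
    spaces becomes a family over \<open>{0, 1}\<close>.\<close>
  define F where "F = (\<lambda>i::nat. if i = 0 then Z1 else Z2)"
  define P where "P = product_topology F {0, 1}"
  have "in_class \<K> P"
    using K Z unfolding almost_Polish_def P_def F_def by simp
  moreover define C where "C = {y \<in> topspace P. f1 (y 0) = f2 (y 1)}"
  have c0: "continuous_map P Z1 (\<lambda>y. y 0)" and c1: "continuous_map P Z2 (\<lambda>y. y 1)"
    using continuous_map_product_projection[of 0 "{0, 1}" F]
      continuous_map_product_projection[of 1 "{0, 1}" F] by (simp_all add: P_def F_def)
  have "closedin P C"
    unfolding C_def using closedin_continuous_maps_eq[OF X]
      continuous_map_compose[OF c0 f(1)] continuous_map_compose[OF c1 f(2)]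
    by (fastforce simp: o_def)
  ultimately obtain Z \<psi> where Zp: "Z \<in> \<K>" "continuous_map Z P \<psi>" "C = \<psi> ` topspace Z"
    using class_analytic_closedin unfolding class_analytic_def by blast
  have "(\<lambda>z. (\<psi> z 0, \<psi> z 1)) ` topspace Z = (\<lambda>y. (y 0, y 1)) ` C"
    by (auto simp: Zp(3))
  also have "\<dots> = {(a, b). a \<in> topspace Z1 \<and> b \<in> topspace Z2 \<and> f1 a = f2 b}"
  proof (rule equalityI; rule subsetI)
    fix p assume "p \<in> (\<lambda>y. (y 0, y 1)) ` C"
    then show "p \<in> {(a, b). a \<in> topspace Z1 \<and> b \<in> topspace Z2 \<and> f1 a = f2 b}"
      by (auto simp: C_def P_def F_def PiE_iff)
  next
    fix p assume p: "p \<in> {(a, b). a \<in> topspace Z1 \<and> b \<in> topspace Z2 \<and> f1 a = f2 b}"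
    \<comment> \<open>Points of a product topology are extensional, so \<open>y\<close> has to be
      \<open>undefined\<close> off \<open>{0, 1}\<close>.\<close>
    define y where "y = (\<lambda>i::nat. if i = 0 then fst p else if i = 1 then snd p else undefined)"
    have "y \<in> C"
      using p by (auto simp: C_def P_def F_def PiE_iff y_def extensional_def)
    moreover have "p = (y 0, y 1)"
      by (simp add: y_def)
    ultimately show "p \<in> (\<lambda>y. (y 0, y 1)) ` C"
      by blast
  qed
  finally show thesis
    using that[OF Zp(1), of "\<lambda>z. \<psi> z 0" "\<lambda>z. \<psi> z 1"]
      continuous_map_compose[OF Zp(2) c0] continuous_map_compose[OF Zp(2) c1] by (simp add: o_def)
qed

lemma class_analytic_Times:
  assumes "class_analytic \<K> X A" "class_analytic \<K> Y B"
  shows "class_analytic \<K> (prod_topology X Y) (A \<times> B)"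
proof -
  obtain Z1 \<psi>1 where 1: "Z1 \<in> \<K>" "continuous_map Z1 X \<psi>1" "A = \<psi>1 ` topspace Z1"
    using assms(1) unfolding class_analytic_def by blast
  obtain Z2 \<psi>2 where 2: "Z2 \<in> \<K>" "continuous_map Z2 Y \<psi>2" "B = \<psi>2 ` topspace Z2"
    using assms(2) unfolding class_analytic_def by blast
  \<comment> \<open>The fibre product over a one point space is the full product; the condition
    \<open>() = ()\<close> is void.\<close>
  obtain Z p1 p2 where Z: "Z \<in> \<K>" "continuous_map Z Z1 p1" "continuous_map Z Z2 p2"
    "(\<lambda>z. (p1 z, p2 z)) ` topspace Z = {(a, b). a \<in> topspace Z1 \<and> b \<in> topspace Z2 \<and> () = ()}"
    by (rule class_fibre_product[OF 1(1) 2(1), of "discrete_topology {()}" "\<lambda>_. ()" "\<lambda>_. ()"])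
      (auto simp: Hausdorff_space_discrete_topology)
  have "continuous_map Z (prod_topology X Y) (\<lambda>z. (\<psi>1 (p1 z), \<psi>2 (p2 z)))"
    using continuous_map_compose[OF Z(2) 1(2)] continuous_map_compose[OF Z(3) 2(2)]
    by (simp add: continuous_map_pairwise o_def)
  moreover have "(\<lambda>z. (\<psi>1 (p1 z), \<psi>2 (p2 z))) ` topspace Z
      = (\<lambda>(a, b). (\<psi>1 a, \<psi>2 b)) ` (\<lambda>z. (p1 z, p2 z)) ` topspace Z"
    by (simp add: image_image)
  then have "(\<lambda>z. (\<psi>1 (p1 z), \<psi>2 (p2 z))) ` topspace Z = A \<times> B"
    unfolding Z(4) by (auto simp: 1(3) 2(3))
  ultimately show ?thesis
    unfolding class_analytic_def using Z(1) by metis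
qed

text \<open>The preimage is a projection of the fibre product of \<open>f\<close> with a
  parametrization of \<open>A\<close>.\<close>

lemma class_analytic_vimage:
  assumes S: "in_class \<K> S" and f: "continuous_map S X f" and X: "Hausdorff_space X"
    and A: "class_analytic \<K> X A"
  shows "class_analytic \<K> S {x \<in> topspace S. f x \<in> A}"
proof -
  obtain Y h g where Y: "Y \<in> \<K>" "homeomorphic_maps S Y h g"
    using S unfolding in_class_def homeomorphic_space_def by blast
  obtain W \<psi> where W: "W \<in> \<K>" "continuous_map W X \<psi>" "A = \<psi> ` topspace W"
    using A unfolding class_analytic_def by blast
  have g: "continuous_map Y S g"
    using Y(2) by (simp add: homeomorphic_maps_def)
  obtain Z p1 p2 where Z: "Z \<in> \<K>" "continuous_map Z Y p1" "continuous_map Z W p2"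
    "(\<lambda>z. (p1 z, p2 z)) ` topspace Z = {(a, b). a \<in> topspace Y \<and> b \<in> topspace W \<and> (f \<circ> g) a = \<psi> b}"
    using class_fibre_product[OF Y(1) W(1) continuous_map_compose[OF g f] W(2) X] by blast
  have "(\<lambda>z. g (p1 z)) ` topspace Z = (g \<circ> fst) ` (\<lambda>z. (p1 z, p2 z)) ` topspace Z"
    by (simp add: image_image)
  also have "\<dots> = {g a |a. a \<in> topspace Y \<and> f (g a) \<in> A}"
    unfolding Z(4) W(3) by (fastforce simp: image_iff)
  also have "\<dots> = {x \<in> topspace S. f x \<in> A}"
    using Y(2) unfolding homeomorphic_maps_def continuous_map_def
    by (auto simp: Pi_iff) metis
  finally show ?thesis
    unfolding class_analytic_def using Z(1) continuous_map_compose[OF Z(2) g]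
    by (metis (no_types, lifting) comp_apply image_cong)
qed

text \<open>The intersection is the preimage of \<open>A \<times> B\<close> under the diagonal
  map.\<close>

lemma class_analytic_Int:
  assumes S: "in_class \<K> S" "Hausdorff_space S"
    and A: "class_analytic \<K> S A" and B: "class_analytic \<K> S B"
  shows "class_analytic \<K> S (A \<inter> B)"
proof -
  have "continuous_map S (prod_topology S S) (\<lambda>x. (x, x))"
    by (simp add: continuous_map_pairwise o_def)
  then have "class_analytic \<K> S {x \<in> topspace S. (x, x) \<in> A \<times> B}"
    using S(2) by (intro class_analytic_vimage[OF S(1) _ _ class_analytic_Times[OF A B]])
      (simp_all add: Hausdorff_space_prod_topology)
  moreover have "{x \<in> topspace S. (x, x) \<in> A \<times> B} = A \<inter> B"
    using class_analytic_subset_topspace[OF A] by auto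
  ultimately show ?thesis
    by simp
qed

end

section \<open>The theorem of Pettis\<close>

locale topgroup =
  fixes G :: "('a, 'b) monoid_scheme" (structure) and T :: "'a topology"
  assumes topological_group: "topological_group G T"
begin

sublocale group G
  using topological_group by (simp add: topological_group_def)

lemma topspace_eq: "topspace T = carrier G"
  using topological_group by (simp add: topological_group_def)

lemma Hausdorff: "Hausdorff_space T"
  using topological_group by (simp add: topological_group_def)

lemma continuous_map_mult:
  assumes "continuous_map X T f" "continuous_map X T g"
  shows "continuous_map X T (\<lambda>x. f x \<otimes> g x)"
proof -
  have "continuous_map X (prod_topology T T) (\<lambda>x. (f x, g x))"
    using assms by (simp add: continuous_map_pairwise o_def)
  moreover have "continuous_map (prod_topology T T) T (\<lambda>(x, y). x \<otimes> y)"
    using topological_group by (simp add: topological_group_def)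
  ultimately show ?thesis
    using continuous_map_compose by (fastforce simp: o_def)
qed

lemma continuous_map_inv:
  assumes "continuous_map X T f"
  shows "continuous_map X T (\<lambda>x. inv (f x))"
proof -
  have "continuous_map T T (\<lambda>x. inv x)"
    using topological_group by (simp add: topological_group_def)
  then show ?thesis
    using continuous_map_compose[OF assms] by (fastforce simp: o_def)
qed

lemma continuous_map_group_const:
  assumes "g \<in> carrier G"
  shows "continuous_map X T (\<lambda>x. g)"
  using assms by (simp add: topspace_eq)

lemmas continuous_map_group_intros =
  continuous_map_mult continuous_map_inv continuous_map_group_const continuous_map_id[unfolded id_def]

lemma homeomorphic_map_left_translation:
  assumes g: "g \<in> carrier G"
  shows "homeomorphic_map T T (\<lambda>x. g \<otimes> x)"
proof -
  have "homeomorphic_maps T T (\<lambda>x. g \<otimes> x) (\<lambda>x. inv g \<otimes> x)"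
    unfolding homeomorphic_maps_def
    using g by (auto simp: topspace_eq m_assoc[symmetric] intro!: continuous_map_group_intros)
  then show ?thesis
    using homeomorphic_maps_map by blast
qed

lemma openin_left_translation:
  "g \<in> carrier G \<Longrightarrow> openin T U \<Longrightarrow> openin T ((\<lambda>x. g \<otimes> x) ` U)"
  using homeomorphic_map_left_translation homeomorphic_map_openness_eq by blast

text \<open>The Lindelof axiom enters through this cover. Translations are homeomorphisms, so if the
  covering set were meager, the whole group would be.\<close>

lemma Lindelof_translation_cover:
  assumes L: "Lindelof_space T" and U: "openin T U" "U \<noteq> {}"
  obtains Q where "countable Q" "Q \<subseteq> carrier G" "carrier G \<subseteq> (\<Union>q\<in>Q. (\<lambda>x. q \<otimes> x) ` U)"
proof -
  obtain u where u: "u \<in> U" "u \<in> carrier G"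
    using U openin_subset[OF U(1)] topspace_eq by auto
  let ?\<U> = "(\<lambda>q. (\<lambda>x. q \<otimes> x) ` U) ` carrier G"
  have op: "\<And>V. V \<in> ?\<U> \<Longrightarrow> openin T V"
    using openin_left_translation[OF _ U(1)] by blast
  have "x \<in> \<Union>?\<U>" if "x \<in> carrier G" for x
  proof -
    have "x = (x \<otimes> inv u) \<otimes> u"
      using that u by (simp add: m_assoc)
    then show ?thesis
      using that u by (metis UN_I image_eqI inv_closed m_closed)
  qed
  moreover have "\<Union>?\<U> \<subseteq> carrier G"
    using op openin_subset topspace_eq by blast
  ultimately have "\<Union>?\<U> = topspace T"
    unfolding topspace_eq by blast
  then obtain \<V> where "countable \<V>" "\<V> \<subseteq> ?\<U>" "\<Union>\<V> = topspace T"
    using L op unfolding Lindelof_space_def by meson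
  moreover obtain Q where "countable Q" "Q \<subseteq> carrier G" "\<V> = (\<lambda>q. (\<lambda>x. q \<otimes> x) ` U) ` Q"
    using countable_subset_image[of \<V>] calculation(1,2) by meson
  ultimately show thesis
    using that topspace_eq by simp
qed

lemma nonmeager_openin:
  assumes L: "Lindelof_space T" and nm: "\<not> meager_in T (carrier G)"
    and U: "openin T U" "U \<noteq> {}"
  shows "\<not> meager_in T U"
proof
  assume m: "meager_in T U"
  obtain Q where Q: "countable Q" "Q \<subseteq> carrier G" "carrier G \<subseteq> (\<Union>q\<in>Q. (\<lambda>x. q \<otimes> x) ` U)"
    using Lindelof_translation_cover[OF L U] .
  have "meager_in T (\<Union>q\<in>Q. (\<lambda>x. q \<otimes> x) ` U)"
    using Q(1,2) by (intro meager_in_Union)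
      (auto intro!: meager_in_homeomorphic_image[OF homeomorphic_map_left_translation m])
  then show False
    using nm Q(3) meager_in_subset by blast
qed

text \<open>\<open>A\<close> agrees with an open set \<open>U\<close> up to a meager set. For
  \<open>g\<close> near the identity, \<open>U\<close> meets its translate by the inverse of
  \<open>g\<close> in a nonempty open, hence nonmeager set. The points \<open>b\<close> there for
  which \<open>b\<close> or \<open>g \<otimes> b\<close> lies outside \<open>A\<close> form a meager
  set, so some \<open>b\<close> has both in \<open>A\<close>.\<close>

lemma Pettis:
  assumes L: "Lindelof_space T" and nm: "\<not> meager_in T (carrier G)"
    and A: "almost_open_in T A" "\<not> meager_in T A"
  obtains W where "openin T W" "\<one> \<in> W" "\<And>g. g \<in> W \<Longrightarrow> \<exists>a\<in>A. \<exists>b\<in>A. g = a \<otimes> inv b"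
proof -
  obtain U where U: "openin T U" "meager_in T ((A - U) \<union> (U - A))"
    using A(1) unfolding almost_open_in_def by blast
  have Ac: "A \<subseteq> carrier G"
    using A(1) by (simp add: almost_open_in_def topspace_eq)
  have Uc: "U \<subseteq> carrier G"
    using openin_subset[OF U(1)] topspace_eq by simp
  have "U \<noteq> {}"
  proof
    assume "U = {}"
    then show False
      using U(2) A(2) by simp
  qed
  then obtain u where u: "u \<in> U"
    by blast
  \<comment> \<open>The set of quotients of elements of \<open>U\<close>, written as a union of
    preimages of \<open>U\<close> so that openness is visible.\<close>
  define W where "W = (\<Union>u\<in>U. {g \<in> carrier G. g \<otimes> u \<in> U})"
  have "openin T {g \<in> topspace T. g \<otimes> v \<in> U}" if "v \<in> U" for v
    using that Uc
    by (intro openin_continuous_map_preimage[OF _ U(1)] continuous_map_group_intros) auto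
  then have "openin T W"
    unfolding W_def topspace_eq by blast
  moreover have "\<one> \<in> W"
    using u Uc unfolding W_def by force
  moreover have "\<exists>a\<in>A. \<exists>b\<in>A. g = a \<otimes> inv b" if "g \<in> W" for g
  proof -
    have g: "g \<in> carrier G"
      using that unfolding W_def by blast
    let ?O = "U \<inter> {x \<in> topspace T. g \<otimes> x \<in> U}"
    have "openin T {x \<in> topspace T. g \<otimes> x \<in> U}"
      using g by (intro openin_continuous_map_preimage[OF _ U(1)] continuous_map_group_intros) auto
    then have "openin T ?O"
      using U(1) by blast
    moreover have "?O \<noteq> {}"
      using that Uc unfolding W_def topspace_eq by blast
    ultimately have nmO: "\<not> meager_in T ?O"
      using nonmeager_openin[OF L nm] by blast
    have mUA: "meager_in T (U - A)"
      using U(2) meager_in_subset by blast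
    have "\<exists>b\<in>A. g \<otimes> b \<in> A"
    proof (rule ccontr)
      assume none: "\<not> (\<exists>b\<in>A. g \<otimes> b \<in> A)"
      have "?O \<subseteq> (U - A) \<union> (\<lambda>x. inv g \<otimes> x) ` (U - A)"
      proof
        fix x assume x: "x \<in> ?O"
        show "x \<in> (U - A) \<union> (\<lambda>x. inv g \<otimes> x) ` (U - A)"
        proof (cases "x \<in> A")
          case True
          then have "g \<otimes> x \<in> U - A"
            using x none by blast
          moreover have "x = inv g \<otimes> (g \<otimes> x)"
            using x g Uc by (auto simp: m_assoc[symmetric])
          ultimately show ?thesis
            by blast
        qed (use x in blast)
      qed
      moreover have "meager_in T ((\<lambda>x. inv g \<otimes> x) ` (U - A))"
        using meager_in_homeomorphic_image[OF homeomorphic_map_left_translation mUA] g by simp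
      ultimately show False
        using meager_in_subset[OF meager_in_Un[OF mUA]] nmO by blast
    qed
    then obtain b where "b \<in> A" "g \<otimes> b \<in> A"
      by blast
    moreover have "g = (g \<otimes> b) \<otimes> inv b"
      using g \<open>b \<in> A\<close> Ac by (auto simp: m_assoc)
    ultimately show ?thesis
      by blast
  qed
  ultimately show thesis
    using that by blast
qed

lemma one_nbhd_quotient:
  assumes "openin T U" "\<one> \<in> U"
  obtains V where "openin T V" "\<one> \<in> V" "\<And>a b. a \<in> V \<Longrightarrow> b \<in> V \<Longrightarrow> a \<otimes> inv b \<in> U"
proof -
  have "continuous_map (prod_topology T T) T (\<lambda>p. fst p \<otimes> inv (snd p))"
    by (intro continuous_map_group_intros continuous_map_fst continuous_map_snd)
  then have "openin (prod_topology T T)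
      {p \<in> topspace (prod_topology T T). fst p \<otimes> inv (snd p) \<in> U}"
    using assms(1) by (rule openin_continuous_map_preimage)
  moreover have "(\<one>, \<one>) \<in> {p \<in> topspace (prod_topology T T). fst p \<otimes> inv (snd p) \<in> U}"
    using assms(2) by (simp add: topspace_eq)
  ultimately obtain V1 V2 where V: "openin T V1" "openin T V2" "\<one> \<in> V1" "\<one> \<in> V2"
    "V1 \<times> V2 \<subseteq> {p \<in> topspace (prod_topology T T). fst p \<otimes> inv (snd p) \<in> U}"
    unfolding openin_prod_topology_alt by meson
  show thesis
    by (rule that[of "V1 \<inter> V2"]) (use V in auto)
qed

text \<open>The closure of \<open>V\<close> lies in \<open>U\<close>: a point \<open>x\<close> of it
  has \<open>x \<otimes> v\<close> in \<open>V\<close> for some \<open>v\<close> in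
  \<open>V\<close>, so it is a quotient of elements of \<open>V\<close>. Closed neighbourhoods are
  wanted because closed sets are analytic, whereas open sets are not known to be.\<close>

lemma one_nbhd_closed:
  assumes "openin T U" "\<one> \<in> U"
  obtains V C where "openin T V" "\<one> \<in> V" "closedin T C" "V \<subseteq> C" "C \<subseteq> U"
proof -
  obtain V where V: "openin T V" "\<one> \<in> V" "\<And>a b. a \<in> V \<Longrightarrow> b \<in> V \<Longrightarrow> a \<otimes> inv b \<in> U"
    using one_nbhd_quotient[OF assms] by blast
  have Vc: "V \<subseteq> carrier G"
    using openin_subset[OF V(1)] topspace_eq by simp
  have "T closure_of V \<subseteq> U"
  proof
    fix x assume x: "x \<in> T closure_of V"
    then have xc: "x \<in> carrier G"
      by (metis in_closure_of topspace_eq)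
    have "openin T ((\<lambda>y. x \<otimes> y) ` V)" "x \<in> (\<lambda>y. x \<otimes> y) ` V"
      using openin_left_translation[OF xc V(1)] V(2) xc by (auto simp: image_iff intro!: bexI[of _ \<one>])
    then obtain v where v: "v \<in> V" "x \<otimes> v \<in> V"
      using x unfolding in_closure_of by blast
    then have "x = (x \<otimes> v) \<otimes> inv v"
      using xc Vc by (auto simp: m_assoc)
    then show "x \<in> U"
      using V(3) v by metis
  qed
  then show thesis
    using that[OF V(1,2), of "T closure_of V"] closure_of_subset[of V T] Vc topspace_eq by simp
qed

end

section \<open>Continuity and openness of homomorphisms, tested at the identity\<close>

lemma continuous_map_hom_at_one:
  assumes "topgroup L S" "topgroup G T" and \<phi>: "\<phi> \<in> hom L G"
    and *: "\<And>U. openin T U \<Longrightarrow> \<one>\<^bsub>G\<^esub> \<in> U \<Longrightarrow> \<exists>V. openin S V \<and> \<one>\<^bsub>L\<^esub> \<in> V \<and> \<phi> ` V \<subseteq> U"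
  shows "continuous_map S T \<phi>"
proof -
  interpret L: topgroup L S by fact
  interpret G: topgroup G T by fact
  interpret hom: group_hom L G \<phi>
    using \<phi> by unfold_locales auto
  have "openin S {x \<in> carrier L. \<phi> x \<in> U}" if U: "openin T U" for U
  proof (subst openin_subopen, intro ballI)
    fix x assume "x \<in> {x \<in> carrier L. \<phi> x \<in> U}"
    then have x: "x \<in> carrier L" "\<phi> x \<in> U"
      by auto
    have "openin T {y \<in> topspace T. \<phi> x \<otimes>\<^bsub>G\<^esub> y \<in> U}"
      using x by (intro openin_continuous_map_preimage[OF _ U] G.continuous_map_group_intros) auto
    then obtain V where V: "openin S V" "\<one>\<^bsub>L\<^esub> \<in> V" "\<phi> ` V \<subseteq> {y \<in> topspace T. \<phi> x \<otimes>\<^bsub>G\<^esub> y \<in> U}"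
      using *[of "{y \<in> topspace T. \<phi> x \<otimes>\<^bsub>G\<^esub> y \<in> U}"] x G.topspace_eq by auto
    have Vc: "V \<subseteq> carrier L"
      using openin_subset[OF V(1)] L.topspace_eq by simp
    show "\<exists>T. openin S T \<and> x \<in> T \<and> T \<subseteq> {x \<in> carrier L. \<phi> x \<in> U}"
    proof (intro exI conjI)
      show "openin S ((\<lambda>y. x \<otimes>\<^bsub>L\<^esub> y) ` V)"
        using L.openin_left_translation x(1) V(1) by blast
      show "x \<in> (\<lambda>y. x \<otimes>\<^bsub>L\<^esub> y) ` V"
        using V(2) x(1) by (auto simp: image_iff intro!: bexI[of _ "\<one>\<^bsub>L\<^esub>"])
      show "(\<lambda>y. x \<otimes>\<^bsub>L\<^esub> y) ` V \<subseteq> {x \<in> carrier L. \<phi> x \<in> U}"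
        using V(3) Vc x(1) by (auto simp: subset_iff image_iff)
    qed
  qed
  then show ?thesis
    by (auto simp: continuous_map_def L.topspace_eq G.topspace_eq)
qed

lemma open_map_hom_at_one:
  assumes "topgroup L S" "topgroup G T" and \<phi>: "\<phi> \<in> hom L G"
    and *: "\<And>V. openin S V \<Longrightarrow> \<one>\<^bsub>L\<^esub> \<in> V \<Longrightarrow> \<exists>U. openin T U \<and> \<one>\<^bsub>G\<^esub> \<in> U \<and> U \<subseteq> \<phi> ` V"
  shows "open_map S T \<phi>"
  unfolding open_map_def
proof (intro allI impI)
  interpret L: topgroup L S by fact
  interpret G: topgroup G T by fact
  interpret hom: group_hom L G \<phi>
    using \<phi> by unfold_locales auto
  fix V assume V: "openin S V"
  have Vc: "V \<subseteq> carrier L"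
    using openin_subset[OF V(1)] L.topspace_eq by simp
  show "openin T (\<phi> ` V)"
  proof (subst openin_subopen, intro ballI)
    fix y assume "y \<in> \<phi> ` V"
    then obtain x where x: "x \<in> V" "y = \<phi> x" "x \<in> carrier L"
      using Vc by blast
    have "openin S {v \<in> topspace S. x \<otimes>\<^bsub>L\<^esub> v \<in> V}"
      using x by (intro openin_continuous_map_preimage[OF _ V] L.continuous_map_group_intros) auto
    then obtain U where U: "openin T U" "\<one>\<^bsub>G\<^esub> \<in> U" "U \<subseteq> \<phi> ` {v \<in> topspace S. x \<otimes>\<^bsub>L\<^esub> v \<in> V}"
      using *[of "{v \<in> topspace S. x \<otimes>\<^bsub>L\<^esub> v \<in> V}"] x L.topspace_eq by auto
    show "\<exists>W. openin T W \<and> y \<in> W \<and> W \<subseteq> \<phi> ` V"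
    proof (intro exI conjI)
      show "openin T ((\<lambda>z. y \<otimes>\<^bsub>G\<^esub> z) ` U)"
        using G.openin_left_translation x U(1) by auto
      show "y \<in> (\<lambda>z. y \<otimes>\<^bsub>G\<^esub> z) ` U"
        using U(2) x by (auto simp: image_iff intro!: bexI[of _ "\<one>\<^bsub>G\<^esub>"])
      show "(\<lambda>z. y \<otimes>\<^bsub>G\<^esub> z) ` U \<subseteq> \<phi> ` V"
      proof
        fix w assume "w \<in> (\<lambda>z. y \<otimes>\<^bsub>G\<^esub> z) ` U"
        then obtain v where v: "v \<in> carrier L" "x \<otimes>\<^bsub>L\<^esub> v \<in> V" "w = \<phi> x \<otimes>\<^bsub>G\<^esub> \<phi> v"
          using U(3) x L.topspace_eq by auto
        then have "w = \<phi> (x \<otimes>\<^bsub>L\<^esub> v)"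
          using x by simp
        then show "w \<in> \<phi> ` V"
          using v by blast
      qed
    qed
  qed
qed

section \<open>Sets with analytic preimage\<close>

text \<open>
  Every subset of \<open>G\<close> that is positively and existentially definable in the language of groups, with
  parameters, is traceable.
\<close>

locale analytic_epi = L: topgroup L S + G: topgroup G T
  for \<K> :: "'u topology set" and L :: "'l monoid" and S :: "'l topology"
    and G :: "('a, 'b) monoid_scheme" and T :: "'a topology" and \<phi> :: "'l \<Rightarrow> 'a" +
  assumes almost_Polish: "almost_Polish \<K>"
    and in_class_S: "in_class \<K> S" and in_class_T: "in_class \<K> T"
    and epi: "\<phi> \<in> epi L G" and kernel_analytic: "class_analytic \<K> S (kernel L G \<phi>)"
begin

sublocale hom: group_hom L G \<phi>
  using epi by unfold_locales (auto simp: epi_def)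

lemma surj: "\<phi> ` carrier L = carrier G"
  using epi by (simp add: epi_def)

text \<open>Analyticity is required of the preimage and not of \<open>E\<close>: as long as
  \<open>\<phi>\<close> is not known to be continuous, only category in \<open>L\<close> says
  anything about \<open>\<phi>\<close>.\<close>

definition traceable :: "'a set \<Rightarrow> bool" where
  "traceable E \<longleftrightarrow> E \<subseteq> carrier G \<and> class_analytic \<K> S {k \<in> carrier L. \<phi> k \<in> E}"

lemma traceable_subset: "traceable E \<Longrightarrow> E \<subseteq> carrier G"
  by (simp add: traceable_def)

text \<open>The preimage of the image of \<open>P\<close> is \<open>P\<close> times the kernel. This
  is the only place where analyticity of the kernel enters.\<close>

lemma traceable_image:
  assumes P: "class_analytic \<K> S P"
  shows "traceable (\<phi> ` P)"
proof -
  have Pc: "P \<subseteq> carrier L"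
    using class_analytic_subset_topspace[OF P] L.topspace_eq by simp
  have "continuous_map (prod_topology S S) S (\<lambda>p. fst p \<otimes>\<^bsub>L\<^esub> snd p)"
    by (intro L.continuous_map_group_intros continuous_map_fst continuous_map_snd)
  then have "class_analytic \<K> S ((\<lambda>p. fst p \<otimes>\<^bsub>L\<^esub> snd p) ` (P \<times> kernel L G \<phi>))"
    using class_analytic_Times[OF almost_Polish P kernel_analytic] class_analytic_continuous_image
    by blast
  moreover have "(\<lambda>p. fst p \<otimes>\<^bsub>L\<^esub> snd p) ` (P \<times> kernel L G \<phi>) = {k \<in> carrier L. \<phi> k \<in> \<phi> ` P}"
  proof (rule equalityI; rule subsetI)
    fix k assume "k \<in> (\<lambda>p. fst p \<otimes>\<^bsub>L\<^esub> snd p) ` (P \<times> kernel L G \<phi>)"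
    then show "k \<in> {k \<in> carrier L. \<phi> k \<in> \<phi> ` P}"
      using Pc by (fastforce simp: kernel_def)
  next
    fix k assume "k \<in> {k \<in> carrier L. \<phi> k \<in> \<phi> ` P}"
    then obtain p where k: "k \<in> carrier L" "p \<in> P" "p \<in> carrier L" "\<phi> k = \<phi> p"
      using Pc by blast
    then have "inv\<^bsub>L\<^esub> p \<otimes>\<^bsub>L\<^esub> k \<in> kernel L G \<phi>"
      by (simp add: kernel_def)
    moreover have "k = p \<otimes>\<^bsub>L\<^esub> (inv\<^bsub>L\<^esub> p \<otimes>\<^bsub>L\<^esub> k)"
      using k by (simp add: L.m_assoc[symmetric])
    ultimately show "k \<in> (\<lambda>p. fst p \<otimes>\<^bsub>L\<^esub> snd p) ` (P \<times> kernel L G \<phi>)"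
      using k(2) by (auto intro!: image_eqI[of _ _ "(p, inv\<^bsub>L\<^esub> p \<otimes>\<^bsub>L\<^esub> k)"])
  qed
  ultimately show ?thesis
    using Pc by (auto simp: traceable_def)
qed

lemma traceable_eq_image:
  "E \<subseteq> carrier G \<Longrightarrow> \<phi> ` {k \<in> carrier L. \<phi> k \<in> E} = E"
  unfolding surj[symmetric] by blast

lemma traceable_carrier: "traceable (carrier G)"
  using traceable_image[OF class_analytic_topspace[OF in_class_S]] surj by (simp add: L.topspace_eq)

lemma traceable_singleton:
  assumes "g \<in> carrier G"
  shows "traceable {g}"
proof -
  obtain h where h: "h \<in> carrier L" "\<phi> h = g"
    using assms unfolding surj[symmetric] by blast
  have "closedin S {h}"
    using closedin_Hausdorff_sing_eq[OF L.Hausdorff] h(1) L.topspace_eq by blast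
  then have "traceable (\<phi> ` {h})"
    by (intro traceable_image class_analytic_closedin[OF almost_Polish in_class_S])
  then show ?thesis
    using h(2) by simp
qed

lemma traceable_Int: "traceable A \<Longrightarrow> traceable B \<Longrightarrow> traceable (A \<inter> B)"
proof -
  assume A: "traceable A" and B: "traceable B"
  have "{k \<in> carrier L. \<phi> k \<in> A \<inter> B} = {k \<in> carrier L. \<phi> k \<in> A} \<inter> {k \<in> carrier L. \<phi> k \<in> B}"
    by blast
  then show "traceable (A \<inter> B)"
    using A B class_analytic_Int[OF almost_Polish in_class_S L.Hausdorff]
    by (auto simp: traceable_def)
qed

lemma traceable_Ball:
  assumes "finite I" "\<And>i. i \<in> I \<Longrightarrow> traceable {x \<in> carrier G. P i x}"
  shows "traceable {x \<in> carrier G. \<forall>i\<in>I. P i x}"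
  using assms
proof (induction I rule: finite_induct)
  case empty
  then show ?case
    using traceable_carrier by simp
next
  case (insert i I)
  have "{x \<in> carrier G. \<forall>j\<in>insert i I. P j x} = {x \<in> carrier G. P i x} \<inter> {x \<in> carrier G. \<forall>j\<in>I. P j x}"
    by blast
  then show ?case
    using insert traceable_Int by simp
qed

lemma set_mult_eq: "A <#>\<^bsub>G\<^esub> B = (\<lambda>p. fst p \<otimes>\<^bsub>G\<^esub> snd p) ` (A \<times> B)"
  by (force simp: set_mult_def)

lemma traceable_set_mult:
  assumes A: "traceable A" and B: "traceable B"
  shows "traceable (A <#>\<^bsub>G\<^esub> B)"
proof -
  let ?A = "{k \<in> carrier L. \<phi> k \<in> A}" and ?B = "{k \<in> carrier L. \<phi> k \<in> B}"
  have "continuous_map (prod_topology S S) S (\<lambda>p. fst p \<otimes>\<^bsub>L\<^esub> snd p)"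
    by (intro L.continuous_map_group_intros continuous_map_fst continuous_map_snd)
  then have "class_analytic \<K> S ((\<lambda>p. fst p \<otimes>\<^bsub>L\<^esub> snd p) ` (?A \<times> ?B))"
    using class_analytic_Times[OF almost_Polish] class_analytic_continuous_image A B
    unfolding traceable_def by blast
  then have "traceable (\<phi> ` (\<lambda>p. fst p \<otimes>\<^bsub>L\<^esub> snd p) ` (?A \<times> ?B))"
    by (rule traceable_image)
  moreover have "\<phi> ` (\<lambda>p. fst p \<otimes>\<^bsub>L\<^esub> snd p) ` (?A \<times> ?B)
      = (\<lambda>p. fst p \<otimes>\<^bsub>G\<^esub> snd p) ` ((\<phi> ` ?A) \<times> (\<phi> ` ?B))"
    by (force simp: image_iff)
  ultimately show ?thesis
    unfolding traceable_eq_image[OF traceable_subset[OF A]] traceable_eq_image[OF traceable_subset[OF B]]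
    by (simp add: set_mult_eq)
qed

text \<open>\<open>F\<close> stands for a group word with parameters in \<open>G\<close>. Choosing
  preimages of the parameters gives the corresponding word \<open>f\<close> in \<open>L\<close>,
  which is continuous for the topology of \<open>L\<close>.\<close>

lemma
  assumes E: "traceable E" and f: "continuous_map S S f"
    and F: "\<And>k. k \<in> carrier L \<Longrightarrow> \<phi> (f k) = F (\<phi> k)"
  shows traceable_vimage_lift: "traceable {x \<in> carrier G. F x \<in> E}"
    and traceable_image_lift: "traceable (F ` E)"
proof -
  have fc: "f k \<in> carrier L" if "k \<in> carrier L" for k
    using f that by (auto simp: continuous_map_def L.topspace_eq)
  let ?E = "{k \<in> carrier L. \<phi> k \<in> E}"
  have "class_analytic \<K> S {k \<in> topspace S. f k \<in> ?E}"
    using E by (intro class_analytic_vimage[OF almost_Polish in_class_S f L.Hausdorff])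
      (simp add: traceable_def)
  moreover have "{k \<in> topspace S. f k \<in> ?E} = {k \<in> carrier L. \<phi> k \<in> {x \<in> carrier G. F x \<in> E}}"
    using fc F by (auto simp: L.topspace_eq)
  ultimately show "traceable {x \<in> carrier G. F x \<in> E}"
    by (auto simp: traceable_def)
  have "traceable (\<phi> ` f ` ?E)"
    using E f by (intro traceable_image class_analytic_continuous_image) (simp_all add: traceable_def)
  moreover have "\<phi> ` f ` ?E = F ` \<phi> ` ?E"
    using F by (force simp: image_iff)
  ultimately show "traceable (F ` E)"
    using traceable_eq_image[OF traceable_subset[OF E]] by simp
qed

lemma
  assumes E: "traceable E" and g: "g \<in> carrier G"
  shows traceable_vimage_conj: "traceable {x \<in> carrier G. x \<otimes>\<^bsub>G\<^esub> g \<otimes>\<^bsub>G\<^esub> inv\<^bsub>G\<^esub> x \<in> E}"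
    and traceable_image_conj: "traceable ((\<lambda>x. x \<otimes>\<^bsub>G\<^esub> g \<otimes>\<^bsub>G\<^esub> inv\<^bsub>G\<^esub> x) ` E)"
proof -
  obtain h where h: "h \<in> carrier L" "\<phi> h = g"
    using g unfolding surj[symmetric] by blast
  have c: "continuous_map S S (\<lambda>k. k \<otimes>\<^bsub>L\<^esub> h \<otimes>\<^bsub>L\<^esub> inv\<^bsub>L\<^esub> k)"
    using h(1) by (intro L.continuous_map_group_intros)
  show "traceable {x \<in> carrier G. x \<otimes>\<^bsub>G\<^esub> g \<otimes>\<^bsub>G\<^esub> inv\<^bsub>G\<^esub> x \<in> E}"
    by (rule traceable_vimage_lift[OF E c]) (use h in simp)
  show "traceable ((\<lambda>x. x \<otimes>\<^bsub>G\<^esub> g \<otimes>\<^bsub>G\<^esub> inv\<^bsub>G\<^esub> x) ` E)"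
    by (rule traceable_image_lift[OF E c]) (use h in simp)
qed

lemma traceable_image_square:
  assumes "traceable E"
  shows "traceable ((\<lambda>x. x \<otimes>\<^bsub>G\<^esub> x) ` E)"
proof -
  have c: "continuous_map S S (\<lambda>k. k \<otimes>\<^bsub>L\<^esub> k)"
    by (intro L.continuous_map_group_intros)
  show ?thesis
    by (rule traceable_image_lift[OF assms c]) simp
qed

lemma traceable_image_inv:
  assumes "traceable E"
  shows "traceable ((\<lambda>x. inv\<^bsub>G\<^esub> x) ` E)"
proof -
  have c: "continuous_map S S (\<lambda>k. inv\<^bsub>L\<^esub> k)"
    by (intro L.continuous_map_group_intros)
  show ?thesis
    by (rule traceable_image_lift[OF assms c]) simp
qed

lemma traceable_centralizer:
  assumes g: "g \<in> carrier G"
  shows "traceable {x \<in> carrier G. x \<otimes>\<^bsub>G\<^esub> g = g \<otimes>\<^bsub>G\<^esub> x}"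
proof -
  have "{x \<in> carrier G. x \<otimes>\<^bsub>G\<^esub> g \<otimes>\<^bsub>G\<^esub> inv\<^bsub>G\<^esub> x \<in> {g}} = {x \<in> carrier G. x \<otimes>\<^bsub>G\<^esub> g = g \<otimes>\<^bsub>G\<^esub> x}"
    using g by (auto simp: G.inv_solve_right')
  then show ?thesis
    using traceable_vimage_conj[OF traceable_singleton[OF g] g] by simp
qed

lemma traceable_foldr_set_mult:
  "(\<And>A. A \<in> set As \<Longrightarrow> traceable A) \<Longrightarrow> traceable (foldr (<#>\<^bsub>G\<^esub>) As {\<one>\<^bsub>G\<^esub>})"
  by (induction As) (simp_all add: traceable_singleton traceable_set_mult)

text \<open>Countably many translates of the preimages of the sets in the family cover
  \<open>L\<close>, so one preimage is nonmeager. Pettis, applied to this single one, gives a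
  neighbourhood whose image consists of quotients of elements of one \<open>E\<close>; hence the
  sets are taken inside a \<open>V\<close> whose quotients lie in \<open>U\<close>.\<close>

lemma continuous_open_if_traceable_nbhds:
  assumes nb: "\<And>U. openin T U \<Longrightarrow> \<one>\<^bsub>G\<^esub> \<in> U \<Longrightarrow>
      \<exists>\<E> W. countable \<E> \<and> (\<forall>E\<in>\<E>. traceable E \<and> E \<subseteq> U) \<and> openin T W \<and> \<one>\<^bsub>G\<^esub> \<in> W \<and> W \<subseteq> \<Union>\<E>"
  shows "continuous_map S T \<phi> \<and> open_map S T \<phi>"
proof
  note LS = in_class_Lindelof_space[OF almost_Polish in_class_S]
  note LT = in_class_Lindelof_space[OF almost_Polish in_class_T]
  have nmS: "\<not> meager_in S (carrier L)"
    using in_class_not_meager[OF almost_Polish in_class_S] L.topspace_eq L.one_closed by auto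
  have nmT: "\<not> meager_in T (carrier G)"
    using in_class_not_meager[OF almost_Polish in_class_T] G.topspace_eq G.one_closed by auto
  have tg: "topgroup L S" "topgroup G T"
    by unfold_locales
  show cont: "continuous_map S T \<phi>"
  proof (rule continuous_map_hom_at_one[OF tg hom.homh])
    fix U assume U: "openin T U" "\<one>\<^bsub>G\<^esub> \<in> U"
    obtain V where V: "openin T V" "\<one>\<^bsub>G\<^esub> \<in> V" "\<And>a b. a \<in> V \<Longrightarrow> b \<in> V \<Longrightarrow> a \<otimes>\<^bsub>G\<^esub> inv\<^bsub>G\<^esub> b \<in> U"
      using G.one_nbhd_quotient[OF U] by blast
    obtain \<E> W where \<E>: "countable \<E>" "\<And>E. E \<in> \<E> \<Longrightarrow> traceable E" "\<And>E. E \<in> \<E> \<Longrightarrow> E \<subseteq> V"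
      and W: "openin T W" "\<one>\<^bsub>G\<^esub> \<in> W" "W \<subseteq> \<Union>\<E>"
      using nb[OF V(1,2)] by metis
    obtain Q where Q: "countable Q" "Q \<subseteq> carrier G" "carrier G \<subseteq> (\<Union>q\<in>Q. (\<lambda>x. q \<otimes>\<^bsub>G\<^esub> x) ` W)"
      using G.Lindelof_translation_cover[OF LT W(1)] W(2) by blast
    \<comment> \<open>\<open>s\<close> chooses a preimage of each translating element, so that the
      cover of \<open>G\<close> can be lifted to \<open>L\<close>.\<close>
    define s where "s = inv_into (carrier L) \<phi>"
    have s: "s q \<in> carrier L \<and> \<phi> (s q) = q" if "q \<in> Q" for q
      using that Q(2) unfolding s_def surj[symmetric] by (auto simp: inv_into_into f_inv_into_f)
    define pre where "pre = (\<lambda>E. {k \<in> carrier L. \<phi> k \<in> E})"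
    have cov: "carrier L \<subseteq> (\<Union>(q, E)\<in>Q \<times> \<E>. (\<lambda>x. s q \<otimes>\<^bsub>L\<^esub> x) ` pre E)"
    proof
      fix k assume k: "k \<in> carrier L"
      then obtain q w where q: "q \<in> Q" "w \<in> W" "\<phi> k = q \<otimes>\<^bsub>G\<^esub> w"
        using Q(3) hom.hom_closed by blast
      then obtain E where E: "E \<in> \<E>" "w \<in> E"
        using W(3) by blast
      have w: "w \<in> carrier G"
        using E \<E>(2) traceable_subset by blast
      have "q \<in> carrier G"
        using q(1) Q(2) by blast
      then have "inv\<^bsub>L\<^esub> (s q) \<otimes>\<^bsub>L\<^esub> k \<in> pre E"
        using k q s[OF q(1)] E w by (simp add: pre_def G.m_assoc[symmetric])
      moreover have "k = s q \<otimes>\<^bsub>L\<^esub> (inv\<^bsub>L\<^esub> (s q) \<otimes>\<^bsub>L\<^esub> k)"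
        using k s[OF q(1)] by (simp add: L.m_assoc[symmetric])
      ultimately show "k \<in> (\<Union>(q, E)\<in>Q \<times> \<E>. (\<lambda>x. s q \<otimes>\<^bsub>L\<^esub> x) ` pre E)"
        using q(1) E(1) by blast
    qed
    have "\<exists>E\<in>\<E>. \<not> meager_in S (pre E)"
    proof (rule ccontr)
      assume "\<not> (\<exists>E\<in>\<E>. \<not> meager_in S (pre E))"
      then have m: "meager_in S (pre E)" if "E \<in> \<E>" for E
        using that by blast
      have "meager_in S (\<Union>(q, E)\<in>Q \<times> \<E>. (\<lambda>x. s q \<otimes>\<^bsub>L\<^esub> x) ` pre E)"
        using \<E>(1) Q(1) s m
        by (intro meager_in_Union)
          (auto intro!: meager_in_homeomorphic_image[OF L.homeomorphic_map_left_translation])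
      then show False
        using cov nmS meager_in_subset by blast
    qed
    then obtain E where E: "E \<in> \<E>" "\<not> meager_in S (pre E)"
      by blast
    have "almost_open_in S (pre E)"
      using \<E>(2)[OF E(1)] class_analytic_almost_open[OF almost_Polish in_class_S]
      by (simp add: traceable_def pre_def)
    then obtain N where N: "openin S N" "\<one>\<^bsub>L\<^esub> \<in> N"
      "\<And>g. g \<in> N \<Longrightarrow> \<exists>a\<in>pre E. \<exists>b\<in>pre E. g = a \<otimes>\<^bsub>L\<^esub> inv\<^bsub>L\<^esub> b"
      using L.Pettis[OF LS nmS _ E(2)] by blast
    have "\<phi> ` N \<subseteq> U"
    proof
      fix y assume "y \<in> \<phi> ` N"
      then obtain a b where "a \<in> pre E" "b \<in> pre E" "y = \<phi> (a \<otimes>\<^bsub>L\<^esub> inv\<^bsub>L\<^esub> b)"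
        using N(3) by blast
      then show "y \<in> U"
        using V(3) \<E>(3)[OF E(1)] by (auto simp: pre_def subset_iff)
    qed
    then show "\<exists>N. openin S N \<and> \<one>\<^bsub>L\<^esub> \<in> N \<and> \<phi> ` N \<subseteq> U"
      using N(1,2) by blast
  qed
  \<comment> \<open>With continuity established, the image of a closed set is analytic in
    \<open>G\<close> itself. Countably many of its translates cover \<open>G\<close>, so it is
    nonmeager and Pettis applies there.\<close>
  show "open_map S T \<phi>"
  proof (rule open_map_hom_at_one[OF tg hom.homh])
    fix U assume U: "openin S U" "\<one>\<^bsub>L\<^esub> \<in> U"
    obtain V where V: "openin S V" "\<one>\<^bsub>L\<^esub> \<in> V" "\<And>a b. a \<in> V \<Longrightarrow> b \<in> V \<Longrightarrow> a \<otimes>\<^bsub>L\<^esub> inv\<^bsub>L\<^esub> b \<in> U"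
      using L.one_nbhd_quotient[OF U] by blast
    obtain O' C where C: "openin S O'" "\<one>\<^bsub>L\<^esub> \<in> O'" "closedin S C" "O' \<subseteq> C" "C \<subseteq> V"
      using L.one_nbhd_closed[OF V(1,2)] by blast
    have Cc: "C \<subseteq> carrier L"
      using closedin_subset[OF C(3)] L.topspace_eq by simp
    obtain Q where Q: "countable Q" "Q \<subseteq> carrier L" "carrier L \<subseteq> (\<Union>q\<in>Q. (\<lambda>x. q \<otimes>\<^bsub>L\<^esub> x) ` O')"
      using L.Lindelof_translation_cover[OF LS C(1)] C(2) by blast
    have cov: "carrier G \<subseteq> (\<Union>q\<in>Q. (\<lambda>x. \<phi> q \<otimes>\<^bsub>G\<^esub> x) ` \<phi> ` C)"
    proof
      fix y assume "y \<in> carrier G"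
      then obtain k where k: "k \<in> carrier L" "y = \<phi> k"
        unfolding surj[symmetric] by blast
      then obtain q c where "q \<in> Q" "c \<in> C" "k = q \<otimes>\<^bsub>L\<^esub> c"
        using Q(3) C(4) by blast
      moreover have "q \<in> carrier L" "c \<in> carrier L"
        using calculation Q(2) Cc by auto
      ultimately show "y \<in> (\<Union>q\<in>Q. (\<lambda>x. \<phi> q \<otimes>\<^bsub>G\<^esub> x) ` \<phi> ` C)"
        using k(2) by auto
    qed
    have "\<not> meager_in T (\<phi> ` C)"
    proof
      assume m: "meager_in T (\<phi> ` C)"
      have "meager_in T (\<Union>q\<in>Q. (\<lambda>x. \<phi> q \<otimes>\<^bsub>G\<^esub> x) ` \<phi> ` C)"
        using Q(1,2) m
        by (intro meager_in_Union)
          (auto intro!: meager_in_homeomorphic_image[OF G.homeomorphic_map_left_translation])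
      then show False
        using cov nmT meager_in_subset by blast
    qed
    moreover have "almost_open_in T (\<phi> ` C)"
      by (intro class_analytic_almost_open[OF almost_Polish in_class_T]
          class_analytic_continuous_image[OF class_analytic_closedin[OF almost_Polish in_class_S C(3)] cont])
    ultimately obtain N where N: "openin T N" "\<one>\<^bsub>G\<^esub> \<in> N"
      "\<And>g. g \<in> N \<Longrightarrow> \<exists>a\<in>\<phi> ` C. \<exists>b\<in>\<phi> ` C. g = a \<otimes>\<^bsub>G\<^esub> inv\<^bsub>G\<^esub> b"
      using G.Pettis[OF LT nmT] by blast
    have "N \<subseteq> \<phi> ` U"
    proof
      fix y assume "y \<in> N"
      then obtain a b where ab: "a \<in> C" "b \<in> C" "y = \<phi> a \<otimes>\<^bsub>G\<^esub> inv\<^bsub>G\<^esub> (\<phi> b)"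
        using N(3) by blast
      then have "y = \<phi> (a \<otimes>\<^bsub>L\<^esub> inv\<^bsub>L\<^esub> b)"
        using Cc by (simp add: subset_iff)
      then show "y \<in> \<phi> ` U"
        using V(3) C(5) ab by blast
    qed
    then show "\<exists>N. openin T N \<and> \<one>\<^bsub>G\<^esub> \<in> N \<and> N \<subseteq> \<phi> ` U"
      using N(1,2) by blast
  qed
qed

end

section \<open>Groups of affine maps\<close>

lemma matrix_vector_mult_axis:
  fixes A :: "'k::semiring_1^'n^'m"
  shows "(A *v axis j q) $ i = A $ i $ j * q"
  by (simp add: matrix_vector_mult_def axis_def if_distrib[of "\<lambda>x. _ * x"] cong: if_cong)

lemma matrix_vector_mult_scaleR_algebra:
  fixes A :: "'k::real_algebra_1^'n^'m"
  shows "A *v (r *\<^sub>R x) = r *\<^sub>R (A *v x)"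
  by (simp add: vec_eq_iff matrix_vector_mult_def scaleR_sum_right)

lemma matrix_vector_mult_minus_right:
  fixes A :: "'k::ring_1^'n^'m"
  shows "A *v (- x) = - (A *v x)"
  by (simp add: vec_eq_iff matrix_vector_mult_def sum_negf)

lemma matrix_eqI_axis:
  fixes A B :: "'k::semiring_1^'n^'m"
  assumes "\<And>j. A *v axis j 1 = B *v axis j 1"
  shows "A = B"
  using assms matrix_vector_mult_axis[where q = "1 :: 'k"] by (metis mult.right_neutral vec_eq_iff)

lemma continuous_on_matrix_vector_mult [continuous_intros]:
  fixes f :: "'a::topological_space \<Rightarrow> 'k::real_normed_algebra_1^'n^'m"
  assumes "continuous_on X f" "continuous_on X g"
  shows "continuous_on X (\<lambda>x. f x *v g x)"
  unfolding matrix_vector_mult_def using assms by (intro continuous_intros)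

lemma continuous_on_matrix_matrix_mult [continuous_intros]:
  fixes f :: "'a::topological_space \<Rightarrow> 'k::real_normed_algebra_1^'n^'m"
  assumes "continuous_on X f" "continuous_on X g"
  shows "continuous_on X (\<lambda>x. f x ** g x)"
  unfolding matrix_matrix_mult_def using assms by (intro continuous_intros)

lemma norm_matrix_le_entries:
  fixes A :: "'k::real_normed_vector^'n^'m"
  shows "norm A \<le> (\<Sum>i\<in>UNIV. \<Sum>j\<in>UNIV. norm (A $ i $ j))"
proof -
  have le: "norm x \<le> (\<Sum>i\<in>UNIV. norm (x $ i))" for x :: "'b::real_normed_vector^'c::finite"
    by (simp add: norm_vec_def L2_set_le_sum)
  show ?thesis
    using le[of A] sum_mono[of UNIV "\<lambda>i. norm (A $ i)", OF le] by (rule order_trans)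
qed

text \<open>\<open>J\<close> is inversion. It is left abstract so that each group supplies a formula
  whose continuity is evident: transpose, adjoint or, by Cramer's rule,
  \<open>matrix_inv\<close>.\<close>

locale matrix_topgroup =
  fixes M :: "('k::real_normed_algebra_1^'n::finite^'n) set" and J :: "'k^'n^'n \<Rightarrow> 'k^'n^'n"
  assumes mat_1_mem: "mat 1 \<in> M"
    and mult_mem: "\<And>A B. A \<in> M \<Longrightarrow> B \<in> M \<Longrightarrow> A ** B \<in> M"
    and J_mem: "\<And>A. A \<in> M \<Longrightarrow> J A \<in> M"
    and J_left: "\<And>A. A \<in> M \<Longrightarrow> J A ** A = mat 1"
    and J_right: "\<And>A. A \<in> M \<Longrightarrow> A ** J A = mat 1"
    and continuous_J: "continuous_on M J"
begin

abbreviation \<G> :: "(('k^'n) \<times> ('k^'n^'n)) monoid" where "\<G> \<equiv> affine_group M"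

lemma carrier_affine: "carrier \<G> = UNIV \<times> M"
  by (simp add: affine_group_def semidirect_def matrix_group_def)

lemma mult_affine: "(u, A) \<otimes>\<^bsub>\<G>\<^esub> (v, B) = (u + A *v v, A ** B)"
  by (simp add: affine_group_def semidirect_def matrix_group_def)

lemma one_affine: "\<one>\<^bsub>\<G>\<^esub> = (0, mat 1)"
  by (simp add: affine_group_def semidirect_def matrix_group_def)

lemma affine_topology_eq: "affine_topology M = top_of_set (UNIV \<times> M)"
  using prod_topology_subtopology_eu[of UNIV M] by (simp add: affine_topology_def)

lemma group_affine: "group \<G>"
proof (rule groupI)
  fix x assume "x \<in> carrier \<G>"
  then obtain u A where x: "x = (u, A)" "A \<in> M"
    by (auto simp: carrier_affine)
  then have "(- (J A *v u), J A) \<otimes>\<^bsub>\<G>\<^esub> x = \<one>\<^bsub>\<G>\<^esub>"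
    by (simp add: mult_affine one_affine J_left)
  moreover have "(- (J A *v u), J A) \<in> carrier \<G>"
    using x J_mem by (simp add: carrier_affine)
  ultimately show "\<exists>y\<in>carrier \<G>. y \<otimes>\<^bsub>\<G>\<^esub> x = \<one>\<^bsub>\<G>\<^esub>"
    by blast
qed (auto simp: carrier_affine mult_affine one_affine mat_1_mem mult_mem matrix_mul_assoc
    matrix_vector_mul_assoc matrix_vector_right_distrib add.assoc)

lemma inv_affine:
  assumes "A \<in> M"
  shows "inv\<^bsub>\<G>\<^esub> (u, A) = (- (J A *v u), J A)"
  using assms
  by (intro group.inv_equality[OF group_affine])
    (simp_all add: carrier_affine mult_affine one_affine J_left J_mem)

lemma topological_group_affine: "topological_group \<G> (affine_topology M)"
  unfolding topological_group_def
proof (intro conjI)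
  show "group \<G>"
    by (rule group_affine)
  show "topspace (affine_topology M) = carrier \<G>"
    by (simp add: affine_topology_eq carrier_affine)
  show "Hausdorff_space (affine_topology M)"
    by (simp add: affine_topology_eq Hausdorff_space_subtopology)
  have "continuous_on ((UNIV \<times> M) \<times> (UNIV \<times> M))
      (\<lambda>p. (fst (fst p) + snd (fst p) *v fst (snd p), snd (fst p) ** snd (snd p)))"
    by (intro continuous_intros)
  moreover have "(\<lambda>(x, y). x \<otimes>\<^bsub>\<G>\<^esub> y) =
      (\<lambda>p. (fst (fst p) + snd (fst p) *v fst (snd p), snd (fst p) ** snd (snd p)))"
    by (auto simp: mult_affine)
  ultimately show "continuous_map (prod_topology (affine_topology M) (affine_topology M))
      (affine_topology M) (\<lambda>(x, y). x \<otimes>\<^bsub>\<G>\<^esub> y)"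
    by (auto simp: affine_topology_eq continuous_map_in_subtopology mult_mem)
  have "continuous_on (UNIV \<times> M) (\<lambda>p :: ('k^'n) \<times> ('k^'n^'n). J (snd p))"
    by (rule continuous_on_compose2[OF continuous_J]) (auto intro: continuous_intros)
  then have "continuous_on (UNIV \<times> M) (\<lambda>p. (- (J (snd p) *v fst p), J (snd p)))"
    by (intro continuous_intros)
  then have "continuous_on (UNIV \<times> M) (\<lambda>p. inv\<^bsub>\<G>\<^esub> p)"
    by (subst continuous_on_cong[OF refl]) (auto simp: inv_affine)
  then show "continuous_map (affine_topology M) (affine_topology M) (\<lambda>x. inv\<^bsub>\<G>\<^esub> x)"
    by (auto simp: affine_topology_eq continuous_map_in_subtopology inv_affine J_mem)
qed

lemma conj_translation:
  assumes "A \<in> M"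
  shows "(u, A) \<otimes>\<^bsub>\<G>\<^esub> (v, mat 1) \<otimes>\<^bsub>\<G>\<^esub> inv\<^bsub>\<G>\<^esub> (u, A) = (A *v v, mat 1)"
proof -
  have "A *v (J A *v u) = u"
    using assms by (simp add: matrix_vector_mul_assoc J_right)
  then show ?thesis
    using assms by (simp add: mult_affine inv_affine J_right matrix_vector_mult_minus_right)
qed

end

section \<open>Traceable sets of translations and small traceable neighbourhoods\<close>

locale affine_analytic_epi =
  matrix_topgroup M J + analytic_epi \<K> L S "affine_group M" "affine_topology M" \<phi>
  for M :: "('k::real_normed_algebra_1^'n::finite^'n) set" and J
    and \<K> :: "'u topology set" and L :: "'l monoid" and S :: "'l topology" and \<phi>
begin

lemma traceable_translations_add:
  assumes "traceable (B \<times> {mat 1})" "traceable (C \<times> {mat 1})"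
  shows "traceable ({b + c |b c. b \<in> B \<and> c \<in> C} \<times> {mat 1})"
proof -
  have "(B \<times> {mat 1}) <#>\<^bsub>\<G>\<^esub> (C \<times> {mat 1}) = {b + c |b c. b \<in> B \<and> c \<in> C} \<times> {mat 1}"
    unfolding set_mult_eq by (force simp: mult_affine image_iff)
  then show ?thesis
    using traceable_set_mult[OF assms] by simp
qed

lemma traceable_orbit: "traceable ((\<lambda>A. A *v v) ` M \<times> {mat 1})"
proof -
  have "(\<lambda>x. x \<otimes>\<^bsub>\<G>\<^esub> (v, mat 1) \<otimes>\<^bsub>\<G>\<^esub> inv\<^bsub>\<G>\<^esub> x) ` carrier \<G> = (\<lambda>A. A *v v) ` M \<times> {mat 1}"
    by (force simp: carrier_affine image_iff conj_translation)
  then show ?thesis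
    using traceable_image_conj[OF traceable_carrier, of "(v, mat 1)"]
    by (simp add: carrier_affine mat_1_mem)
qed

text \<open>\<open>(u, A)\<close> commutes with \<open>(0, z)\<close> exactly if
  \<open>z *v u = u\<close> and \<open>A ** z = z ** A\<close>. The first condition forces
  \<open>u = 0\<close>, the second always holds.\<close>

lemma traceable_stabilizer_if_central:
  assumes z: "z \<in> M" "\<And>A. A \<in> M \<Longrightarrow> A ** z = z ** A" "\<And>u. z *v u = u \<Longrightarrow> u = 0"
  shows "traceable ({0} \<times> M)"
proof -
  have "{x \<in> carrier \<G>. x \<otimes>\<^bsub>\<G>\<^esub> (0, z) = (0, z) \<otimes>\<^bsub>\<G>\<^esub> x} = {0} \<times> M"
    using z(2) by (auto simp: carrier_affine mult_affine dest!: sym[THEN z(3)])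
  then show ?thesis
    using traceable_centralizer[of "(0, z)"] z(1) by (simp add: carrier_affine)
qed

text \<open>\<open>Q\<close> spans the scalars over the reals with coefficients bounded by the norm,
  so the space is spanned by the finitely many real lines through \<open>axis i q\<close>. The
  neighbourhood is a sum of small sets that contain segments of these lines; the sets need not lie
  on the lines.\<close>

lemma traceable_nbhds_if_axis_nbhds:
  fixes Q :: "'k set"
  assumes Q: "finite Q"
      "\<And>x::'k. \<exists>t. x = (\<Sum>q\<in>Q. t q *\<^sub>R q) \<and> (\<forall>q\<in>Q. \<bar>t q\<bar> \<le> norm x)"
    and axes: "\<And>i q r. q \<in> Q \<Longrightarrow> r > 0 \<Longrightarrow>
      \<exists>B \<delta>. \<delta> > 0 \<and> traceable (B \<times> {mat 1}) \<and> (\<forall>b\<in>B. norm b \<le> r) \<and>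
        (\<forall>t. \<bar>t\<bar> < \<delta> \<longrightarrow> t *\<^sub>R axis i q \<in> B)"
    and r: "r > 0"
  shows "\<exists>B \<delta>. \<delta> > 0 \<and> traceable (B \<times> {mat 1}) \<and> ball 0 \<delta> \<subseteq> B \<and> B \<subseteq> ball 0 r"
proof -
  \<comment> \<open>One summand of norm at most \<open>s\<close> is added for each pair of a
    coordinate and an element of \<open>Q\<close>; the extra \<open>1\<close> makes the total
    strictly smaller than \<open>r\<close>.\<close>
  define s where "s = r / (real (card ((UNIV :: 'n set) \<times> Q)) + 1)"
  have s: "s > 0"
    using r by (simp add: s_def)
  have "\<exists>B \<delta>. \<delta> > 0 \<and> traceable (B \<times> {mat 1}) \<and> (\<forall>b\<in>B. norm b \<le> card P * s) \<and>
      (\<forall>t. (\<forall>p\<in>P. \<bar>t p\<bar> < \<delta>) \<longrightarrow> (\<Sum>p\<in>P. t p *\<^sub>R axis (fst p) (snd p)) \<in> B)"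
    if "finite P" "P \<subseteq> UNIV \<times> Q" for P :: "('n \<times> 'k) set"
    using that
  proof (induction P rule: finite_induct)
    case empty
    have "traceable ({0} \<times> {mat 1})"
      using traceable_singleton[of "(0, mat 1)"] by (simp add: carrier_affine mat_1_mem)
    then show ?case
      by (intro exI[of _ "{0}"] exI[of _ 1]) simp
  next
    case (insert p P)
    then obtain B \<delta> where B: "\<delta> > 0" "traceable (B \<times> {mat 1})" "\<forall>b\<in>B. norm b \<le> card P * s"
      "\<And>t. (\<forall>p\<in>P. \<bar>t p\<bar> < \<delta>) \<Longrightarrow> (\<Sum>p\<in>P. t p *\<^sub>R axis (fst p) (snd p)) \<in> B"
      by blast
    obtain C \<epsilon> where C: "\<epsilon> > 0" "traceable (C \<times> {mat 1})" "\<forall>b\<in>C. norm b \<le> s"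
      "\<And>t. \<bar>t\<bar> < \<epsilon> \<Longrightarrow> t *\<^sub>R axis (fst p) (snd p) \<in> C"
      using axes[of "snd p" s "fst p"] s insert.prems by (auto simp: mem_Times_iff)
    show ?case
    proof (intro exI conjI allI impI)
      show "min \<delta> \<epsilon> > 0"
        using B(1) C(1) by simp
      show "traceable ({b + c |b c. b \<in> C \<and> c \<in> B} \<times> {mat 1})"
        using traceable_translations_add[OF C(2) B(2)] .
      show "\<forall>b\<in>{b + c |b c. b \<in> C \<and> c \<in> B}. norm b \<le> card (insert p P) * s"
      proof clarify
        fix b c assume "b \<in> C" "c \<in> B"
        then have "norm b \<le> s" "norm c \<le> card P * s"
          using B(3) C(3) by auto
        then show "norm (b + c) \<le> card (insert p P) * s"
          using insert(1,2) norm_triangle_ineq[of b c] by (simp add: algebra_simps)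
      qed
      fix t assume t: "\<forall>p\<in>insert p P. \<bar>t p\<bar> < min \<delta> \<epsilon>"
      then have "t p *\<^sub>R axis (fst p) (snd p) \<in> C" "(\<Sum>p\<in>P. t p *\<^sub>R axis (fst p) (snd p)) \<in> B"
        using B(4) C(4) by simp_all
      then show "(\<Sum>p\<in>insert p P. t p *\<^sub>R axis (fst p) (snd p)) \<in> {b + c |b c. b \<in> C \<and> c \<in> B}"
        using insert(1,2) by auto
    qed
  qed
  from this[of "UNIV \<times> Q"] Q(1) obtain B \<delta> where B: "\<delta> > 0" "traceable (B \<times> {mat 1})"
    "\<forall>b\<in>B. norm b \<le> card ((UNIV :: 'n set) \<times> Q) * s"
    "\<And>t. (\<forall>p\<in>UNIV \<times> Q. \<bar>t p\<bar> < \<delta>) \<Longrightarrow> (\<Sum>p\<in>UNIV \<times> Q. t p *\<^sub>R axis (fst p) (snd p)) \<in> B"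
    by auto
  have "card ((UNIV :: 'n set) \<times> Q) * s < r"
  proof -
    have "real (card ((UNIV :: 'n set) \<times> Q)) * r < r * (real (card ((UNIV :: 'n set) \<times> Q)) + 1)"
      using r by (simp add: algebra_simps)
    then show ?thesis
      unfolding s_def by (simp add: divide_simps add_pos_nonneg)
  qed
  then have "B \<subseteq> ball 0 r"
    using B(3) by fastforce
  moreover have "ball 0 \<delta> \<subseteq> B"
  proof
    fix x :: "'k^'n" assume x: "x \<in> ball 0 \<delta>"
    define t where "t = (\<lambda>y::'k. SOME t. y = (\<Sum>q\<in>Q. t q *\<^sub>R q) \<and> (\<forall>q\<in>Q. \<bar>t q\<bar> \<le> norm y))"
    have t: "y = (\<Sum>q\<in>Q. t y q *\<^sub>R q)" "\<forall>q\<in>Q. \<bar>t y q\<bar> \<le> norm y" for y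
      using someI_ex[OF Q(2)[of y]] unfolding t_def by auto
    have "\<bar>t (x $ i) q\<bar> < \<delta>" if "q \<in> Q" for i q
      using t(2)[of "x $ i"] that x Finite_Cartesian_Product.norm_nth_le[of x i] by fastforce
    then have "(\<Sum>p\<in>UNIV \<times> Q. t (x $ fst p) (snd p) *\<^sub>R axis (fst p) (snd p)) \<in> B"
      using B(4)[of "\<lambda>p. t (x $ fst p) (snd p)"] by auto
    also have "(\<Sum>p\<in>UNIV \<times> Q. t (x $ fst p) (snd p) *\<^sub>R axis (fst p) (snd p))
        = (\<Sum>i\<in>UNIV. \<Sum>q\<in>Q. t (x $ i) q *\<^sub>R axis i q)"
      by (simp add: sum.cartesian_product case_prod_unfold)
    also have "\<dots> = x"
    proof (subst vec_eq_iff, intro allI)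
      fix j
      have "(\<Sum>i\<in>UNIV. \<Sum>q\<in>Q. t (x $ i) q *\<^sub>R axis i q) $ j
          = (\<Sum>i\<in>UNIV. \<Sum>q\<in>Q. t (x $ i) q *\<^sub>R axis i q $ j)"
        by simp
      also have "\<dots> = (\<Sum>i\<in>UNIV. if i = j then \<Sum>q\<in>Q. t (x $ i) q *\<^sub>R q else 0)"
        by (rule sum.cong) (simp_all add: axis_def)
      also have "\<dots> = x $ j"
        using t(1)[of "x $ j"] by simp
      finally show "(\<Sum>i\<in>UNIV. \<Sum>q\<in>Q. t (x $ i) q *\<^sub>R axis i q) $ j = x $ j" .
    qed
    finally show "x \<in> B" .
  qed
  ultimately show ?thesis
    using B(1,2) by blast
qed

text \<open>The orbit of a short vector is bounded but may contain no segment, as a sphere shows.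
  The sum of two copies of the orbit does: this is what \<open>half\<close> provides.\<close>

lemma axis_nbhd_if_bounded:
  assumes bounded: "\<And>A i j. A \<in> M \<Longrightarrow> norm (A $ i $ j) \<le> 1"
    and half: "\<And>t. \<bar>t\<bar> \<le> 1 \<Longrightarrow> \<exists>A\<in>M. \<exists>A'\<in>M. A *v axis i q + A' *v axis i q = (2 * t) *\<^sub>R axis i q"
    and r: "r > 0"
  shows "\<exists>B \<delta>. \<delta> > 0 \<and> traceable (B \<times> {mat 1}) \<and> (\<forall>b\<in>B. norm b \<le> r) \<and>
        (\<forall>t. \<bar>t\<bar> < \<delta> \<longrightarrow> t *\<^sub>R (axis i q :: 'k^'n) \<in> B)"
proof -
  define N where "N = real CARD('n) * norm q"
  \<comment> \<open>\<open>N\<close> bounds the norm of \<open>A *v axis i q\<close>. The factor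
    \<open>2\<close> accounts for the two orbit points, and \<open>+ 1\<close> keeps the denominator
    positive.\<close>
  define s where "s = r / (2 * (N + 1))"
  have N: "N \<ge> 0"
    by (simp add: N_def)
  have s: "s > 0" "2 * (s * N) \<le> r"
    using r N by (simp_all add: s_def divide_simps)
  let ?O = "(\<lambda>A. A *v (s *\<^sub>R axis i q)) ` M"
  have bound: "norm b \<le> s * N" if "b \<in> ?O" for b
  proof -
    obtain A where A: "A \<in> M" "b = s *\<^sub>R (A *v axis i q)"
      using \<open>b \<in> ?O\<close> by (auto simp: matrix_vector_mult_scaleR_algebra)
    have "norm (A *v axis i q) \<le> (\<Sum>k\<in>(UNIV :: 'n set). norm ((A *v axis i q) $ k))"
      by (simp add: norm_vec_def L2_set_le_sum)
    also have "\<dots> \<le> (\<Sum>k\<in>(UNIV :: 'n set). norm q)"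
    proof (rule sum_mono)
      fix k
      have "norm (A $ k $ i * q) \<le> norm (A $ k $ i) * norm q"
        by (rule norm_mult_ineq)
      also have "\<dots> \<le> norm q"
        using bounded[OF A(1), of k i] by (simp add: mult_left_le_one_le)
      finally show "norm ((A *v axis i q) $ k) \<le> norm q"
        by (simp add: matrix_vector_mult_axis)
    qed
    finally show ?thesis
      using s(1) by (simp add: A(2) N_def)
  qed
  let ?B = "{b + c |b c. b \<in> ?O \<and> c \<in> ?O}"
  show ?thesis
  proof (intro exI conjI allI impI)
    show "2 * s > 0"
      using s by simp
    show "traceable (?B \<times> {mat 1})"
      by (intro traceable_translations_add traceable_orbit)
    show "\<forall>b\<in>?B. norm b \<le> r"
    proof
      fix d assume "d \<in> ?B"
      then obtain b c where bc: "b \<in> ?O" "c \<in> ?O" "d = b + c"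
        by blast
      show "norm d \<le> r"
        unfolding bc(3) using bound[OF bc(1)] bound[OF bc(2)] s(2) norm_triangle_ineq[of b c] by linarith
    qed
    fix t assume "\<bar>t\<bar> < 2 * s"
    then have "\<bar>t / (2 * s)\<bar> \<le> 1"
      using s(1) by (simp add: divide_simps)
    then obtain A A' where A: "A \<in> M" "A' \<in> M"
      "A *v axis i q + A' *v axis i q = (2 * (t / (2 * s))) *\<^sub>R axis i q"
      using half by blast
    have "t *\<^sub>R axis i q = s *\<^sub>R (A *v axis i q + A' *v axis i q)"
      using s(1) by (simp add: A(3))
    also have "\<dots> = A *v (s *\<^sub>R axis i q) + A' *v (s *\<^sub>R axis i q)"
      by (simp add: matrix_vector_mult_scaleR_algebra scaleR_add_right)
    finally show "t *\<^sub>R axis i q \<in> ?B"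
      using A(1,2) by blast
  qed
qed

text \<open>The small sets are the products of \<open>B\<close> with \<open>E \<inter> D\<close>:
  membership in \<open>E\<close> makes the translation part \<open>0\<close>, \<open>D\<close>
  brings the matrix close to \<open>mat 1\<close>, and left multiplication by \<open>B\<close>
  restores the small translations.\<close>

lemma continuous_open:
  assumes nbhds: "\<And>r. r > 0 \<Longrightarrow>
      \<exists>B \<delta>. \<delta> > 0 \<and> traceable (B \<times> {mat 1}) \<and> ball 0 \<delta> \<subseteq> B \<and> B \<subseteq> ball 0 r"
    and stab: "countable \<S>" "\<And>E. E \<in> \<S> \<Longrightarrow> traceable E" "\<Union>\<S> = {0} \<times> M"
  shows "continuous_map S (affine_topology M) \<phi> \<and> open_map S (affine_topology M) \<phi>"
proof (rule continuous_open_if_traceable_nbhds)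
  fix U assume U: "openin (affine_topology M) U" "\<one>\<^bsub>\<G>\<^esub> \<in> U"
  then obtain V where V: "open V" "U = (UNIV \<times> M) \<inter> V"
    unfolding affine_topology_eq openin_open by blast
  then obtain e where e: "e > 0" "ball (0, mat 1) e \<subseteq> V"
    using U(2) open_contains_ball one_affine by (metis IntD2)
  define N where "N = real CARD('n)"
  \<comment> \<open>Each of the \<open>N * N\<close> matrix entries and the translation part
    contribute at most \<open>r\<close> to the distance from the identity.\<close>
  define r where "r = e / (N * N + 2)"
  have r: "r > 0" "r + N * N * r < e"
    using e(1) by (simp_all add: r_def N_def divide_simps add_pos_nonneg algebra_simps)
  obtain B \<delta> where B: "\<delta> > 0" "traceable (B \<times> {mat 1})" "ball 0 \<delta> \<subseteq> B" "B \<subseteq> ball 0 r"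
    using nbhds[OF r(1)] by blast
  \<comment> \<open>The conjugates of the basis translations do not depend on the translation part
    of \<open>x\<close>, so \<open>D\<close> contains all translations and is not small by
    itself.\<close>
  define D where "D = {x \<in> carrier \<G>. \<forall>i\<in>UNIV. x \<otimes>\<^bsub>\<G>\<^esub> (axis i 1, mat 1) \<otimes>\<^bsub>\<G>\<^esub> inv\<^bsub>\<G>\<^esub> x
      \<in> (B \<times> {mat 1}) <#>\<^bsub>\<G>\<^esub> {(axis i 1, mat 1)}}"
  have "traceable D"
    unfolding D_def
    by (intro traceable_Ball traceable_vimage_conj traceable_set_mult B(2) traceable_singleton)
      (simp_all add: carrier_affine mat_1_mem)
  have D: "D = {(u, A). A \<in> M \<and> (\<forall>i. A *v axis i 1 - axis i 1 \<in> B)}"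
  proof -
    have "(B \<times> {mat 1}) <#>\<^bsub>\<G>\<^esub> {(axis i 1, mat 1)} = {(v, C). v - axis i 1 \<in> B \<and> C = mat 1}" for i
      unfolding set_mult_eq
    proof (rule equalityI; rule subsetI)
      fix p :: "('k^'n) \<times> ('k^'n^'n)" assume "p \<in> {(v, C). v - axis i 1 \<in> B \<and> C = mat 1}"
      then show "p \<in> (\<lambda>p. fst p \<otimes>\<^bsub>\<G>\<^esub> snd p) ` ((B \<times> {mat 1}) \<times> {(axis i 1, mat 1)})"
        by (intro image_eqI[of _ _ "((fst p - axis i 1, mat 1), (axis i 1, mat 1))"])
          (auto simp: mult_affine)
    qed (auto simp: mult_affine)
    then show ?thesis
      by (auto simp: D_def carrier_affine conj_translation)
  qed
  define \<E> where "\<E> = (\<lambda>E. (B \<times> {mat 1}) <#>\<^bsub>\<G>\<^esub> (E \<inter> D)) ` \<S>"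
  define W where "W = (UNIV \<times> M) \<inter>
    {p :: ('k^'n) \<times> ('k^'n^'n). norm (fst p) < \<delta> \<and> (\<forall>i. norm (snd p *v axis i 1 - axis i 1) < \<delta>)}"
  show "\<exists>\<E> W. countable \<E> \<and> (\<forall>E\<in>\<E>. traceable E \<and> E \<subseteq> U) \<and> openin (affine_topology M) W \<and>
      \<one>\<^bsub>\<G>\<^esub> \<in> W \<and> W \<subseteq> \<Union>\<E>"
  proof (intro exI conjI ballI)
    show "countable \<E>"
      using stab(1) by (simp add: \<E>_def)
    fix E assume "E \<in> \<E>"
    then obtain E' where E: "E' \<in> \<S>" "E = (B \<times> {mat 1}) <#>\<^bsub>\<G>\<^esub> (E' \<inter> D)"
      by (auto simp: \<E>_def)
    show "traceable E"
      unfolding E(2) using stab(2)[OF E(1)] \<open>traceable D\<close>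
      by (intro traceable_set_mult traceable_Int B(2))
    show "E \<subseteq> U"
    proof
      fix x assume "x \<in> E"
      then obtain b u A where x: "b \<in> B" "(u, A) \<in> E'" "(u, A) \<in> D" "x = (b, mat 1) \<otimes>\<^bsub>\<G>\<^esub> (u, A)"
        unfolding E(2) set_mult_eq by auto
      have "u = 0"
        using stab(3) E(1) x(2) by blast
      then have xb: "x = (b, A)"
        using x(4) by (simp add: mult_affine)
      have A: "A \<in> M" "\<And>i. A *v axis i 1 - axis i 1 \<in> B"
        using x(3) by (auto simp: D)
      have "norm (A - mat 1) \<le> (\<Sum>k\<in>(UNIV::'n set). \<Sum>i\<in>(UNIV::'n set). norm ((A - mat 1) $ k $ i))"
        by (rule norm_matrix_le_entries)
      also have "\<dots> \<le> (\<Sum>k\<in>(UNIV::'n set). \<Sum>i\<in>(UNIV::'n set). r)"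
      proof (intro sum_mono)
        fix k i
        have "(A - mat 1) $ k $ i = (A *v axis i 1 - axis i 1) $ k"
          by (simp add: matrix_vector_mult_axis) (simp add: mat_def axis_def)
        moreover have "norm (A *v axis i 1 - axis i 1) < r"
          using A(2)[of i] B(4) by (auto simp: subset_iff)
        ultimately show "norm ((A - mat 1) $ k $ i) \<le> r"
          using Finite_Cartesian_Product.norm_nth_le[of "A *v axis i 1 - axis i 1" k] by simp
      qed
      also have "\<dots> = N * N * r"
        by (simp add: N_def)
      finally have "norm (A - mat 1) \<le> N * N * r" .
      moreover have "norm b < r"
        using x(1) B(4) by (auto simp: subset_iff)
      ultimately have "norm (b, A - mat 1) < e"
        using norm_Pair_le[of b "A - mat 1"] r(2) by linarith
      then have "(b, A) \<in> ball (0, mat 1) e"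
        by (simp add: dist_commute dist_norm)
      then show "x \<in> U"
        using e(2) A(1) xb V(2) by auto
    qed
  next
    have "open ({p :: ('k^'n) \<times> ('k^'n^'n). norm (fst p) < \<delta>} \<inter>
        (\<Inter>i. {p. norm (snd p *v axis i 1 - axis i 1) < \<delta>}))"
      by (intro open_Int open_INT ballI open_Collect_less continuous_intros finite)
    also have "{p :: ('k^'n) \<times> ('k^'n^'n). norm (fst p) < \<delta>} \<inter>
        (\<Inter>i. {p. norm (snd p *v axis i 1 - axis i 1) < \<delta>}) =
        {p. norm (fst p) < \<delta> \<and> (\<forall>i. norm (snd p *v axis i 1 - axis i 1) < \<delta>)}"
      by auto
    finally have "open {p :: ('k^'n) \<times> ('k^'n^'n). norm (fst p) < \<delta> \<and>
        (\<forall>i. norm (snd p *v axis i 1 - axis i 1) < \<delta>)}" .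
    then show "openin (affine_topology M) W"
      unfolding affine_topology_eq W_def by (auto simp: openin_open)
    show "\<one>\<^bsub>\<G>\<^esub> \<in> W"
      using B(1) by (simp add: W_def one_affine mat_1_mem)
    show "W \<subseteq> \<Union>\<E>"
    proof
      fix x assume "x \<in> W"
      then obtain u A where x: "x = (u, A)" "A \<in> M" "norm u < \<delta>"
        "\<And>i. norm (A *v axis i 1 - axis i 1) < \<delta>"
        by (auto simp: W_def)
      have "(0, A) \<in> D"
        using x(2,4) B(3) by (auto simp: D subset_iff)
      moreover obtain E where E: "E \<in> \<S>" "(0, A) \<in> E"
        using stab(3) x(2) by blast
      moreover have "(u, mat 1) \<in> B \<times> {mat 1}"
        using x(3) B(3) by auto
      moreover have "x = (u, mat 1) \<otimes>\<^bsub>\<G>\<^esub> (0, A)"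
        by (simp add: x(1) mult_affine)
      ultimately have "x \<in> (B \<times> {mat 1}) <#>\<^bsub>\<G>\<^esub> (E \<inter> D)"
        unfolding set_mult_def by blast
      then show "x \<in> \<Union>\<E>"
        using E(1) by (auto simp: \<E>_def)
    qed
  qed
qed

end

lemma (in matrix_topgroup) rigid_within_affine:
  fixes \<K> :: "'u topology set"
  assumes K: "almost_Polish \<K>" "in_class \<K> (affine_topology M)"
    and *: "\<And>(L :: 'u monoid) S \<phi>. affine_analytic_epi M J \<K> L S \<phi> \<Longrightarrow>
      continuous_map S (affine_topology M) \<phi> \<and> open_map S (affine_topology M) \<phi>"
  shows "rigid_within \<K> \<G> (affine_topology M)"
  unfolding rigid_within_def
proof (intro conjI allI impI)
  show "topological_group \<G> (affine_topology M)"
    by (rule topological_group_affine)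
  show "in_class \<K> (affine_topology M)"
    by (rule K)
  fix L :: "'u monoid" and S \<phi>
  assume "topological_group L S \<and> in_class \<K> S \<and> \<phi> \<in> epi L \<G> \<and> class_analytic \<K> S (kernel L \<G> \<phi>)"
  then have "affine_analytic_epi M J \<K> L S \<phi>"
    using K topological_group_affine by unfold_locales auto
  then show "continuous_map S (affine_topology M) \<phi>" "open_map S (affine_topology M) \<phi>"
    using * by blast+
qed

section \<open>The classical groups as topological groups\<close>

definition diag_mat :: "('n \<Rightarrow> 'k) \<Rightarrow> 'k::zero^'n^'n" where
  "diag_mat d = (\<chi> i j. if i = j then d i else 0)"

lemma diag_mat_nth [simp]: "diag_mat d $ i $ j = (if i = j then d i else 0)"
  by (simp add: diag_mat_def)

lemma mat_eq_diag_mat: "mat c = diag_mat (\<lambda>_. c)"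
  by (simp add: diag_mat_def mat_def)

lemma diag_mat_mult_vec [simp]:
  fixes d :: "'n::finite \<Rightarrow> 'k::semiring_1"
  shows "(diag_mat d *v x) $ i = d i * x $ i"
  by (simp add: matrix_vector_mult_def if_distrib[of "\<lambda>y. y * _"] cong: if_cong)

lemma diag_mat_mult_left:
  fixes d :: "'n::finite \<Rightarrow> 'k::semiring_1"
  shows "(diag_mat d ** A) $ i $ j = d i * A $ i $ j"
  by (simp add: matrix_matrix_mult_def if_distrib[of "\<lambda>y. y * _"] cong: if_cong)

lemma diag_mat_mult_right:
  fixes d :: "'n::finite \<Rightarrow> 'k::semiring_1"
  shows "(A ** diag_mat d) $ i $ j = A $ i $ j * d j"
  by (simp add: matrix_matrix_mult_def if_distrib[of "\<lambda>y. _ * y"] cong: if_cong)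

lemma diag_mat_mult:
  fixes d :: "'n::finite \<Rightarrow> 'k::semiring_1"
  shows "diag_mat d ** diag_mat e = diag_mat (\<lambda>i. d i * e i)"
  by (simp add: vec_eq_iff diag_mat_mult_left)

lemma det_diag_mat: "det (diag_mat d) = prod d UNIV"
  by (simp add: det_diagonal)

lemma prod_delta2:
  fixes a b :: "'k::comm_monoid_mult"
  assumes "i \<noteq> j"
  shows "(\<Prod>k\<in>(UNIV :: 'n::finite set). if k = i then a else if k = j then b else 1) = a * b"
proof -
  have "(\<Prod>k\<in>UNIV - {i}. if k = i then a else if k = j then b else 1) = (\<Prod>k\<in>UNIV - {i}. if k = j then b else 1)"
    by (rule prod.cong) auto
  also have "\<dots> = b"
    using assms by simp
  finally show ?thesis
    by (subst prod.remove[of UNIV i]) auto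
qed

section \<open>Continuity of matrix inversion\<close>

lemma continuous_on_det:
  fixes f :: "'a::topological_space \<Rightarrow> real^'n^'n"
  assumes "\<And>i j. continuous_on X (\<lambda>x. f x $ i $ j)"
  shows "continuous_on X (\<lambda>x. det (f x))"
  unfolding det_def by (intro continuous_on_sum continuous_on_mult continuous_on_const continuous_on_prod assms)

lemma
  fixes A :: "'k::semiring_1^'n^'n"
  assumes "invertible A"
  shows matrix_inv_mult_left: "matrix_inv A ** A = mat 1"
    and matrix_inv_mult_right: "A ** matrix_inv A = mat 1"
  using someI_ex[OF assms[unfolded invertible_def]] unfolding matrix_inv_def by blast+

text \<open>Column \<open>l\<close> of the inverse solves the linear system with right hand side
  \<open>axis l 1\<close>. The formula exhibits its entries as quotients of polynomials in the
  entries of \<open>A\<close>, hence as continuous.\<close>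

lemma matrix_inv_eq_cramer:
  fixes A :: "real^'n^'n"
  assumes "det A \<noteq> 0"
  shows "matrix_inv A $ k $ l = det (\<chi> i j. if j = k then axis l 1 $ i else A $ i $ j) / det A"
proof -
  have "A *v (matrix_inv A *v axis l 1) = axis l 1"
    using assms by (simp add: matrix_vector_mul_assoc matrix_inv_mult_right invertible_det_nz)
  then have "(matrix_inv A *v axis l 1) $ k
      = det (\<chi> i j. if j = k then axis l 1 $ i else A $ i $ j) / det A"
    unfolding cramer[OF assms] by simp
  then show ?thesis
    by (simp add: matrix_vector_mult_axis)
qed

lemma continuous_on_matrix_inv:
  fixes M :: "(real^'n^'n) set"
  assumes "\<And>A. A \<in> M \<Longrightarrow> invertible A"
  shows "continuous_on M matrix_inv"
proof -
  have d: "det A \<noteq> 0" if "A \<in> M" for A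
    using assms[OF that] by (simp add: invertible_det_nz)
  have "continuous_on M (\<lambda>A. det (\<chi> i j. if j = k then axis l 1 $ i else A $ i $ j) / det A)" for k l
  proof (intro continuous_on_divide continuous_on_det)
    fix i j
    show "continuous_on M (\<lambda>A. (\<chi> i j. if j = k then axis l 1 $ i else A $ i $ j) $ i $ j)"
      by (cases "j = k") (auto intro!: continuous_intros)
  qed (use d in \<open>auto intro!: continuous_intros\<close>)
  then have "continuous_on M (\<lambda>A. \<chi> k l. det (\<chi> i j. if j = k then axis l 1 $ i else A $ i $ j) / det A)"
    by (intro continuous_on_vec_lambda)
  then show ?thesis
    by (rule continuous_on_eq) (simp add: vec_eq_iff matrix_inv_eq_cramer d)
qed

lemma matrix_topgroup_matrix_inv:
  fixes M :: "(real^'n^'n) set"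
  assumes "mat 1 \<in> M" "\<And>A B. A \<in> M \<Longrightarrow> B \<in> M \<Longrightarrow> A ** B \<in> M"
    "\<And>A. A \<in> M \<Longrightarrow> invertible A" "\<And>A. A \<in> M \<Longrightarrow> matrix_inv A \<in> M"
  shows "matrix_topgroup M matrix_inv"
  by unfold_locales (use assms in \<open>auto intro: matrix_inv_mult_left matrix_inv_mult_right continuous_on_matrix_inv\<close>)

lemma continuous_on_transpose:
  "continuous_on X (transpose :: 'k::topological_space^'n^'m \<Rightarrow> _)"
  unfolding transpose_def by (intro continuous_intros)

section \<open>The matrix groups with their inversion maps\<close>

lemma matrix_topgroup_O: "matrix_topgroup (O_mats :: (real^'n::finite^'n) set) transpose"
  by unfold_locales
    (simp_all add: O_mats_def orthogonal_matrix_id orthogonal_matrix_mul continuous_on_transpose,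
      simp_all add: orthogonal_matrix_def)

lemma matrix_topgroup_SO: "matrix_topgroup (SO_mats :: (real^'n::finite^'n) set) transpose"
  by unfold_locales
    (simp_all add: SO_mats_def rotation_matrix_def orthogonal_matrix_id orthogonal_matrix_mul det_mul
      continuous_on_transpose, simp_all add: orthogonal_matrix_def)

lemma cadjoint_mult: "cadjoint (A ** B) = cadjoint B ** cadjoint A"
  by (simp add: cadjoint_def matrix_matrix_mult_def vec_eq_iff mult.commute)

lemma cadjoint_cadjoint [simp]: "cadjoint (cadjoint A) = A"
  by (simp add: cadjoint_def vec_eq_iff)

lemma cadjoint_diag_mat: "cadjoint (diag_mat d) = diag_mat (\<lambda>i. cnj (d i))"
  by (simp add: cadjoint_def vec_eq_iff)

lemma det_cadjoint: "det (cadjoint A) = cnj (det (A :: complex^'n^'n))"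
proof -
  have "det (cadjoint A) = det (\<chi> i j. cnj (A $ i $ j))"
    using det_transpose[of "\<chi> i j. cnj (A $ i $ j)"] by (simp add: cadjoint_def transpose_def)
  also have "\<dots> = cnj (det A)"
    by (simp add: det_def)
  finally show ?thesis .
qed

lemma matrix_topgroup_SU: "matrix_topgroup (SU_mats :: (complex^'n::finite^'n) set) cadjoint"
proof
  show "mat 1 \<in> (SU_mats :: (complex^'n::finite^'n) set)"
    by (simp add: SU_mats_def mat_eq_diag_mat cadjoint_diag_mat diag_mat_mult det_diag_mat)
  show "continuous_on SU_mats (cadjoint :: complex^'n^'n \<Rightarrow> _)"
    unfolding cadjoint_def by (intro continuous_intros)
next
  fix A B :: "complex^'n^'n" assume "A \<in> SU_mats" "B \<in> SU_mats"
  then have A: "cadjoint A ** A = mat 1" "A ** cadjoint A = mat 1" "det A = 1"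
    and B: "cadjoint B ** B = mat 1" "B ** cadjoint B = mat 1" "det B = 1"
    by (auto simp: SU_mats_def)
  have "cadjoint B ** cadjoint A ** (A ** B) = cadjoint B ** (cadjoint A ** A) ** B"
    "(A ** B) ** (cadjoint B ** cadjoint A) = A ** (B ** cadjoint B) ** cadjoint A"
    by (simp_all only: matrix_mul_assoc)
  then show "A ** B \<in> SU_mats"
    using A B by (simp add: SU_mats_def cadjoint_mult det_mul)
qed (auto simp: SU_mats_def det_cadjoint)

lemma qcnj_mult: "qcnj (x * y) = qcnj y * qcnj x"
  by (simp add: quat_eq_iff algebra_simps)

lemma qcnj_simps [simp]: "qcnj (qcnj x) = x" "qcnj 0 = 0" "qcnj 1 = 1" "qcnj (x + y) = qcnj x + qcnj y"
  "qcnj (- x) = - qcnj x" "norm (qcnj x) = norm x"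
  by (simp_all add: quat_eq_iff norm_quat_def)

lemma bounded_linear_qcnj: "bounded_linear qcnj"
  by (rule bounded_linear_intro[where K = 1]) (simp_all add: quat_eq_iff norm_quat_def)

lemma qcnj_sum: "qcnj (sum f I) = (\<Sum>i\<in>I. qcnj (f i))"
  by (rule linear_sum[OF bounded_linear.linear[OF bounded_linear_qcnj]])

lemma quat_mult_qcnj: "x * qcnj x = of_real ((norm x)\<^sup>2)"
  by (simp add: quat_eq_iff norm_quat_def of_real_def power2_eq_square)

lemma qadjoint_mult: "qadjoint (A ** B) = qadjoint B ** qadjoint A"
  by (simp add: qadjoint_def matrix_matrix_mult_def vec_eq_iff qcnj_mult qcnj_sum)

lemma qadjoint_qadjoint [simp]: "qadjoint (qadjoint A) = A"
  by (simp add: qadjoint_def vec_eq_iff)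

lemma qadjoint_diag_mat: "qadjoint (diag_mat d) = diag_mat (\<lambda>i. qcnj (d i))"
  by (simp add: qadjoint_def vec_eq_iff)

lemma matrix_topgroup_Sp: "matrix_topgroup (Sp_mats :: (quat^'n::finite^'n) set) qadjoint"
proof
  show "mat 1 \<in> (Sp_mats :: (quat^'n::finite^'n) set)"
    by (simp add: Sp_mats_def mat_eq_diag_mat qadjoint_diag_mat diag_mat_mult)
  show "continuous_on Sp_mats (qadjoint :: quat^'n^'n \<Rightarrow> _)"
    unfolding qadjoint_def
    by (intro continuous_on_vec_lambda bounded_linear.continuous_on[OF bounded_linear_qcnj] continuous_intros)
next
  fix A B :: "quat^'n^'n" assume "A \<in> Sp_mats" "B \<in> Sp_mats"
  then have A: "qadjoint A ** A = mat 1" "A ** qadjoint A = mat 1"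
    and B: "qadjoint B ** B = mat 1" "B ** qadjoint B = mat 1"
    by (auto simp: Sp_mats_def)
  have "qadjoint B ** qadjoint A ** (A ** B) = qadjoint B ** (qadjoint A ** A) ** B"
    "(A ** B) ** (qadjoint B ** qadjoint A) = A ** (B ** qadjoint B) ** qadjoint A"
    by (simp_all only: matrix_mul_assoc)
  then show "A ** B \<in> Sp_mats"
    using A B by (simp add: Sp_mats_def qadjoint_mult)
qed (auto simp: Sp_mats_def)

lemma symplectic_form_axis:
  "symplectic_form x (axis (Inr i) 1) = x $ Inl i"
  "symplectic_form x (axis (Inl i) 1) = - x $ Inr i"
  by (simp_all add: symplectic_form_def axis_def if_distrib[of "\<lambda>y. _ * y"] sum_negf cong: if_cong)

text \<open>Nondegeneracy of the form: a vector in the kernel of \<open>A\<close> pairs to zero with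
  every vector, and pairing with the basis vectors reads off its coordinates.\<close>

lemma invertible_SpR:
  assumes "A \<in> SpR_mats"
  shows "invertible A"
proof -
  have "x = 0" if "A *v x = 0" for x
  proof -
    have "symplectic_form x y = 0" for y
    proof -
      have "symplectic_form x y = symplectic_form (A *v x) (A *v y)"
        using assms by (simp add: SpR_mats_def)
      then show ?thesis
        by (simp add: that symplectic_form_def)
    qed
    then have "x $ k = 0" for k
      using symplectic_form_axis[of x] by (cases k) (metis, metis add.inverse_neutral minus_minus)
    then show ?thesis
      by (simp add: vec_eq_iff)
  qed
  then show ?thesis
    using invertible_left_inverse matrix_left_invertible_ker by blast
qed

lemma matrix_topgroup_SpR:
  "matrix_topgroup (SpR_mats :: (real^('n::finite + 'n)^('n + 'n)) set) matrix_inv"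
proof (rule matrix_topgroup_matrix_inv)
  fix A :: "real^('n + 'n)^('n + 'n)" assume A: "A \<in> SpR_mats"
  have "symplectic_form (matrix_inv A *v x) (matrix_inv A *v y) = symplectic_form x y" for x y
  proof -
    have "symplectic_form (matrix_inv A *v x) (matrix_inv A *v y)
        = symplectic_form (A *v (matrix_inv A *v x)) (A *v (matrix_inv A *v y))"
      using A by (simp add: SpR_mats_def)
    then show ?thesis
      by (simp add: matrix_vector_mul_assoc matrix_inv_mult_right[OF invertible_SpR[OF A]])
  qed
  then show "matrix_inv A \<in> SpR_mats"
    by (simp add: SpR_mats_def)
qed (auto simp: SpR_mats_def invertible_SpR simp flip: matrix_vector_mul_assoc)

lemma det_matrix_inv:
  assumes "invertible (A :: 'k::field^'n^'n)"
  shows "det (matrix_inv A) * det A = 1"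
  using matrix_inv_mult_left[OF assms] by (metis det_I det_mul)

lemma matrix_topgroup_SL: "matrix_topgroup (SL_mats :: (real^'n::finite^'n) set) matrix_inv"
proof (rule matrix_topgroup_matrix_inv)
  fix A :: "real^'n^'n" assume "A \<in> SL_mats"
  then have "det A = 1"
    by (simp add: SL_mats_def)
  moreover from this show "invertible A"
    by (simp add: invertible_det_nz)
  ultimately show "matrix_inv A \<in> SL_mats"
    using det_matrix_inv by (fastforce simp: SL_mats_def)
qed (auto simp: SL_mats_def det_mul)

lemma matrix_topgroup_GL: "matrix_topgroup (GL_mats :: (real^'n::finite^'n) set) matrix_inv"
proof (rule matrix_topgroup_matrix_inv)
  fix A :: "real^'n^'n" assume "A \<in> GL_mats"
  then show "matrix_inv A \<in> GL_mats"
    using matrix_inv_mult_left matrix_inv_mult_right unfolding GL_mats_def mem_Collect_eq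
    by (meson invertible_def)
qed (auto simp: GL_mats_def invertible_det_nz det_mul)

text \<open>
  A bounded interval of a coordinate axis is an intersection of two half lines, and the open half
  line of positive multiples of a basis vector is its orbit under the squares of a torus.
\<close>

lemma axis_nbhd_if_torus:
  fixes M :: "(real^'n::finite^'n) set" and i j :: 'n
  assumes "affine_analytic_epi M J \<K> L S \<phi>"
    and ij: "i \<noteq> j"
    and torus: "\<And>a. a \<noteq> 0 \<Longrightarrow> diag_mat (\<lambda>k. if k = i then a else if k = j then 1 / a else 1) \<in> M"
    and r: "r > 0"
  shows "\<exists>B \<delta>. \<delta> > 0 \<and> analytic_epi.traceable \<K> L S (affine_group M) \<phi> (B \<times> {mat 1}) \<and>
        (\<forall>b\<in>B. norm b \<le> r) \<and> (\<forall>t. \<bar>t\<bar> < \<delta> \<longrightarrow> t *\<^sub>R (axis i 1 :: real^'n) \<in> B)"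
proof -
  interpret affine_analytic_epi M J \<K> L S \<phi> by fact
  define d where "d = (\<lambda>a. diag_mat (\<lambda>k. if k = i then a else if k = j then 1 / a else 1) :: real^'n^'n)"
  have d: "d a \<in> M" if "a \<noteq> 0" for a
    using torus[OF that] by (simp add: d_def)
  define e where "e = (axis i 1 :: real^'n)"
  have de: "d a *v e = a *\<^sub>R e" for a
    by (simp add: vec_eq_iff d_def e_def axis_def)
  \<comment> \<open>The eigenvalue \<open>2\<close> of \<open>d 2\<close> is simple, so every matrix
    commuting with it has \<open>e\<close> as an eigenvector. Nonzero translation parts may occur in
    \<open>C\<close>; conjugation of a translation ignores them.\<close>
  define C where "C = {x \<in> carrier \<G>. x \<otimes>\<^bsub>\<G>\<^esub> (0, d 2) = (0, d 2) \<otimes>\<^bsub>\<G>\<^esub> x}"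
  have "traceable C"
    unfolding C_def by (rule traceable_centralizer) (simp add: carrier_affine d)
  \<comment> \<open>The square of an element of \<open>C\<close> multiplies \<open>e\<close> by
    \<open>a * a\<close>, so the sign of the eigenvalue \<open>a\<close> disappears;
    \<open>d (sqrt p)\<close> attains every positive \<open>p\<close>.\<close>
  define P where "P = {p *\<^sub>R e |p. p > 0}"
  have "(\<lambda>x. x \<otimes>\<^bsub>\<G>\<^esub> (e, mat 1) \<otimes>\<^bsub>\<G>\<^esub> inv\<^bsub>\<G>\<^esub> x) ` (\<lambda>x. x \<otimes>\<^bsub>\<G>\<^esub> x) ` C = P \<times> {mat 1}"
  proof (rule equalityI; rule subsetI)
    fix y assume "y \<in> (\<lambda>x. x \<otimes>\<^bsub>\<G>\<^esub> (e, mat 1) \<otimes>\<^bsub>\<G>\<^esub> inv\<^bsub>\<G>\<^esub> x) ` (\<lambda>x. x \<otimes>\<^bsub>\<G>\<^esub> x) ` C"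
    then obtain x where x: "x \<in> C" "y = x \<otimes>\<^bsub>\<G>\<^esub> x \<otimes>\<^bsub>\<G>\<^esub> (e, mat 1) \<otimes>\<^bsub>\<G>\<^esub> inv\<^bsub>\<G>\<^esub> (x \<otimes>\<^bsub>\<G>\<^esub> x)"
      by blast
    obtain u A where uA: "x = (u, A)"
      by fastforce
    then have A: "A \<in> M" "A ** d 2 = d 2 ** A"
      using x(1) by (auto simp: C_def carrier_affine mult_affine)
    have xx: "x \<otimes>\<^bsub>\<G>\<^esub> x = (u + A *v u, A ** A)"
      by (simp add: uA mult_affine)
    have y: "y = (A ** A *v e, mat 1)"
      unfolding x(2) xx using A(1) by (intro conj_translation mult_mem)
    define a where "a = A $ i $ i"
    have "A $ k $ i = 0" if "k \<noteq> i" for k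
    proof -
      have "(A ** d 2) $ k $ i = (d 2 ** A) $ k $ i"
        by (simp add: A(2))
      then show ?thesis
        using that by (auto simp: d_def diag_mat_mult_left diag_mat_mult_right split: if_splits)
    qed
    then have Ae: "A *v e = a *\<^sub>R e"
      by (auto simp: vec_eq_iff e_def matrix_vector_mult_axis a_def) (auto simp: axis_def)
    have "a \<noteq> 0"
    proof
      assume "a = 0"
      then have "J A *v (A *v e) = 0"
        by (simp add: Ae)
      then show False
        using J_left[OF A(1)] by (simp add: matrix_vector_mul_assoc e_def)
    qed
    then have "a * a > 0"
      by (simp add: zero_less_mult_iff) linarith
    moreover have "A ** A *v e = (a * a) *\<^sub>R e"
      by (simp add: matrix_vector_mul_assoc[symmetric] Ae matrix_vector_mult_scaleR)
    ultimately show "y \<in> P \<times> {mat 1}"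
      using y by (auto simp: P_def)
  next
    fix y :: "(real^'n) \<times> (real^'n^'n)" assume "y \<in> P \<times> {mat 1}"
    then obtain p where p: "p > 0" "y = (p *\<^sub>R e, mat 1)"
      by (auto simp: P_def)
    define x where "x = (0 :: real^'n, d (sqrt p))"
    have "x \<in> C"
      using p(1) d by (simp add: x_def C_def carrier_affine mult_affine)
        (simp add: d_def diag_mat_mult mult.commute)
    moreover have "(x \<otimes>\<^bsub>\<G>\<^esub> x) \<otimes>\<^bsub>\<G>\<^esub> (e, mat 1) \<otimes>\<^bsub>\<G>\<^esub> inv\<^bsub>\<G>\<^esub> (x \<otimes>\<^bsub>\<G>\<^esub> x) = y"
    proof -
      have "d (sqrt p) ** d (sqrt p) *v e = p *\<^sub>R e"
        using p(1) by (simp add: matrix_vector_mul_assoc[symmetric] de matrix_vector_mult_scaleR)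
      moreover have xx: "x \<otimes>\<^bsub>\<G>\<^esub> x = (0, d (sqrt p) ** d (sqrt p))"
        by (simp add: x_def mult_affine)
      moreover have "d (sqrt p) ** d (sqrt p) \<in> M"
        using p(1) d by (simp add: mult_mem)
      note conj_translation[OF this, of 0 e]
      ultimately show ?thesis
        unfolding xx p(2) by (simp only:)
    qed
    ultimately show "y \<in> (\<lambda>x. x \<otimes>\<^bsub>\<G>\<^esub> (e, mat 1) \<otimes>\<^bsub>\<G>\<^esub> inv\<^bsub>\<G>\<^esub> x) ` (\<lambda>x. x \<otimes>\<^bsub>\<G>\<^esub> x) ` C"
      by blast
  qed
  then have P: "traceable (P \<times> {mat 1})"
    using traceable_image_conj[OF traceable_image_square[OF \<open>traceable C\<close>], of "(e, mat 1)"]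
    by (simp add: carrier_affine mat_1_mem)
  have "(\<lambda>x. inv\<^bsub>\<G>\<^esub> x) ` (P \<times> {mat 1}) = uminus ` P \<times> {mat 1}"
  proof -
    have "J (mat 1) = mat 1"
      using J_left[OF mat_1_mem] by simp
    then show ?thesis
      by (force simp: inv_affine mat_1_mem image_iff)
  qed
  then have mP: "traceable (uminus ` P \<times> {mat 1})"
    using traceable_image_inv[OF P] by simp
  have single: "traceable ({v} \<times> {mat 1})" for v
    using traceable_singleton[of "(v, mat 1)"] by (simp add: carrier_affine mat_1_mem)
  define B where "B = {b + c |b c. b \<in> {- r *\<^sub>R e} \<and> c \<in> P} \<inter> {b + c |b c. b \<in> {r *\<^sub>R e} \<and> c \<in> uminus ` P}"
  have "traceable (({b + c |b c. b \<in> {- r *\<^sub>R e} \<and> c \<in> P} \<times> {mat 1}) \<inter>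
      ({b + c |b c. b \<in> {r *\<^sub>R e} \<and> c \<in> uminus ` P} \<times> {mat 1}))"
    by (intro traceable_Int traceable_translations_add single P mP)
  then have "traceable (B \<times> {mat 1})"
    by (simp add: B_def Times_Int_Times)
  moreover have "norm b \<le> r" if "b \<in> B" for b
  proof -
    have "\<exists>p>0. b = - r *\<^sub>R e + p *\<^sub>R e" "\<exists>q>0. b = r *\<^sub>R e + - (q *\<^sub>R e)"
      using that unfolding B_def P_def by auto
    then obtain p q where pq: "p > 0" "q > 0" "b = - r *\<^sub>R e + p *\<^sub>R e" "b = r *\<^sub>R e + - (q *\<^sub>R e)"
      by metis
    have "b $ i = - r + p" "b $ i = r - q"
      by (simp add: pq(3) e_def, simp add: pq(4) e_def)
    then have "\<bar>- r + p\<bar> \<le> r"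
      using pq(1,2) by linarith
    moreover have "b = (- r + p) *\<^sub>R e"
      by (simp only: pq(3) scaleR_add_left)
    moreover have "norm e = 1"
      by (simp add: e_def)
    ultimately show ?thesis
      by simp
  qed
  moreover have "t *\<^sub>R e \<in> B" if "\<bar>t\<bar> < r" for t
  proof -
    have "t *\<^sub>R e = - r *\<^sub>R e + (r + t) *\<^sub>R e" "t *\<^sub>R e = r *\<^sub>R e + - ((r - t) *\<^sub>R e)"
      by (simp_all add: algebra_simps)
    moreover have "r + t > 0" "r - t > 0"
      using that by auto
    ultimately show ?thesis
      unfolding B_def P_def by blast
  qed
  ultimately show ?thesis
    using r unfolding e_def by blast
qed

lemma real_spanned_by_1:
  "\<exists>t. x = (\<Sum>q\<in>{1}. t q *\<^sub>R q) \<and> (\<forall>q\<in>{1}. \<bar>t q\<bar> \<le> norm x)" for x :: real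
  by (rule exI[of _ "\<lambda>_. x"]) simp

lemma complex_spanned_by_1_i:
  "\<exists>t. x = (\<Sum>q\<in>{1, \<i>}. t q *\<^sub>R q) \<and> (\<forall>q\<in>{1, \<i>}. \<bar>t q\<bar> \<le> norm x)" for x :: complex
  by (rule exI[of _ "\<lambda>q. if q = 1 then Re x else Im x"])
    (auto simp: complex_eq_iff abs_Re_le_cmod abs_Im_le_cmod)

definition quat_units :: "quat set" where
  "quat_units = {1, Quat 0 1 0 0, Quat 0 0 1 0, Quat 0 0 0 1}"

lemma quat_spanned_by_units:
  "\<exists>t. x = (\<Sum>q\<in>quat_units. t q *\<^sub>R q) \<and> (\<forall>q\<in>quat_units. \<bar>t q\<bar> \<le> norm x)" for x :: quat
proof -
  have le: "\<bar>a\<bar> \<le> sqrt (a\<^sup>2 + b\<^sup>2 + c\<^sup>2 + d\<^sup>2)" for a b c d :: real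
    by (rule real_le_rsqrt) simp
  have "\<bar>qRe x\<bar> \<le> norm x" "\<bar>qI x\<bar> \<le> norm x" "\<bar>qJ x\<bar> \<le> norm x" "\<bar>qK x\<bar> \<le> norm x"
    using le[of "qRe x" "qI x" "qJ x" "qK x"] le[of "qI x" "qRe x" "qJ x" "qK x"]
      le[of "qJ x" "qI x" "qRe x" "qK x"] le[of "qK x" "qI x" "qJ x" "qRe x"]
    by (simp_all add: norm_quat_def ac_simps)
  \<comment> \<open>The coefficient of a unit \<open>q\<close> is the Euclidean inner product of
    \<open>x\<close> and \<open>q\<close>.\<close>
  then show ?thesis
    by (intro exI[of _ "\<lambda>q. qRe x * qRe q + qI x * qI q + qJ x * qJ q + qK x * qK q"])
      (simp add: quat_units_def quat_eq_iff)
qed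

section \<open>Generators of the special linear and special orthogonal groups\<close>

text \<open>Written with \<open>of_bool\<close> so as to match the elementary matrices in
  \<open>induct_matrix_elementary\<close>.\<close>

definition transvection :: "'n \<Rightarrow> 'n \<Rightarrow> real \<Rightarrow> real^'n^'n" where
  "transvection m n c = (\<chi> i j. if i = m \<and> j = n then c else of_bool (i = j))"

lemma transvection_nth [simp]:
  "transvection m n c $ i $ j = (if i = m \<and> j = n then c else of_bool (i = j))"
  by (simp add: transvection_def)

lemma mult_transvection_nth:
  fixes A :: "real^'n::finite^'n"
  assumes "m \<noteq> n"
  shows "(A ** transvection m n c) $ i $ j = (if j = n then A $ i $ n + c * A $ i $ m else A $ i $ j)"
proof (cases "j = n")
  case True
  have "(A ** transvection m n c) $ i $ n
      = (\<Sum>k\<in>UNIV. (if k = m then c * A $ i $ m else 0) + (if k = n then A $ i $ n else 0))"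
    unfolding matrix_matrix_mult_def using assms by (auto intro!: sum.cong)
  then show ?thesis
    using True by (simp add: sum.distrib)
next
  case False
  have "(A ** transvection m n c) $ i $ j = (\<Sum>k\<in>UNIV. if k = j then A $ i $ j else 0)"
    unfolding matrix_matrix_mult_def using False by (auto intro!: sum.cong)
  then show ?thesis
    using False by simp
qed

lemma det_transvection:
  assumes "m \<noteq> n"
  shows "det (transvection m n c :: real^'n::finite^'n) = 1"
proof -
  have "transvection m n c = (\<chi> k. if k = m then row m (mat 1) + c *s row n (mat 1) else row k (mat 1))"
    using assms by (auto simp: vec_eq_iff row_def mat_def)
  then show ?thesis
    using det_row_operation[OF assms, of "mat 1 :: real^'n^'n" c] by simp
qed

lemma transvection_conj_diag_mat:
  fixes d e :: "'n::finite \<Rightarrow> real"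
  assumes "m \<noteq> n" "\<And>i. d i * e i = 1"
  shows "diag_mat d ** transvection m n c ** diag_mat e = transvection m n (d m * c * e n)"
  using assms by (auto simp: vec_eq_iff diag_mat_mult_left diag_mat_mult_right)

lemma SL_mats_subset_monoid:
  fixes \<Gamma> :: "(real^'n::finite^'n) set"
  assumes one: "mat 1 \<in> \<Gamma>" and mult: "\<And>A B. A \<in> \<Gamma> \<Longrightarrow> B \<in> \<Gamma> \<Longrightarrow> A ** B \<in> \<Gamma>"
    and transvection: "\<And>m n c. m \<noteq> n \<Longrightarrow> transvection m n c \<in> \<Gamma>"
    and diag: "\<And>d. prod d UNIV = 1 \<Longrightarrow> diag_mat d \<in> \<Gamma>"
  shows "SL_mats \<subseteq> \<Gamma>"
proof
  \<comment> \<open>Passing to a monoid normalised by the diagonal matrices makes Gaussian elimination applicable,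
     which leaves a diagonal factor.\<close>
  define \<Delta> where "\<Delta> = {A. det A = 1 \<and> (\<forall>d e. (\<forall>i. d i * e i = 1) \<longrightarrow> diag_mat d ** A ** diag_mat e \<in> \<Gamma>)}"
  have \<Delta>1: "mat 1 \<in> \<Delta>"
    using one by (simp add: \<Delta>_def diag_mat_mult flip: mat_eq_diag_mat)
  have \<Delta>mult: "A ** B \<in> \<Delta>" if "A \<in> \<Delta>" "B \<in> \<Delta>" for A B
  proof -
    have "diag_mat d ** (A ** B) ** diag_mat e \<in> \<Gamma>" if de: "\<forall>i. d i * e i = 1" for d e
    proof -
      have "diag_mat e ** diag_mat d = (mat 1 :: real^'n^'n)"
        using de by (simp add: diag_mat_mult mat_eq_diag_mat mult.commute)
      then have "diag_mat d ** (A ** B) ** diag_mat e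
          = (diag_mat d ** A ** diag_mat e) ** (diag_mat d ** B ** diag_mat e)"
        by (metis matrix_mul_assoc matrix_mul_lid)
      then show ?thesis
        using \<open>A \<in> \<Delta>\<close> \<open>B \<in> \<Delta>\<close> de mult by (simp add: \<Delta>_def)
    qed
    then show ?thesis
      using that by (simp add: \<Delta>_def det_mul)
  qed
  have \<Delta>trans: "transvection m n c \<in> \<Delta>" if "m \<noteq> n" for m n c
    using that transvection by (simp add: \<Delta>_def det_transvection transvection_conj_diag_mat)
  have \<Delta>conj: "diag_mat d ** A ** diag_mat e \<in> \<Delta>" if A: "A \<in> \<Delta>" and de: "\<And>i. d i * e i = 1" for d e A
  proof -
    have "diag_mat d' ** (diag_mat d ** A ** diag_mat e) ** diag_mat e' \<in> \<Gamma>"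
      if de': "\<forall>i. d' i * e' i = 1" for d' e'
    proof -
      have "diag_mat d' ** (diag_mat d ** A ** diag_mat e) ** diag_mat e'
          = diag_mat (\<lambda>i. d' i * d i) ** A ** diag_mat (\<lambda>i. e i * e' i)"
        unfolding diag_mat_mult[symmetric] by (simp add: matrix_mul_assoc)
      moreover have "(d' i * d i) * (e i * e' i) = 1" for i
        using de[of i] de'[rule_format, of i] by (metis mult.assoc mult.left_neutral mult.commute)
      ultimately show ?thesis
        using A by (simp add: \<Delta>_def)
    qed
    moreover have "det (diag_mat d ** A ** diag_mat e) = 1"
      using A de by (simp add: det_mul \<Delta>_def det_diag_mat prod.distrib[symmetric])
    ultimately show ?thesis
      by (simp add: \<Delta>_def)
  qed
  \<comment> \<open>Elements of \<open>\<Delta>\<close> have determinant \<open>1\<close>, so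
    \<open>d\<close> carries the whole determinant of \<open>A\<close>; for determinant
    \<open>1\<close> the diagonal factor is thus one of those assumed in \<open>\<Gamma>\<close>.
    The premise disposes of the singular matrices that the induction passes through.\<close>
  have decomp: "det A \<noteq> 0 \<longrightarrow> (\<exists>Q\<in>\<Delta>. \<exists>d. (\<forall>i. d i \<noteq> 0) \<and> A = Q ** diag_mat d)" for A :: "real^'n^'n"
  proof (rule induct_matrix_elementary[where P = "\<lambda>A. det A \<noteq> 0 \<longrightarrow> (\<exists>Q\<in>\<Delta>. \<exists>d. (\<forall>i. d i \<noteq> 0) \<and> A = Q ** diag_mat d)"];
      (intro impI)?)
    fix A B :: "real^'n^'n"
    assume IH: "det A \<noteq> 0 \<longrightarrow> (\<exists>Q\<in>\<Delta>. \<exists>d. (\<forall>i. d i \<noteq> 0) \<and> A = Q ** diag_mat d)"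
      "det B \<noteq> 0 \<longrightarrow> (\<exists>Q\<in>\<Delta>. \<exists>d. (\<forall>i. d i \<noteq> 0) \<and> B = Q ** diag_mat d)" and "det (A ** B) \<noteq> 0"
    then obtain Q d R e where Q: "Q \<in> \<Delta>" "\<And>i. d i \<noteq> 0" "A = Q ** diag_mat d"
      and R: "R \<in> \<Delta>" "\<And>i. e i \<noteq> 0" "B = R ** diag_mat e"
      by (auto simp: det_mul)
    have inv: "diag_mat (\<lambda>i. 1 / d i) ** diag_mat d = (mat 1 :: real^'n^'n)"
      using Q(2) by (simp add: diag_mat_mult mat_eq_diag_mat)
    \<comment> \<open>The diagonal factor of \<open>A\<close> is moved to the right past
      \<open>R\<close>, which replaces \<open>R\<close> by a conjugate that is still in
      \<open>\<Delta>\<close>.\<close>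
    have "A ** B = Q ** (diag_mat d ** R ** (diag_mat (\<lambda>i. 1 / d i) ** diag_mat d)) ** diag_mat e"
      unfolding inv by (simp add: Q(3) R(3) matrix_mul_assoc)
    also have "\<dots> = Q ** (diag_mat d ** R ** diag_mat (\<lambda>i. 1 / d i)) ** diag_mat (\<lambda>i. d i * e i)"
      unfolding diag_mat_mult[symmetric] by (simp add: matrix_mul_assoc)
    finally show "\<exists>Q\<in>\<Delta>. \<exists>d. (\<forall>i. d i \<noteq> 0) \<and> A ** B = Q ** diag_mat d"
      using \<Delta>mult[OF Q(1) \<Delta>conj[OF R(1), of d "\<lambda>i. 1 / d i"]] Q(2) R(2)
      by (intro bexI[of _ "Q ** (diag_mat d ** R ** diag_mat (\<lambda>i. 1 / d i))"] exI[of _ "\<lambda>i. d i * e i"]) auto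
  next
    fix A :: "real^'n^'n" and i assume "row i A = 0" "det A \<noteq> 0"
    then show "\<exists>Q\<in>\<Delta>. \<exists>d. (\<forall>i. d i \<noteq> 0) \<and> A = Q ** diag_mat d"
      by (simp add: det_zero_row)
  next
    fix A :: "real^'n^'n" assume 0: "\<And>i j. i \<noteq> j \<Longrightarrow> A $ i $ j = 0" and det: "det A \<noteq> 0"
    have A: "A = diag_mat (\<lambda>i. A $ i $ i)"
      using 0 by (simp add: vec_eq_iff)
    then have "det A = (\<Prod>i\<in>UNIV. A $ i $ i)"
      using det_diag_mat[of "\<lambda>i. A $ i $ i"] by simp
    then show "\<exists>Q\<in>\<Delta>. \<exists>d. (\<forall>i. d i \<noteq> 0) \<and> A = Q ** diag_mat d"
      using A det by (intro bexI[OF _ \<Delta>1] exI[of _ "\<lambda>i. A $ i $ i"]) auto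
  next
    fix m n :: 'n assume mn: "m \<noteq> n"
    \<comment> \<open>The transposition has determinant \<open>- 1\<close>. Three transvections
      compose to a quarter turn in the plane of \<open>m\<close> and \<open>n\<close>, and a sign in
      column \<open>m\<close> turns it into the transposition.\<close>
    let ?Q = "transvection m n 1 ** transvection n m (- 1) ** transvection m n 1 :: real^'n^'n"
    have "(\<chi> i j. mat 1 $ i $ Transposition.transpose m n j)
        = ?Q ** diag_mat (\<lambda>i. if i = m then - 1 else 1)"
      using mn by (auto simp: vec_eq_iff diag_mat_mult_right mult_transvection_nth mat_def Transposition.transpose_def)
    then show "\<exists>Q\<in>\<Delta>. \<exists>d. (\<forall>i. d i \<noteq> 0) \<and>
        (\<chi> i j. mat 1 $ i $ Transposition.transpose m n j) = Q ** diag_mat d"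
      using \<Delta>mult \<Delta>trans mn
      by (intro bexI[of _ ?Q] exI[of _ "\<lambda>i. if i = m then - 1 else 1"]) auto
  next
    fix m n :: 'n and c assume mn: "m \<noteq> n"
    show "\<exists>Q\<in>\<Delta>. \<exists>d. (\<forall>i. d i \<noteq> 0) \<and>
        (\<chi> i j. if i = m \<and> j = n then c else of_bool (i = j)) = Q ** diag_mat d"
      unfolding transvection_def[symmetric]
      by (intro bexI[OF _ \<Delta>trans[OF mn]] exI[of _ "\<lambda>_. 1"]) (simp flip: mat_eq_diag_mat)
  qed
  fix A :: "real^'n^'n" assume "A \<in> SL_mats"
  then have "det A = 1"
    by (simp add: SL_mats_def)
  then obtain Q d where Q: "Q \<in> \<Delta>" "A = Q ** diag_mat d"
    using decomp[of A] by auto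
  have "prod d UNIV = 1"
    using \<open>det A = 1\<close> Q by (simp add: \<Delta>_def det_mul det_diag_mat)
  moreover have "Q \<in> \<Gamma>"
  proof -
    have "\<forall>d e. (\<forall>i. d i * e i = 1) \<longrightarrow> diag_mat d ** Q ** diag_mat e \<in> \<Gamma>"
      using Q(1) by (simp add: \<Delta>_def)
    from this[rule_format, of "\<lambda>_. 1" "\<lambda>_. 1"] show ?thesis
      by (simp flip: mat_eq_diag_mat)
  qed
  ultimately show "A \<in> \<Gamma>"
    unfolding Q(2) by (intro mult diag)
qed

section \<open>Half turns and orthogonal matrices\<close>

text \<open>The negative of a reflection, hence of determinant \<open>1\<close> in odd dimension.\<close>

definition half_turn :: "real^'n \<Rightarrow> real^'n^'n" where
  "half_turn a = (\<chi> i j. 2 * a $ i * a $ j / (a \<bullet> a) - of_bool (i = j))"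

lemma half_turn_mult_vec: "half_turn a *v x = (2 * (a \<bullet> x) / (a \<bullet> a)) *\<^sub>R a - x"
proof -
  have "(half_turn a *v x) $ i = ((2 * (a \<bullet> x) / (a \<bullet> a)) *\<^sub>R a - x) $ i" for i
  proof -
    have "(half_turn a *v x) $ i
        = (\<Sum>j\<in>UNIV. 2 * a $ i / (a \<bullet> a) * (a $ j * x $ j)) - (\<Sum>j\<in>UNIV. of_bool (i = j) * x $ j)"
      by (simp add: half_turn_def matrix_vector_mult_def left_diff_distrib sum_subtractf mult.assoc)
    also have "\<dots> = 2 * a $ i / (a \<bullet> a) * (a \<bullet> x) - x $ i"
      by (simp only: sum_distrib_left[symmetric] inner_vec_def inner_real_def) simp
    finally show ?thesis
      by (simp add: mult_ac)
  qed
  then show ?thesis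
    by (simp add: vec_eq_iff)
qed

lemma half_turn_involution: "a \<noteq> 0 \<Longrightarrow> half_turn a *v (half_turn a *v x) = x"
  by (simp add: half_turn_mult_vec inner_diff_right)

lemma half_turn_mult_self: "a \<noteq> 0 \<Longrightarrow> half_turn a ** half_turn a = mat 1"
  by (simp add: matrix_eq half_turn_involution flip: matrix_vector_mul_assoc)

lemma orthogonal_half_turn: "a \<noteq> 0 \<Longrightarrow> orthogonal_matrix (half_turn a)"
proof -
  assume "a \<noteq> 0"
  moreover have "transpose (half_turn a) = half_turn a"
    by (simp add: transpose_def half_turn_def vec_eq_iff mult_ac eq_commute)
  ultimately show ?thesis
    by (simp add: orthogonal_matrix half_turn_mult_self)
qed

lemma orthogonal_matrix_inner:
  fixes A :: "real^'n^'n"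
  assumes "orthogonal_matrix A"
  shows "(A *v x) \<bullet> (A *v y) = x \<bullet> y"
proof -
  have "orthogonal_transformation ((*v) A)"
    using assms by (simp add: orthogonal_transformation_matrix)
  then show ?thesis
    by (simp add: orthogonal_transformation_def)
qed

text \<open>The reflection along \<open>a - b\<close> exchanges two vectors of equal norm, and the
  half turn is its negative.\<close>

lemma half_turn_difference:
  assumes "norm a = norm b" "a \<noteq> b"
  shows "half_turn (a - b) *v a = - b"
proof -
  have eq: "a \<bullet> a = b \<bullet> b"
    using assms(1) by (simp add: norm_eq)
  have "(a - b) \<bullet> (a - b) = 2 * ((a - b) \<bullet> a)"
    using eq by (simp add: inner_diff_left inner_diff_right inner_commute)
  moreover have "(a - b) \<bullet> (a - b) \<noteq> 0"
    using assms(2) by simp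
  ultimately have coeff: "2 * ((a - b) \<bullet> a) / ((a - b) \<bullet> (a - b)) = 1"
    by (metis divide_self)
  show ?thesis
    unfolding half_turn_mult_vec coeff by simp
qed

text \<open>An orthogonal map conjugates the half turn about a vector into the half turn about its
  image, and \<open>half_turn c\<close> is its own inverse. This allows a half turn to be replaced
  by one about a simpler vector.\<close>

lemma half_turn_conj:
  assumes "c \<noteq> 0"
  shows "half_turn a = half_turn c ** half_turn (half_turn c *v a) ** half_turn c"
proof -
  note inner = orthogonal_matrix_inner[OF orthogonal_half_turn[OF assms]]
  have "half_turn c *v (half_turn (half_turn c *v a) *v (half_turn c *v x)) = half_turn a *v x" for x
    unfolding half_turn_mult_vec[of "half_turn c *v a"] half_turn_mult_vec[of a] inner
    by (simp add: matrix_vector_mult_diff_distrib matrix_vector_mult_scaleR half_turn_involution assms)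
  then show ?thesis
    by (simp add: matrix_eq flip: matrix_vector_mul_assoc)
qed

lemma half_turn_axis: "half_turn (axis k r) = diag_mat (\<lambda>i. if i = k then 1 else - 1)" if "r \<noteq> 0"
  using that by (auto simp: vec_eq_iff half_turn_def inner_axis_axis) (auto simp: axis_def)

text \<open>About a coordinate axis the half turn is diagonal with an even number of entries
  \<open>- 1\<close>. Any other half turn is conjugate to such a one by an orthogonal matrix, whose
  determinant squares to \<open>1\<close>.\<close>

lemma det_half_turn:
  fixes a :: "real^'n::finite"
  assumes a: "a \<noteq> 0" and odd: "odd CARD('n)"
  shows "det (half_turn a) = 1"
proof -
  obtain k :: 'n where True
    by simp
  have "(\<Prod>i\<in>(UNIV :: 'n set). if i = k then 1 else - 1 :: real) = (\<Prod>i\<in>UNIV - {k}. - 1)"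
    by (subst prod.remove[of UNIV k]) (auto intro!: prod.cong)
  also have "\<dots> = 1"
    using odd by (simp add: card_Diff_singleton)
  finally have ax: "det (half_turn (axis k r)) = 1" if "r \<noteq> 0" for r
    using that by (simp add: half_turn_axis det_diag_mat)
  define b where "b = (axis k (norm a) :: real^'n)"
  have b: "norm a = norm b" "- b = axis k (- norm a)"
    by (simp add: b_def norm_eq_sqrt_inner inner_axis_axis, simp add: b_def axis_def vec_eq_iff)
  show ?thesis
  proof (cases "a = b")
    case True
    then show ?thesis
      using ax a by (metis b_def norm_eq_zero)
  next
    case False
    let ?c = "half_turn (a - b)"
    have "orthogonal_matrix ?c"
      using False by (simp add: orthogonal_half_turn)
    then have "det ?c * det ?c = 1"
      using det_orthogonal_matrix by fastforce
    moreover have "det (half_turn a) = det ?c * det (half_turn (- b)) * det ?c"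
      using half_turn_conj[of "a - b" a] half_turn_difference[OF b(1) False] False by (metis det_mul eq_iff_diff_eq_0)
    ultimately show ?thesis
      using ax[of "- norm a"] a b(2) by (simp add: mult_ac)
  qed
qed

lemma matrix_vector_mult_minus_left: "(- A) *v x = - (A *v x)" for A :: "real^'n^'m"
  by (simp add: vec_eq_iff matrix_vector_mult_def sum_negf)

text \<open>The Cartan-Dieudonne argument, by induction on the number of basis vectors that
  \<open>A\<close> moves. Half turns are negatives of reflections, so the sign is lost.\<close>

lemma orthogonal_mats_subset_monoid:
  fixes \<Gamma> :: "(real^'n::finite^'n) set"
  assumes one: "mat 1 \<in> \<Gamma>" and mult: "\<And>A B. A \<in> \<Gamma> \<Longrightarrow> B \<in> \<Gamma> \<Longrightarrow> A ** B \<in> \<Gamma>"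
    and half_turns: "\<And>a. a \<noteq> 0 \<Longrightarrow> half_turn a \<in> \<Gamma>"
    and A: "orthogonal_matrix A"
  shows "A \<in> \<Gamma> \<or> - A \<in> \<Gamma>"
  using A
proof (induction "card {j. A *v axis j 1 \<noteq> axis j 1}" arbitrary: A rule: less_induct)
  case less
  have neg: "B ** (- C) = - (B ** C)" for B C :: "real^'n^'n"
    by (simp add: vec_eq_iff matrix_matrix_mult_def sum_negf)
  show ?case
  proof (cases "\<exists>j. A *v axis j 1 \<noteq> axis j 1")
    case False
    then have "A = mat 1"
      by (intro matrix_eqI_axis) simp
    then show ?thesis
      using one by simp
  next
    case True
    then obtain j where j: "A *v axis j 1 \<noteq> axis j 1"
      by blast
    define c where "c = A *v axis j 1 - axis j 1"
    have c: "c \<noteq> 0"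
      using j by (simp add: c_def)
    \<comment> \<open>\<open>- half_turn c\<close> is the reflection along \<open>c\<close>; it
      sends \<open>A *v axis j 1\<close> back to \<open>axis j 1\<close>.\<close>
    define B where "B = - (half_turn c ** A)"
    have "norm (A *v axis j 1) = norm (axis j 1 :: real^'n)"
      unfolding norm_eq by (rule orthogonal_matrix_inner[OF less.prems])
    from half_turn_difference[OF this j] have Bj: "B *v axis j 1 = axis j 1"
      by (simp add: B_def c_def vec.neg matrix_vector_mul_assoc[symmetric] matrix_vector_mult_minus_left)
    \<comment> \<open>\<open>A\<close> preserves inner products and fixes \<open>axis i 1\<close>,
      so \<open>c\<close> is orthogonal to this vector and the reflection does not move it.\<close>
    have Bi: "B *v axis i 1 = axis i 1" if i: "A *v axis i 1 = axis i 1" for i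
    proof -
      have "(A *v axis j 1) \<bullet> (axis i 1) = (axis j 1 :: real^'n) \<bullet> axis i 1"
        using orthogonal_matrix_inner[OF less.prems, of "axis j 1" "axis i 1"] by (simp add: i)
      then have "c \<bullet> axis i 1 = 0"
        by (simp add: c_def inner_diff_left)
      then have "half_turn c *v axis i 1 = - axis i 1"
        by (simp add: half_turn_mult_vec)
      then show ?thesis
        by (simp add: B_def matrix_vector_mul_assoc[symmetric] matrix_vector_mult_minus_left i)
    qed
    have "{j. B *v axis j 1 \<noteq> axis j 1} \<subset> {j. A *v axis j 1 \<noteq> axis j 1}"
      using Bi Bj j by blast
    then have "card {j. B *v axis j 1 \<noteq> axis j 1} < card {j. A *v axis j 1 \<noteq> axis j 1}"
      by (rule psubset_card_mono[rotated]) simp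
    moreover have "orthogonal_matrix B"
    proof -
      have "orthogonal_matrix (half_turn c ** A)"
        by (intro orthogonal_matrix_mul orthogonal_half_turn c less.prems)
      moreover have "transpose (- C) ** (- C) = transpose C ** C" for C :: "real^'n^'n"
        by (simp add: vec_eq_iff matrix_matrix_mult_def transpose_def)
      ultimately show ?thesis
        by (simp add: B_def orthogonal_matrix)
    qed
    ultimately have "B \<in> \<Gamma> \<or> - B \<in> \<Gamma>"
      using less.hyps by blast
    moreover have "A = half_turn c ** (- B)" "- A = half_turn c ** B"
      by (simp_all add: B_def neg matrix_mul_assoc half_turn_mult_self c)
    ultimately show ?thesis
      using mult[OF half_turns[OF c]] by metis
  qed
qed

lemma exists_not_in_list: "length (xs :: 'n::finite list) < CARD('n) \<Longrightarrow> \<exists>x. x \<notin> set xs"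
  by (metis UNIV_I card_length card_mono finite_set leD order_trans subsetI)

text \<open>Induction on the number of nonzero coordinates: conjugation by a half turn about a
  vector in a coordinate plane removes one of them, and in dimension at least \<open>4\<close> such
  a vector has two zero coordinates. In dimension \<open>3\<close> the given half turns would be
  those about the coordinate axes, which generate only a finite group.\<close>

lemma half_turns_subset_monoid:
  fixes \<Gamma> :: "(real^'n::finite^'n) set"
  assumes n: "CARD('n) \<ge> 4" and mult: "\<And>A B. A \<in> \<Gamma> \<Longrightarrow> B \<in> \<Gamma> \<Longrightarrow> A ** B \<in> \<Gamma>"
    and half_turns: "\<And>a j k. a \<noteq> 0 \<Longrightarrow> j \<noteq> k \<Longrightarrow> a $ j = 0 \<Longrightarrow> a $ k = 0 \<Longrightarrow> half_turn a \<in> \<Gamma>"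
    and a: "a \<noteq> 0"
  shows "half_turn a \<in> \<Gamma>"
  using a
proof (induction "card {k. a $ k \<noteq> 0}" arbitrary: a rule: less_induct)
  case less
  show ?case
  proof (cases "\<exists>p q. p \<noteq> q \<and> a $ p \<noteq> 0 \<and> a $ q \<noteq> 0")
    case True
    then obtain p q where pq: "p \<noteq> q" "a $ p \<noteq> 0" "a $ q \<noteq> 0"
      by blast
    obtain j where j: "j \<notin> {p, q}"
      using exists_not_in_list[of "[p, q]"] n by auto
    obtain k where k: "k \<notin> {p, q, j}"
      using exists_not_in_list[of "[p, q, j]"] n by auto
    define s where "s = sqrt ((a $ p)\<^sup>2 + (a $ q)\<^sup>2)"
    have s: "s * s = a $ p * a $ p + a $ q * a $ q"
      by (simp add: s_def power2_eq_square)
    have "s \<noteq> 0"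
      using pq(2) s by (metis add_nonneg_eq_0_iff mult_eq_0_iff zero_le_square)
    \<comment> \<open>The component of \<open>a\<close> in the plane of \<open>p\<close> and
      \<open>q\<close> is turned onto the axis \<open>p\<close>, keeping its length
      \<open>s\<close>. Then \<open>c\<close> is supported on \<open>p\<close> and \<open>q\<close>,
      so it vanishes at \<open>j\<close> and \<open>k\<close>.\<close>
    define b where "b = (\<chi> l. if l = p then s else if l = q then 0 else a $ l)"
    define c where "c = a - b"
    have c: "c \<noteq> 0" "c $ j = 0" "c $ k = 0"
      using pq j k by (auto simp: c_def b_def vec_eq_iff)
    have "(\<Sum>l\<in>UNIV. b $ l * b $ l) = (\<Sum>l\<in>UNIV. a $ l * a $ l)"
    proof -
      have split: "(\<Sum>l\<in>UNIV. f l) = f p + (f q + (\<Sum>l\<in>UNIV - {p} - {q}. f l))" for f :: "'n \<Rightarrow> real"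
        using pq(1) by (subst sum.remove[of UNIV p]; simp) (subst sum.remove[of "UNIV - {p}" q]; simp)
      show ?thesis
        unfolding split using pq(1) by (simp add: b_def s)
    qed
    then have norm: "norm a = norm b"
      by (simp add: norm_eq inner_vec_def)
    moreover have "a \<noteq> b"
      using c(1) by (simp add: c_def)
    ultimately have ca: "half_turn c *v a = - b"
      unfolding c_def by (rule half_turn_difference)
    have "{k. (- b) $ k \<noteq> 0} \<subset> {k. a $ k \<noteq> 0}"
      using pq by (auto simp: b_def split: if_splits)
    then have "card {k. (- b) $ k \<noteq> 0} < card {k. a $ k \<noteq> 0}"
      by (rule psubset_card_mono[rotated]) simp
    moreover have "- b \<noteq> 0"
      using norm less.prems by auto
    ultimately have "half_turn (- b) \<in> \<Gamma>"
      by (rule less.hyps)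
    moreover have "half_turn c \<in> \<Gamma>"
      using half_turns[OF c(1) _ c(2,3)] k by blast
    ultimately show ?thesis
      unfolding half_turn_conj[OF c(1), of a] ca by (intro mult)
  next
    case False
    obtain p where p: "a $ p \<noteq> 0"
      using less.prems by (auto simp: vec_eq_iff)
    obtain j where j: "j \<notin> {p}"
      using exists_not_in_list[of "[p]"] n by auto
    obtain k where k: "k \<notin> {p, j}"
      using exists_not_in_list[of "[p, j]"] n by auto
    have "a $ j = 0" "a $ k = 0"
      using False p j k by auto
    then show ?thesis
      using half_turns[OF less.prems, of j k] k by auto
  qed
qed

text \<open>In odd dimension half turns have determinant \<open>1\<close>, while negation reverses
  the sign of the determinant. Restricting \<open>\<Gamma>\<close> to determinant \<open>1\<close>
  therefore decides the sign that half turns alone leave open.\<close>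

lemma SO_mats_subset_monoid:
  fixes \<Gamma> :: "(real^'n::finite^'n) set"
  assumes n: "CARD('n) \<ge> 4" "odd CARD('n)"
    and one: "mat 1 \<in> \<Gamma>" and mult: "\<And>A B. A \<in> \<Gamma> \<Longrightarrow> B \<in> \<Gamma> \<Longrightarrow> A ** B \<in> \<Gamma>"
    and half_turns: "\<And>a j k. a \<noteq> 0 \<Longrightarrow> j \<noteq> k \<Longrightarrow> a $ j = 0 \<Longrightarrow> a $ k = 0 \<Longrightarrow> half_turn a \<in> \<Gamma>"
  shows "SO_mats \<subseteq> \<Gamma>"
proof
  fix A :: "real^'n^'n" assume "A \<in> SO_mats"
  then have A: "orthogonal_matrix A" "det A = 1"
    by (auto simp: SO_mats_def rotation_matrix_def)
  let ?\<Gamma> = "{B \<in> \<Gamma>. det B = 1}"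
  have "A \<in> ?\<Gamma> \<or> - A \<in> ?\<Gamma>"
    by (rule orthogonal_mats_subset_monoid[OF _ _ _ A(1)])
      (use one mult half_turns_subset_monoid[OF n(1) mult half_turns] det_half_turn n(2) in
        \<open>auto simp: det_mul\<close>)
  moreover have "det (- A) = - 1"
  proof -
    have "- A = diag_mat (\<lambda>_. - 1) ** A"
      by (simp add: vec_eq_iff diag_mat_mult_left)
    then have "det (- A) = (- 1) ^ CARD('n) * det A"
      by (simp add: det_mul det_diag_mat)
    then show ?thesis
      using n(2) A(2) by simp
  qed
  ultimately show "A \<in> \<Gamma>"
    by auto
qed

section \<open>Rigidity\<close>

context affine_analytic_epi
begin

lemma traceable_stabilizer_if_minus_one:
  assumes "mat (- 1) \<in> M"
  shows "traceable ({0} \<times> M)"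
proof (rule traceable_stabilizer_if_central[OF assms])
  fix A :: "'k^'n^'n"
  show "A ** mat (- 1) = mat (- 1) ** A"
    by (simp add: mat_eq_diag_mat vec_eq_iff diag_mat_mult_left diag_mat_mult_right)
next
  fix u :: "'k^'n" assume "mat (- 1) *v u = u"
  then have "- u = u"
    by (simp add: mat_eq_diag_mat vec_eq_iff)
  then have "2 *\<^sub>R u = 0"
    by (metis add.right_inverse scaleR_2)
  then show "u = 0"
    by simp
qed

text \<open>\<open>gen\<close> expresses that \<open>\<A>\<close> generates \<open>M\<close> as a
  monoid. The products of members of \<open>\<A>\<close> are indexed by finite lists, so there are
  only countably many of them.\<close>

lemma traceable_stabilizer_if_generated:
  assumes \<A>: "countable \<A>" "\<And>E. E \<in> \<A> \<Longrightarrow> traceable E" "\<And>E. E \<in> \<A> \<Longrightarrow> E \<subseteq> {0} \<times> M"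
    and gen: "\<And>\<Gamma>. mat 1 \<in> \<Gamma> \<Longrightarrow> (\<And>A B. A \<in> \<Gamma> \<Longrightarrow> B \<in> \<Gamma> \<Longrightarrow> A ** B \<in> \<Gamma>) \<Longrightarrow>
      (\<And>E A. E \<in> \<A> \<Longrightarrow> (0, A) \<in> E \<Longrightarrow> A \<in> \<Gamma>) \<Longrightarrow> M \<subseteq> \<Gamma>"
  shows "\<exists>\<S>. countable \<S> \<and> (\<forall>E\<in>\<S>. traceable E) \<and> \<Union>\<S> = {0} \<times> M"
proof (intro exI conjI ballI)
  define p where "p = (\<lambda>Es. foldr (<#>\<^bsub>\<G>\<^esub>) Es {\<one>\<^bsub>\<G>\<^esub>})"
  let ?\<S> = "p ` lists \<A>"
  show "countable ?\<S>"
    using \<A>(1) by (intro countable_image countable_lists)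
  show "traceable E" if "E \<in> ?\<S>" for E
    using that \<A>(2) by (auto simp: p_def intro!: traceable_foldr_set_mult)
  have sub: "p Es \<subseteq> {0} \<times> M" if "set Es \<subseteq> \<A>" for Es
    using that
  proof (induction Es)
    case Nil
    then show ?case
      by (simp add: p_def one_affine mat_1_mem)
  next
    case (Cons E Es)
    then have "E \<subseteq> {0} \<times> M" "p Es \<subseteq> {0} \<times> M"
      using \<A>(3) by auto
    then have "E <#>\<^bsub>\<G>\<^esub> p Es \<subseteq> {0} \<times> M"
      by (fastforce simp: set_mult_eq mult_affine mult_mem)
    then show ?case
      by (simp add: p_def)
  qed
  define \<Gamma> where "\<Gamma> = {A. (0, A) \<in> \<Union>?\<S>}"
  \<comment> \<open>A direct proof that \<open>\<Gamma>\<close> is closed under products would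
    concatenate lists. Its left multipliers form a monoid for trivial reasons and contain the
    generators; since \<open>mat 1\<close> is in \<open>\<Gamma>\<close>, they all belong to
    \<open>\<Gamma>\<close>.\<close>
  define \<Delta> where "\<Delta> = {A. \<forall>B\<in>\<Gamma>. A ** B \<in> \<Gamma>}"
  have "(0, mat 1) \<in> p []"
    by (simp add: p_def one_affine)
  then have one: "mat 1 \<in> \<Gamma>"
    unfolding \<Gamma>_def by (intro CollectI UnionI[of "p []"] imageI) auto
  have "M \<subseteq> \<Delta>"
  proof (rule gen)
    show "mat 1 \<in> \<Delta>"
      by (simp add: \<Delta>_def)
    show "A ** B \<in> \<Delta>" if "A \<in> \<Delta>" "B \<in> \<Delta>" for A B
      using that by (simp add: \<Delta>_def flip: matrix_mul_assoc)
    show "A \<in> \<Delta>" if E: "E \<in> \<A>" "(0, A) \<in> E" for E A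
    proof -
      have "A ** B \<in> \<Gamma>" if B: "B \<in> \<Gamma>" for B
      proof -
        obtain Es where Es: "Es \<in> lists \<A>" "(0, B) \<in> p Es"
          using B by (auto simp: \<Gamma>_def)
        have "(0, A) \<otimes>\<^bsub>\<G>\<^esub> (0, B) \<in> E <#>\<^bsub>\<G>\<^esub> p Es"
          using E(2) Es(2) unfolding set_mult_def by blast
        then have "(0, A ** B) \<in> p (E # Es)"
          by (simp add: p_def mult_affine)
        moreover have "E # Es \<in> lists \<A>"
          using E(1) Es(1) by simp
        ultimately show ?thesis
          unfolding \<Gamma>_def by blast
      qed
      then show ?thesis
        by (simp add: \<Delta>_def)
    qed
  qed
  moreover have "\<Delta> \<subseteq> \<Gamma>"
    using one by (force simp: \<Delta>_def)
  ultimately have "M \<subseteq> \<Gamma>"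
    by blast
  then have "{0} \<times> M \<subseteq> \<Union>?\<S>"
    by (auto simp: \<Gamma>_def)
  moreover have "\<Union>?\<S> \<subseteq> {0} \<times> M"
    using sub by (auto simp: in_lists_conv_set subset_iff)
  ultimately show "\<Union>?\<S> = {0} \<times> M"
    by blast
qed

lemma continuous_open_if_stabilizer:
  assumes "\<And>r. r > 0 \<Longrightarrow>
      \<exists>B \<delta>. \<delta> > 0 \<and> traceable (B \<times> {mat 1}) \<and> ball 0 \<delta> \<subseteq> B \<and> B \<subseteq> ball 0 r"
    and "traceable ({0} \<times> M)"
  shows "continuous_map S (affine_topology M) \<phi> \<and> open_map S (affine_topology M) \<phi>"
  by (rule continuous_open[of "{{0} \<times> M}"]) (use assms in auto)

end

section \<open>Small neighbourhoods from bounded orbits and from tori\<close>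

lemma le_1_if_sum_squares_eq_1:
  fixes f :: "'n::finite \<Rightarrow> real"
  assumes "(\<Sum>k\<in>UNIV. (f k)\<^sup>2) = 1" "f j \<ge> 0"
  shows "f j \<le> 1"
proof -
  have "(f j)\<^sup>2 \<le> 1"
    using member_le_sum[of j UNIV "\<lambda>k. (f k)\<^sup>2"] assms(1) by simp
  then show ?thesis
    by (simp add: abs_square_le_1)
qed

lemma orthogonal_entry_le_1:
  fixes A :: "real^'n::finite^'n"
  assumes "A \<in> O_mats"
  shows "norm (A $ i $ j) \<le> 1"
proof (rule le_1_if_sum_squares_eq_1[where f = "\<lambda>k. norm (A $ i $ k)"])
  have "(A ** transpose A) $ i $ i = (mat 1 :: real^'n^'n) $ i $ i"
    using assms by (simp add: O_mats_def orthogonal_matrix_def)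
  then show "(\<Sum>k\<in>UNIV. (norm (A $ i $ k))\<^sup>2) = 1"
    by (simp add: matrix_matrix_mult_def transpose_def mat_def power2_eq_square)
qed simp

lemma unitary_entry_le_1:
  fixes A :: "complex^'n::finite^'n"
  assumes "A \<in> SU_mats"
  shows "norm (A $ i $ j) \<le> 1"
proof (rule le_1_if_sum_squares_eq_1[where f = "\<lambda>k. norm (A $ i $ k)"])
  have "(A ** cadjoint A) $ i $ i = (mat 1 :: complex^'n^'n) $ i $ i"
    using assms by (simp add: SU_mats_def)
  then have "(\<Sum>k\<in>UNIV. A $ i $ k * cnj (A $ i $ k)) = of_real 1"
    by (simp add: matrix_matrix_mult_def cadjoint_def mat_def)
  then have "complex_of_real (\<Sum>k\<in>UNIV. (norm (A $ i $ k))\<^sup>2) = of_real 1"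
    by (simp only: of_real_sum complex_norm_square)
  then show "(\<Sum>k\<in>UNIV. (norm (A $ i $ k))\<^sup>2) = 1"
    using of_real_eq_iff by blast
qed simp

lemma quaternionic_unitary_entry_le_1:
  fixes A :: "quat^'n::finite^'n"
  assumes "A \<in> Sp_mats"
  shows "norm (A $ i $ j) \<le> 1"
proof (rule le_1_if_sum_squares_eq_1[where f = "\<lambda>k. norm (A $ i $ k)"])
  have "(A ** qadjoint A) $ i $ i = (mat 1 :: quat^'n^'n) $ i $ i"
    using assms by (simp add: Sp_mats_def)
  then have "(of_real (\<Sum>k\<in>UNIV. (norm (A $ i $ k))\<^sup>2) :: quat) = of_real 1"
    by (simp add: matrix_matrix_mult_def qadjoint_def mat_def quat_mult_qcnj)
  then show "(\<Sum>k\<in>UNIV. (norm (A $ i $ k))\<^sup>2) = 1"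
    using of_real_eq_iff by blast
qed simp

text \<open>\<open>t *\<^sub>R axis i 1\<close> is the midpoint of two unit vectors in the plane of
  the axes \<open>i\<close> and \<open>j\<close>, and rotations act transitively on the unit
  sphere.\<close>

lemma SO_axis_half:
  assumes n: "CARD('n) \<ge> 2" and t: "\<bar>t\<bar> \<le> 1"
  shows "\<exists>A\<in>SO_mats. \<exists>A'\<in>SO_mats. A *v axis i 1 + A' *v axis i 1 = (2 * t) *\<^sub>R (axis i 1 :: real^'n::finite)"
proof -
  obtain j where j: "j \<noteq> i"
    using exists_not_in_list[of "[i]"] n by auto
  define s where "s = sqrt (1 - t\<^sup>2)"
  have s: "s * s = 1 - t * t"
    using t by (simp add: s_def abs_square_le_1 flip: power2_eq_square)
  have rot: "\<exists>A\<in>SO_mats. A *v axis i 1 = v" if v: "norm v = 1" for v :: "real^'n"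
  proof -
    obtain f where f: "orthogonal_transformation f" "det (matrix f) = 1" "f (axis i 1) = v"
      using rotation_exists[OF n, of "axis i 1" v] v by auto
    have "matrix f *v axis i 1 = v"
      using matrix_vector_mul(2)[OF orthogonal_transformation_linear[OF f(1)], THEN fun_cong, of "axis i 1"]
        f(3) by simp
    moreover have "matrix f \<in> SO_mats"
      using f by (simp add: SO_mats_def rotation_matrix_def orthogonal_transformation_matrix)
    ultimately show ?thesis
      by blast
  qed
  have norm: "norm (t *\<^sub>R axis i 1 + r *\<^sub>R axis j 1 :: real^'n) = 1" if "r * r = 1 - t * t" for r
    using that j by (simp add: norm_eq_1 inner_simps inner_axis_axis)
  obtain A A' where "A \<in> SO_mats" "A' \<in> SO_mats"
    "A *v axis i 1 = t *\<^sub>R axis i 1 + s *\<^sub>R (axis j 1 :: real^'n)"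
    "A' *v axis i 1 = t *\<^sub>R axis i 1 + (- s) *\<^sub>R (axis j 1 :: real^'n)"
    using rot[OF norm[of s]] rot[OF norm[of "- s"]] s by auto
  moreover have "(t *\<^sub>R axis i 1 + s *\<^sub>R axis j 1) + (t *\<^sub>R axis i 1 + (- s) *\<^sub>R axis j 1)
      = (2 * t) *\<^sub>R (axis i 1 :: real^'n)"
    by (simp add: scaleR_2 algebra_simps flip: scaleR_scaleR)
  ultimately show ?thesis
    by metis
qed

text \<open>Stated between \<open>SO_mats\<close> and \<open>O_mats\<close> to serve both groups:
  the lower bound supplies the rotations, the upper bound the bounded entries.\<close>

lemma orthogonal_nbhds:
  fixes M :: "(real^'n::finite^'n) set"
  assumes "affine_analytic_epi M J \<K> L S \<phi>" and M: "SO_mats \<subseteq> M" "M \<subseteq> O_mats"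
    and n: "CARD('n) \<ge> 2" and r: "r > 0"
  shows "\<exists>B \<delta>. \<delta> > 0 \<and> analytic_epi.traceable \<K> L S (affine_group M) \<phi> (B \<times> {mat 1}) \<and>
      ball 0 \<delta> \<subseteq> B \<and> B \<subseteq> ball 0 r"
proof -
  interpret affine_analytic_epi M J \<K> L S \<phi> by fact
  show ?thesis
  proof (rule traceable_nbhds_if_axis_nbhds[of "{1}", OF _ real_spanned_by_1 _ r])
    fix i :: 'n and q r :: real assume q: "q \<in> {1}" and r: "r > 0"
    show "\<exists>B \<delta>. \<delta> > 0 \<and> traceable (B \<times> {mat 1}) \<and> (\<forall>b\<in>B. norm b \<le> r) \<and>
        (\<forall>t. \<bar>t\<bar> < \<delta> \<longrightarrow> t *\<^sub>R axis i q \<in> B)"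
    proof (rule axis_nbhd_if_bounded[OF _ _ r])
      show "norm (A $ i $ j) \<le> 1" if "A \<in> M" for A i j
        using that M(2) by (intro orthogonal_entry_le_1) blast
      show "\<exists>A\<in>M. \<exists>A'\<in>M. A *v axis i q + A' *v axis i q = (2 * t) *\<^sub>R axis i q" if "\<bar>t\<bar> \<le> 1" for t
        using SO_axis_half[OF n that, of i] q M(1) by blast
    qed
  qed simp
qed

lemma torus_nbhds:
  fixes M :: "(real^'n::finite^'n) set"
  assumes "affine_analytic_epi M J \<K> L S \<phi>"
    and torus: "\<And>i. \<exists>j. j \<noteq> i \<and>
      (\<forall>a. a \<noteq> 0 \<longrightarrow> diag_mat (\<lambda>k. if k = i then a else if k = j then 1 / a else 1) \<in> M)"
    and r: "r > 0"
  shows "\<exists>B \<delta>. \<delta> > 0 \<and> analytic_epi.traceable \<K> L S (affine_group M) \<phi> (B \<times> {mat 1}) \<and>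
      ball 0 \<delta> \<subseteq> B \<and> B \<subseteq> ball 0 r"
proof -
  interpret affine_analytic_epi M J \<K> L S \<phi> by fact
  show ?thesis
  proof (rule traceable_nbhds_if_axis_nbhds[of "{1}", OF _ real_spanned_by_1 _ r])
    fix i :: 'n and q r :: real assume q: "q \<in> {1}" and r: "r > 0"
    obtain j where j: "i \<noteq> j"
      "\<And>a. a \<noteq> 0 \<Longrightarrow> diag_mat (\<lambda>k. if k = i then a else if k = j then 1 / a else 1) \<in> M"
      using torus[of i] by metis
    show "\<exists>B \<delta>. \<delta> > 0 \<and> traceable (B \<times> {mat 1}) \<and> (\<forall>b\<in>B. norm b \<le> r) \<and>
        (\<forall>t. \<bar>t\<bar> < \<delta> \<longrightarrow> t *\<^sub>R axis i q \<in> B)"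
      using axis_nbhd_if_torus[OF assms(1) j r] q by simp
  qed simp
qed

section \<open>The seven families of groups\<close>

lemma minus_one_SO: "even CARD('n) \<Longrightarrow> mat (- 1) \<in> (SO_mats :: (real^'n::finite^'n) set)"
  by (simp add: SO_mats_def rotation_matrix_def orthogonal_matrix mat_eq_diag_mat det_diag_mat
      transpose_def vec_eq_iff diag_mat_mult_right)

lemma rigid_within_O:
  fixes \<K> :: "'u topology set"
  assumes K: "almost_Polish \<K>" and n: "CARD('n::finite) \<ge> 2"
    and cls: "in_class \<K> (affine_topology (O_mats :: (real^'n^'n) set))"
  shows "rigid_within \<K> (affine_group (O_mats :: (real^'n^'n) set)) (affine_topology O_mats)"
proof (rule matrix_topgroup.rigid_within_affine[OF matrix_topgroup_O K cls])
  fix L :: "'u monoid" and S \<phi>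
  assume aae: "affine_analytic_epi (O_mats :: (real^'n^'n) set) transpose \<K> L S \<phi>"
  then interpret affine_analytic_epi "O_mats :: (real^'n^'n) set" transpose \<K> L S \<phi> .
  have "mat (- 1) \<in> (O_mats :: (real^'n^'n) set)"
    by (simp add: O_mats_def orthogonal_matrix mat_eq_diag_mat transpose_def vec_eq_iff diag_mat_mult_right)
  moreover have "SO_mats \<subseteq> (O_mats :: (real^'n^'n) set)"
    by (auto simp: SO_mats_def O_mats_def rotation_matrix_def)
  ultimately show "continuous_map S (affine_topology O_mats) \<phi> \<and> open_map S (affine_topology O_mats) \<phi>"
    using orthogonal_nbhds[OF aae _ _ n]
    by (intro continuous_open_if_stabilizer traceable_stabilizer_if_minus_one) simp_all
qed

text \<open>
  For odd \<open>n\<close> there is no central element acting without fixed vectors. The half turns about two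
  different coordinate axes still have only the origin as a common fixed point, so that their common
  centralizer lies in the stabilizer of the origin.
\<close>

lemma rigid_within_SO:
  fixes \<K> :: "'u topology set"
  assumes K: "almost_Polish \<K>" and n: "CARD('n::finite) \<ge> 4"
    and cls: "in_class \<K> (affine_topology (SO_mats :: (real^'n^'n) set))"
  shows "rigid_within \<K> (affine_group (SO_mats :: (real^'n^'n) set)) (affine_topology SO_mats)"
proof (rule matrix_topgroup.rigid_within_affine[OF matrix_topgroup_SO K cls])
  fix L :: "'u monoid" and S \<phi>
  assume aae: "affine_analytic_epi (SO_mats :: (real^'n^'n) set) transpose \<K> L S \<phi>"
  then interpret affine_analytic_epi "SO_mats :: (real^'n^'n) set" transpose \<K> L S \<phi> .
  have nbhds: "\<exists>B \<delta>. \<delta> > 0 \<and> traceable (B \<times> {mat 1}) \<and> ball 0 \<delta> \<subseteq> B \<and> B \<subseteq> ball 0 r" if "r > 0" for r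
    using n that
    by (intro orthogonal_nbhds[OF aae]) (auto simp: SO_mats_def O_mats_def rotation_matrix_def)
  show "continuous_map S (affine_topology SO_mats) \<phi> \<and> open_map S (affine_topology SO_mats) \<phi>"
  proof (cases "even CARD('n)")
    case True
    then show ?thesis
      by (intro continuous_open_if_stabilizer[OF nbhds] traceable_stabilizer_if_minus_one minus_one_SO)
  next
    case False
    define h where "h = (\<lambda>k :: 'n. half_turn (axis k 1))"
    have h_SO: "half_turn a \<in> SO_mats" if "a \<noteq> 0" for a :: "real^'n"
      using that False by (simp add: SO_mats_def rotation_matrix_def orthogonal_half_turn det_half_turn)
    have h: "h k = diag_mat (\<lambda>i. if i = k then 1 else - 1)" "h k \<in> SO_mats" for k
        unfolding h_def by (simp add: half_turn_axis, rule h_SO, simp)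
    define C where "C = (\<lambda>k. {x \<in> carrier \<G>. x \<otimes>\<^bsub>\<G>\<^esub> (0, h k) = (0, h k) \<otimes>\<^bsub>\<G>\<^esub> x})"
    have C: "C k = {(u, A). A \<in> SO_mats \<and> A ** h k = h k ** A \<and> (\<forall>i. i \<noteq> k \<longrightarrow> u $ i = 0)}" for k
      by (auto simp: C_def carrier_affine mult_affine h vec_eq_iff split: if_splits)
    have "traceable (C k)" for k
      unfolding C_def by (rule traceable_centralizer) (simp add: carrier_affine h(2))
    define \<A> where "\<A> = (\<lambda>(j, k). C j \<inter> C k) ` {(j, k). j \<noteq> k}"
    have "\<exists>\<S>. countable \<S> \<and> (\<forall>E\<in>\<S>. traceable E) \<and> \<Union>\<S> = {0} \<times> SO_mats"
    proof (rule traceable_stabilizer_if_generated)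
      show "countable \<A>"
        unfolding \<A>_def by (intro countable_finite) simp
      show "traceable E" if "E \<in> \<A>" for E
        using that \<open>\<And>k. traceable (C k)\<close> traceable_Int by (auto simp: \<A>_def)
      show "E \<subseteq> {0} \<times> SO_mats" if "E \<in> \<A>" for E
        using that by (auto simp: \<A>_def C vec_eq_iff) metis
      fix \<Gamma> :: "(real^'n^'n) set"
      assume \<Gamma>: "mat 1 \<in> \<Gamma>" "\<And>A B. A \<in> \<Gamma> \<Longrightarrow> B \<in> \<Gamma> \<Longrightarrow> A ** B \<in> \<Gamma>"
        "\<And>E A. E \<in> \<A> \<Longrightarrow> (0, A) \<in> E \<Longrightarrow> A \<in> \<Gamma>"
      show "SO_mats \<subseteq> \<Gamma>"
      proof (rule SO_mats_subset_monoid[OF n False \<Gamma>(1,2)])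
        fix a :: "real^'n" and j k assume a: "a \<noteq> 0" "j \<noteq> k" "a $ j = 0" "a $ k = 0"
        \<comment> \<open>The axis \<open>l\<close> is orthogonal to \<open>a\<close>, so both
          matrices preserve its line and the orthogonal complement, and \<open>h l\<close> is a
          scalar on each of these.\<close>
        have comm: "half_turn a ** h l = h l ** half_turn a" if "a $ l = 0" for l
          using that by (auto simp: vec_eq_iff h(1) diag_mat_mult_left diag_mat_mult_right half_turn_def)
        have "C j \<inter> C k \<in> \<A>"
          using a(2) by (auto simp: \<A>_def)
        then show "half_turn a \<in> \<Gamma>"
          by (rule \<Gamma>(3)) (simp add: C h_SO a comm)
      qed
    qed
    then show ?thesis
      using continuous_open[OF nbhds] by blast
  qed
qed

lemma mult_axis_eq:
  fixes A :: "'k::ring_1^'n::finite^'n"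
  assumes "\<And>k. A $ k $ i = (if k = i then z else 0)"
  shows "A *v axis i q = axis i (z * q)"
  using assms by (auto simp: vec_eq_iff matrix_vector_mult_axis) (auto simp: axis_def)

lemma rigid_within_SU:
  fixes \<K> :: "'u topology set"
  assumes K: "almost_Polish \<K>" and n: "CARD('n::finite) \<ge> 2"
    and cls: "in_class \<K> (affine_topology (SU_mats :: (complex^'n^'n) set))"
  shows "rigid_within \<K> (affine_group (SU_mats :: (complex^'n^'n) set)) (affine_topology SU_mats)"
proof (rule matrix_topgroup.rigid_within_affine[OF matrix_topgroup_SU K cls])
  fix L :: "'u monoid" and S \<phi>
  assume aae: "affine_analytic_epi (SU_mats :: (complex^'n^'n) set) cadjoint \<K> L S \<phi>"
  then interpret affine_analytic_epi "SU_mats :: (complex^'n^'n) set" cadjoint \<K> L S \<phi> .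
  \<comment> \<open>The entry at \<open>j\<close> restores determinant \<open>1\<close>, which is
    where a second coordinate is needed.\<close>
  define d where "d = (\<lambda>i j z. diag_mat (\<lambda>k. if k = i then z else if k = j then cnj z else 1) :: complex^'n^'n)"
  have d_SU: "d i j z \<in> SU_mats" if "i \<noteq> j" "z * cnj z = 1" for i j z
    using that by (simp add: d_def SU_mats_def cadjoint_diag_mat diag_mat_mult det_diag_mat prod_delta2)
      (simp add: mat_def vec_eq_iff mult.commute)
  \<comment> \<open>A root of unity other than \<open>1\<close> whose power \<open>CARD('n)\<close>
    is \<open>1\<close>, so that the scalar matrix \<open>mat w\<close> has determinant
    \<open>1\<close>.\<close>
  define w where "w = cis (2 * pi / CARD('n))"
  show "continuous_map S (affine_topology SU_mats) \<phi> \<and> open_map S (affine_topology SU_mats) \<phi>"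
  proof (rule continuous_open_if_stabilizer)
    have "w ^ CARD('n) = 1"
      unfolding w_def Complex.DeMoivre by simp
    moreover have "w * cnj w = 1"
      by (simp add: w_def cis_cnj cis_mult)
    ultimately have "mat w \<in> (SU_mats :: (complex^'n^'n) set)"
      by (simp add: SU_mats_def mat_eq_diag_mat cadjoint_diag_mat diag_mat_mult det_diag_mat mult.commute)
    moreover have "A ** mat w = mat w ** A" for A :: "complex^'n^'n"
      by (simp add: mat_eq_diag_mat vec_eq_iff diag_mat_mult_left diag_mat_mult_right mult.commute)
    moreover have "u = 0" if "mat w *v u = u" for u :: "complex^'n"
    proof -
      \<comment> \<open>The angle is positive and at most \<open>pi\<close>, a range on which cosine
        decreases strictly.\<close>
      have "cos (2 * pi / CARD('n)) < cos 0"
        using n by (intro cos_monotone_0_pi) (simp_all add: divide_simps)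
      then have "w \<noteq> 1"
        by (auto simp: w_def complex_eq_iff)
      then show ?thesis
        using that by (simp add: mat_eq_diag_mat vec_eq_iff)
    qed
    ultimately show "traceable ({0} \<times> SU_mats)"
      by (rule traceable_stabilizer_if_central)
    fix r :: real assume "r > 0"
    then show "\<exists>B \<delta>. \<delta> > 0 \<and> traceable (B \<times> {mat 1}) \<and> ball 0 \<delta> \<subseteq> B \<and> B \<subseteq> ball 0 r"
    proof (rule traceable_nbhds_if_axis_nbhds[of "{1, \<i>}", OF _ complex_spanned_by_1_i, rotated -1])
      fix i :: 'n and q and r :: real assume r: "r > 0"
      show "\<exists>B \<delta>. \<delta> > 0 \<and> traceable (B \<times> {mat 1}) \<and> (\<forall>b\<in>B. norm b \<le> r) \<and>
          (\<forall>t. \<bar>t\<bar> < \<delta> \<longrightarrow> t *\<^sub>R axis i q \<in> B)"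
      proof (rule axis_nbhd_if_bounded[OF unitary_entry_le_1 _ r])
        fix t :: real assume t: "\<bar>t\<bar> \<le> 1"
        obtain j where "j \<noteq> i"
          using exists_not_in_list[of "[i]"] n by auto
        then have j: "i \<noteq> j"
          by simp
        \<comment> \<open>A complex number of modulus \<open>1\<close> with real part
          \<open>t\<close>: it and its conjugate add up to \<open>2 * t\<close>.\<close>
        define z where "z = Complex t (sqrt (1 - t\<^sup>2))"
        have z: "z * cnj z = 1"
          using t by (simp add: z_def complex_eq_iff abs_square_le_1 flip: power2_eq_square)
        have "d i j w *v axis i q = axis i (w * q)" for w
          by (rule mult_axis_eq) (simp add: d_def)
        then have "d i j z *v axis i q + d i j (cnj z) *v axis i q = axis i (z * q) + axis i (cnj z * q)"
          by simp
        also have "\<dots> = (2 * t) *\<^sub>R axis i q"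
          by (simp add: vec_eq_iff axis_def z_def complex_eq_iff)
        finally show "\<exists>A\<in>SU_mats. \<exists>A'\<in>SU_mats. A *v axis i q + A' *v axis i q = (2 * t) *\<^sub>R axis i q"
          using d_SU[OF j z] d_SU[OF j, of "cnj z"] z by (auto simp: mult.commute)
      qed
    qed simp
  qed
qed

lemma rigid_within_Sp:
  fixes \<K> :: "'u topology set"
  assumes K: "almost_Polish \<K>"
    and cls: "in_class \<K> (affine_topology (Sp_mats :: (quat^'n::finite^'n) set))"
  shows "rigid_within \<K> (affine_group (Sp_mats :: (quat^'n^'n) set)) (affine_topology Sp_mats)"
proof (rule matrix_topgroup.rigid_within_affine[OF matrix_topgroup_Sp K cls])
  fix L :: "'u monoid" and S \<phi>
  assume aae: "affine_analytic_epi (Sp_mats :: (quat^'n^'n) set) qadjoint \<K> L S \<phi>"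
  then interpret affine_analytic_epi "Sp_mats :: (quat^'n^'n) set" qadjoint \<K> L S \<phi> .
  \<comment> \<open>No determinant condition has to be restored, so one coordinate may be changed
    alone, even in dimension one.\<close>
  define d where "d = (\<lambda>i z. diag_mat (\<lambda>k. if k = i then z else 1) :: quat^'n^'n)"
  have d_Sp: "d i z \<in> Sp_mats" if "z * qcnj z = 1" "qcnj z * z = 1" for i z
    using that by (simp add: d_def Sp_mats_def qadjoint_diag_mat diag_mat_mult)
      (simp add: mat_def vec_eq_iff)
  show "continuous_map S (affine_topology Sp_mats) \<phi> \<and> open_map S (affine_topology Sp_mats) \<phi>"
  proof (rule continuous_open_if_stabilizer)
    have "mat (- 1) \<in> (Sp_mats :: (quat^'n^'n) set)"
      by (simp add: Sp_mats_def mat_eq_diag_mat qadjoint_diag_mat diag_mat_mult)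
    then show "traceable ({0} \<times> Sp_mats)"
      by (rule traceable_stabilizer_if_minus_one)
    fix r :: real assume "r > 0"
    then show "\<exists>B \<delta>. \<delta> > 0 \<and> traceable (B \<times> {mat 1}) \<and> ball 0 \<delta> \<subseteq> B \<and> B \<subseteq> ball 0 r"
    proof (rule traceable_nbhds_if_axis_nbhds[of quat_units, OF _ quat_spanned_by_units, rotated -1])
      fix i :: 'n and q and r :: real assume r: "r > 0"
      show "\<exists>B \<delta>. \<delta> > 0 \<and> traceable (B \<times> {mat 1}) \<and> (\<forall>b\<in>B. norm b \<le> r) \<and>
          (\<forall>t. \<bar>t\<bar> < \<delta> \<longrightarrow> t *\<^sub>R axis i q \<in> B)"
      proof (rule axis_nbhd_if_bounded[OF quaternionic_unitary_entry_le_1 _ r])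
        fix t :: real assume t: "\<bar>t\<bar> \<le> 1"
        \<comment> \<open>\<open>z + qcnj z\<close> is the real number \<open>2 * t\<close> and so
          acts on each unit \<open>q\<close> as a scalar, although \<open>z\<close> itself need not
          commute with \<open>q\<close>.\<close>
        define z where "z = Quat t (sqrt (1 - t\<^sup>2)) 0 0"
        have z: "z * qcnj z = 1" "qcnj z * z = 1"
          using t by (simp_all add: z_def quat_eq_iff abs_square_le_1 flip: power2_eq_square)
        have "d i w *v axis i q = axis i (w * q)" for w
          by (rule mult_axis_eq) (simp add: d_def)
        then have "d i z *v axis i q + d i (qcnj z) *v axis i q = axis i (z * q) + axis i (qcnj z * q)"
          by simp
        also have "\<dots> = (2 * t) *\<^sub>R axis i q"
          by (simp add: vec_eq_iff axis_def z_def quat_eq_iff)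
        finally show "\<exists>A\<in>Sp_mats. \<exists>A'\<in>Sp_mats. A *v axis i q + A' *v axis i q = (2 * t) *\<^sub>R axis i q"
          using d_Sp[OF z] d_Sp[of "qcnj z"] z by auto
      qed
    qed (simp add: quat_units_def)
  qed
qed

lemma rigid_within_SpR:
  fixes \<K> :: "'u topology set"
  assumes K: "almost_Polish \<K>"
    and cls: "in_class \<K> (affine_topology (SpR_mats :: (real^('n::finite + 'n)^('n + 'n)) set))"
  shows "rigid_within \<K> (affine_group (SpR_mats :: (real^('n + 'n)^('n + 'n)) set)) (affine_topology SpR_mats)"
proof (rule matrix_topgroup.rigid_within_affine[OF matrix_topgroup_SpR K cls])
  fix L :: "'u monoid" and S \<phi>
  assume aae: "affine_analytic_epi (SpR_mats :: (real^('n + 'n)^('n + 'n)) set) matrix_inv \<K> L S \<phi>"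
  then interpret affine_analytic_epi "SpR_mats :: (real^('n + 'n)^('n + 'n)) set" matrix_inv \<K> L S \<phi> .
  \<comment> \<open>Reciprocal entries on each pair of conjugate coordinates preserve the form term
    by term. This covers both \<open>mat (- 1)\<close> and the torus.\<close>
  have diag: "diag_mat e \<in> (SpR_mats :: (real^('n + 'n)^('n + 'n)) set)" if "\<And>k. e (Inl k) * e (Inr k) = 1" for e
  proof -
    have eq: "e (Inl k) * x * (e (Inr k) * y) = x * y" "e (Inr k) * x * (e (Inl k) * y) = x * y" for k x y
      using that[of k] by (metis mult.assoc mult.commute mult.left_neutral)+
    have "symplectic_form (diag_mat e *v x) (diag_mat e *v y) = symplectic_form x y" for x y
      unfolding symplectic_form_def
    proof (rule sum.cong)
      fix k
      show "(diag_mat e *v x) $ Inl k * (diag_mat e *v y) $ Inr k - (diag_mat e *v x) $ Inr k * (diag_mat e *v y) $ Inl k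
          = x $ Inl k * y $ Inr k - x $ Inr k * y $ Inl k"
        unfolding diag_mat_mult_vec
        by (rule arg_cong2[where f = "(-)"]; rule eq)
    qed simp
    then show ?thesis
      by (simp add: SpR_mats_def)
  qed
  show "continuous_map S (affine_topology SpR_mats) \<phi> \<and> open_map S (affine_topology SpR_mats) \<phi>"
  proof (rule continuous_open_if_stabilizer)
    show "traceable ({0} \<times> SpR_mats)"
      by (rule traceable_stabilizer_if_minus_one) (simp add: mat_eq_diag_mat diag)
    show "\<exists>B \<delta>. \<delta> > 0 \<and> traceable (B \<times> {mat 1}) \<and> ball 0 \<delta> \<subseteq> B \<and> B \<subseteq> ball 0 r" if "r > 0" for r
    proof (rule torus_nbhds[OF aae _ that])
      \<comment> \<open>The second coordinate of the torus is the symplectic partner of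
        \<open>i\<close>.\<close>
      fix i :: "'n + 'n"
      show "\<exists>j. j \<noteq> i \<and> (\<forall>a. a \<noteq> 0 \<longrightarrow>
          diag_mat (\<lambda>k. if k = i then a else if k = j then 1 / a else 1) \<in> SpR_mats)"
      proof (cases i)
        case (Inl m)
        then show ?thesis
          by (intro exI[of _ "Inr m"]) (auto intro!: diag)
      next
        case (Inr m)
        then show ?thesis
          by (intro exI[of _ "Inl m"]) (auto intro!: diag)
      qed
    qed
  qed
qed

lemma SL_torus:
  assumes n: "CARD('n::finite) \<ge> 2"
  shows "\<exists>j. j \<noteq> i \<and> (\<forall>a. a \<noteq> 0 \<longrightarrow>
      diag_mat (\<lambda>k. if k = i then a else if k = j then 1 / a else 1) \<in> (SL_mats :: (real^'n^'n) set))"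
proof -
  obtain j where "j \<noteq> i"
    using exists_not_in_list[of "[i]"] n by auto
  then show ?thesis
    by (intro exI[of _ j]) (simp add: SL_mats_def det_diag_mat prod_delta2)
qed

lemma rigid_within_GL:
  fixes \<K> :: "'u topology set"
  assumes K: "almost_Polish \<K>" and n: "CARD('n::finite) \<ge> 2"
    and cls: "in_class \<K> (affine_topology (GL_mats :: (real^'n^'n) set))"
  shows "rigid_within \<K> (affine_group (GL_mats :: (real^'n^'n) set)) (affine_topology GL_mats)"
proof (rule matrix_topgroup.rigid_within_affine[OF matrix_topgroup_GL K cls])
  fix L :: "'u monoid" and S \<phi>
  assume aae: "affine_analytic_epi (GL_mats :: (real^'n^'n) set) matrix_inv \<K> L S \<phi>"
  then interpret affine_analytic_epi "GL_mats :: (real^'n^'n) set" matrix_inv \<K> L S \<phi> .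
  have sub: "SL_mats \<subseteq> (GL_mats :: (real^'n^'n) set)"
    by (auto simp: SL_mats_def GL_mats_def invertible_det_nz)
  show "continuous_map S (affine_topology GL_mats) \<phi> \<and> open_map S (affine_topology GL_mats) \<phi>"
  proof (rule continuous_open_if_stabilizer)
    show "traceable ({0} \<times> GL_mats)"
      by (rule traceable_stabilizer_if_minus_one)
        (simp add: GL_mats_def invertible_det_nz mat_eq_diag_mat det_diag_mat)
    show "\<exists>B \<delta>. \<delta> > 0 \<and> traceable (B \<times> {mat 1}) \<and> ball 0 \<delta> \<subseteq> B \<and> B \<subseteq> ball 0 r" if "r > 0" for r
      using SL_torus[OF n] sub by (intro torus_nbhds[OF aae _ that]) blast
  qed
qed

text \<open>
  The centralizer of a diagonal matrix without eigenvalue \<open>1\<close> fixes the origin and contains the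
  diagonal torus, under which the transvections with entries \<open>1\<close> and \<open>- 1\<close> become all transvections.
\<close>

lemma rigid_within_SL:
  fixes \<K> :: "'u topology set"
  assumes K: "almost_Polish \<K>" and n: "CARD('n::finite) \<ge> 2"
    and cls: "in_class \<K> (affine_topology (SL_mats :: (real^'n^'n) set))"
  shows "rigid_within \<K> (affine_group (SL_mats :: (real^'n^'n) set)) (affine_topology SL_mats)"
proof (rule matrix_topgroup.rigid_within_affine[OF matrix_topgroup_SL K cls])
  fix L :: "'u monoid" and S \<phi>
  assume aae: "affine_analytic_epi (SL_mats :: (real^'n^'n) set) matrix_inv \<K> L S \<phi>"
  then interpret affine_analytic_epi "SL_mats :: (real^'n^'n) set" matrix_inv \<K> L S \<phi> .
  have nbhds: "\<exists>B \<delta>. \<delta> > 0 \<and> traceable (B \<times> {mat 1}) \<and> ball 0 \<delta> \<subseteq> B \<and> B \<subseteq> ball 0 r" if "r > 0" for r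
    using SL_torus[OF n] by (intro torus_nbhds[OF aae _ that]) blast
  obtain k0 :: 'n where True
    by simp
  \<comment> \<open>The value that gives \<open>diag_mat e\<close> determinant \<open>1\<close> when
    its other \<open>CARD('n) - 1\<close> entries are \<open>2\<close>; no entry is then equal to
    \<open>1\<close>.\<close>
  define c where "c = (1 / 2 :: real) ^ (CARD('n) - 1)"
  define e where "e = (\<lambda>k :: 'n. if k = k0 then c else 2)"
  have "c < 1"
  proof -
    obtain m where "CARD('n) - 1 = Suc m"
      using n by (metis Suc_diff_le diff_Suc_Suc diff_zero numeral_2_eq_2 One_nat_def)
    then show ?thesis
      by (simp only: c_def) (rule power_Suc_less_one; simp)
  qed
  then have e1: "e k \<noteq> 1" for k
    by (simp add: e_def)
  have "prod e UNIV = c * (\<Prod>k\<in>UNIV - {k0}. 2)"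
    by (subst prod.remove[of UNIV k0]) (auto simp: e_def intro!: prod.cong)
  also have "\<dots> = 1"
    by (simp add: c_def card_Diff_singleton power_one_over)
  finally have z: "diag_mat e \<in> SL_mats"
    by (simp add: SL_mats_def det_diag_mat)
  define C where "C = {x \<in> carrier \<G>. x \<otimes>\<^bsub>\<G>\<^esub> (0, diag_mat e) = (0, diag_mat e) \<otimes>\<^bsub>\<G>\<^esub> x}"
  have C: "traceable C"
    unfolding C_def by (rule traceable_centralizer) (simp add: carrier_affine z)
  have C_sub: "C \<subseteq> {0} \<times> SL_mats"
    using e1 by (auto simp: C_def carrier_affine mult_affine vec_eq_iff)
  have C_diag: "(0, diag_mat d) \<in> C" if "prod d UNIV = 1" for d
  proof -
    have "diag_mat d \<in> SL_mats"
      using that by (simp add: SL_mats_def det_diag_mat)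
    then show ?thesis
      by (simp add: C_def carrier_affine mult_affine diag_mat_mult mult.commute)
  qed
  \<comment> \<open>\<open>C\<close> may be larger than the diagonal torus. The additional
    conjugates do no harm, since they still lie in the stabilizer of the origin.\<close>
  define T where "T = (\<lambda>(m :: 'n, l, s). (\<lambda>x. x \<otimes>\<^bsub>\<G>\<^esub> (0, transvection m l s) \<otimes>\<^bsub>\<G>\<^esub> inv\<^bsub>\<G>\<^esub> x) ` C)"
  define I where "I = {(m :: 'n, l :: 'n, s :: real). m \<noteq> l \<and> s \<in> {1, - 1}}"
  have trans_SL: "transvection m l s \<in> SL_mats" if "m \<noteq> l" for m l :: 'n and s
    using that by (simp add: SL_mats_def det_transvection)
  have conj: "(0, A) \<otimes>\<^bsub>\<G>\<^esub> (0, B) \<otimes>\<^bsub>\<G>\<^esub> inv\<^bsub>\<G>\<^esub> (0, A) = (0, A ** B ** matrix_inv A)"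
    if "A \<in> SL_mats" for A B
    using that by (simp add: mult_affine inv_affine)
  have "\<exists>\<S>. countable \<S> \<and> (\<forall>E\<in>\<S>. traceable E) \<and> \<Union>\<S> = {0} \<times> SL_mats"
  proof (rule traceable_stabilizer_if_generated[of "insert C (T ` I)"])
    have "finite I"
      by (rule finite_subset[of _ "UNIV \<times> UNIV \<times> {1, - 1}"]) (auto simp: I_def)
    then show "countable (insert C (T ` I))"
      by (simp add: countable_finite)
    show "traceable E" if "E \<in> insert C (T ` I)" for E
      using that C trans_SL by (auto simp: T_def I_def carrier_affine intro!: traceable_image_conj)
    show "E \<subseteq> {0} \<times> SL_mats" if mem: "E \<in> insert C (T ` I)" for E
    proof (cases "E = C")
      case False
      then obtain m l s where E: "m \<noteq> l" "E = T (m, l, s)"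
        using mem by (auto simp: I_def)
      show ?thesis
      proof
        fix y assume "y \<in> E"
        then obtain A where A: "A \<in> SL_mats"
          "y = (0, A) \<otimes>\<^bsub>\<G>\<^esub> (0, transvection m l s) \<otimes>\<^bsub>\<G>\<^esub> inv\<^bsub>\<G>\<^esub> (0, A)"
          using C_sub by (auto simp: E(2) T_def)
        then show "y \<in> {0} \<times> SL_mats"
          unfolding A(2) conj[OF A(1)] using E(1) A(1) by (auto intro!: mult_mem trans_SL J_mem)
      qed
    qed (use C_sub in simp)
    fix \<Gamma> :: "(real^'n^'n) set"
    assume \<Gamma>: "mat 1 \<in> \<Gamma>" "\<And>A B. A \<in> \<Gamma> \<Longrightarrow> B \<in> \<Gamma> \<Longrightarrow> A ** B \<in> \<Gamma>"
      "\<And>E A. E \<in> insert C (T ` I) \<Longrightarrow> (0, A) \<in> E \<Longrightarrow> A \<in> \<Gamma>"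
    show "SL_mats \<subseteq> \<Gamma>"
    proof (rule SL_mats_subset_monoid[OF \<Gamma>(1,2)])
      show "diag_mat d \<in> \<Gamma>" if "prod d UNIV = 1" for d
        using \<Gamma>(3) C_diag[OF that] by blast
      show "transvection m l s \<in> \<Gamma>" if ml: "m \<noteq> l" for m l s
      proof (cases "s = 0")
        case True
        then have "transvection m l s = mat 1"
          using ml by (auto simp: vec_eq_iff mat_def)
        then show ?thesis
          using \<Gamma>(1) by simp
      next
        case False
        \<comment> \<open>Conjugation by \<open>diag_mat d\<close> multiplies the off-diagonal entry
          by \<open>a / (1 / a)\<close>, the positive number \<open>\<bar>s\<bar>\<close>. The sign
          has to come from the transvection itself, which is why \<open>I\<close> contains both
          signs.\<close>
        define a where "a = sqrt \<bar>s\<bar>"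
        have a: "a \<noteq> 0" "a * (sgn s * a) = s"
          using False by (simp_all add: a_def sgn_mult_abs mult.left_commute)
        define d where "d = (\<lambda>k. if k = m then a else if k = l then 1 / a else 1)"
        have d: "prod d UNIV = 1"
          unfolding d_def using ml a(1) by (simp add: prod_delta2)
        then have dSL: "diag_mat d \<in> SL_mats"
          by (simp add: SL_mats_def det_diag_mat)
        have "diag_mat d ** transvection m l (sgn s) = transvection m l s ** diag_mat d"
          using ml a by (auto simp: vec_eq_iff diag_mat_mult_left diag_mat_mult_right d_def field_simps)
        then have "diag_mat d ** transvection m l (sgn s) ** matrix_inv (diag_mat d) = transvection m l s"
          using J_right[OF dSL] by (metis matrix_mul_assoc matrix_mul_rid)
        then have "(0, transvection m l s) \<in> T (m, l, sgn s)"
          using C_diag[OF d] conj[OF dSL, of "transvection m l (sgn s)"] unfolding T_def by force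
        moreover have "(m, l, sgn s) \<in> I"
          using ml False by (simp add: I_def sgn_if)
        ultimately show ?thesis
          using \<Gamma>(3) by blast
      qed
    qed
  qed
  then show "continuous_map S (affine_topology SL_mats) \<phi> \<and> open_map S (affine_topology SL_mats) \<phi>"
    using continuous_open[OF nbhds] by blast
qed

theorem theorem5p6:
  fixes \<K> :: "'u topology set"
  assumes "almost_Polish \<K>"
  shows
    "(CARD('n::finite) \<ge> 3 \<longrightarrow>
        in_class \<K> (affine_topology (O_mats :: (real^'n^'n) set)) \<longrightarrow>
        rigid_within \<K> (affine_group (O_mats :: (real^'n^'n) set))
          (affine_topology (O_mats :: (real^'n^'n) set))) \<and>
     (CARD('n) \<ge> 4 \<longrightarrow>
        in_class \<K> (affine_topology (SO_mats :: (real^'n^'n) set)) \<longrightarrow>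
        rigid_within \<K> (affine_group (SO_mats :: (real^'n^'n) set))
          (affine_topology (SO_mats :: (real^'n^'n) set))) \<and>
     (CARD('n) \<ge> 2 \<longrightarrow>
        in_class \<K> (affine_topology (SU_mats :: (complex^'n^'n) set)) \<longrightarrow>
        rigid_within \<K> (affine_group (SU_mats :: (complex^'n^'n) set))
          (affine_topology (SU_mats :: (complex^'n^'n) set))) \<and>
     (CARD('n) \<ge> 1 \<longrightarrow>
        in_class \<K> (affine_topology (Sp_mats :: (quat^'n^'n) set)) \<longrightarrow>
        rigid_within \<K> (affine_group (Sp_mats :: (quat^'n^'n) set))
          (affine_topology (Sp_mats :: (quat^'n^'n) set))) \<and>
     (CARD('n) \<ge> 1 \<longrightarrow>
        in_class \<K> (affine_topology (SpR_mats :: (real^('n + 'n)^('n + 'n)) set)) \<longrightarrow>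
        rigid_within \<K> (affine_group (SpR_mats :: (real^('n + 'n)^('n + 'n)) set))
          (affine_topology (SpR_mats :: (real^('n + 'n)^('n + 'n)) set))) \<and>
     (CARD('n) \<ge> 2 \<longrightarrow>
        in_class \<K> (affine_topology (SL_mats :: (real^'n^'n) set)) \<longrightarrow>
        rigid_within \<K> (affine_group (SL_mats :: (real^'n^'n) set))
          (affine_topology (SL_mats :: (real^'n^'n) set))) \<and>
     (CARD('n) \<ge> 2 \<longrightarrow>
        in_class \<K> (affine_topology (GL_mats :: (real^'n^'n) set)) \<longrightarrow>
        rigid_within \<K> (affine_group (GL_mats :: (real^'n^'n) set))
          (affine_topology (GL_mats :: (real^'n^'n) set)))"
  by (intro conjI impI rigid_within_O[OF assms] rigid_within_SO[OF assms] rigid_within_SU[OF assms]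
      rigid_within_Sp[OF assms] rigid_within_SpR[OF assms] rigid_within_SL[OF assms]
      rigid_within_GL[OF assms]) simp_all

end
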